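(* Let $\Phi(z)\in\mathbb{R}(z)^{n\times n}$ be a spectrum of normal rank $r\neq 0$. Then there exists a matrix $W(z)\in\mathbb{R}(z)^{r\times n}$ such that: (1) $\Phi(z)=W^*(z)W(z)$. (2) $W(z)$ is analytic in $\{z\in\overline{\mathbb{C}}:|z|>1\}$ and has a right inverse $W^{-R}(z)$ analytic in $\{z\in\overline{\mathbb{C}}:|z|>1\}$. (3) $W(z)$ is unique up to a constant orthogonal matrix multiplier on the left, i.e., if $W_1(z)\in\mathbb{R}(z)^{r\times n}$ also satisfies (1) and (2), then $W_1(z)=TW(z)$ where $T\in\mathbb{R}^{r\times r}$ is orthogonal. (4) Any factorization of the form $\Phi(z)=L^*(z)L(z)$ in which $L(z)\in\mathbb{R}(z)^{r\times n}$ is analytic in $\{z\in\overline{\mathbb{C}}:|z|>1\}$ has the form $L(z)=V(z)W(z)$, where $V(z)\in\mathbb{R}(z)^{r\times r}$ is a para-unitary matrix analytic in $\{z\in\overline{\mathbb{C}}:|z|>1\}$. Conversely, any $L(z)=V(z)W(z)$, where $V(z)\in\mathbb{R}(z)^{r\times r}$ is a para-unitary matrix analytic in $\{z\in\overline{\mathbb{C}}:|z|>1\}$, is a spectral factor of $\Phi(z)$ (i.e. $\Phi(z)=L^*(z)L(z)$) analytic in $\{z\in\overline{\mathbb{C}}:|z|>1\}$. (5) If $\Phi(z)$ is analytic on the unit circle, then $W(z)$ is analytic in $\{z\in\overline{\mathbb{C}}:|z|\geq 1\}$. (6) If $\Phi(z)$ is analytic on the unit circle and the rank of $\Phi(z)$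 is constant on the unit circle, then $W(z)$ is analytic in $\{z\in\overline{\mathbb{C}}:|z|\geq 1\}$ and has a right inverse $W^{-R}(z)$ analytic in $\{z\in\overline{\mathbb{C}}:|z|\geq 1\}$. (7) $W(z)$ satisfying (1) and (2) is stochastically minimal, i.e., the McMillan degree of $W(z)$ is one half of the McMillan degree of $\Phi(z)$.
   Context: $\mathbb{R}(z)^{m\times n}$ is the set of $m\times n$ matrices of real rational functions, and $\overline{\mathbb{C}}=\mathbb{C}\cup\{\infty\}$ (with $|\infty|>1$). For a rational matrix $G(z)$, $G^*(z):=G^\top(z^{-1})$. The normal rank of $G(z)$ is its rank for almost every $z\in\mathbb{C}$. A rational matrix $\Phi(z)\in\mathbb{R}(z)^{n\times n}$ is a spectrum if $\Phi(z)=\Phi^*(z)$ and $\Phi(e^{j\omega})$ is positive semi-definite for all $\omega\in[0,2\pi)$ at which it is defined. A rational matrix $G(z)\in\mathbb{R}(z)^{n\times n}$ is para-unitary if $G^*(z)G(z)=G(z)G^*(z)=I_n$. A rational matrix is analytic in a set $\mathbb{T}\subseteq\overline{\mathbb{C}}$ (open or not) if none of its entries has a pole in $\mathbb{T}$ (the point $\infty$ included when it belongs to $\mathbb{T}$). A right inverse of $W(z)\in\mathbb{R}(z)^{r\times n}$ is a matrix $W^{-R}(z)\in\mathbb{R}(z)^{n\times r}$ with $W(z)W^{-R}(z)=I_r$. The McMillan degree of $G(z)$ is the sum, over all distinct poles $p\in\overline{\mathbb{C}}$ of $G(z)$ (including a possible pole at infinity), of $\delta(G;p)$, where $\delta(G;p)$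 is the largest multiplicity that $p$ possesses as a pole of any minor of $G(z)$. *)

theory Defs
  imports
    "HOL-Analysis.Lebesgue_Measure"
    "HOL-Computational_Algebra.Normalized_Fraction"
    "HOL-Computational_Algebra.Polynomial_Factorial"
    "HOL-Computational_Algebra.Field_as_Ring"
    "Jordan_Normal_Form.Schur_Decomposition"
    "Jordan_Normal_Form.DL_Rank"
    "Jordan_Normal_Form.DL_Submatrix"
begin

section \<open>Real rational functions\<close>

type_synonym ratfun = "real poly fract"

text \<open>Numerator and denominator in lowest terms (the denominator is monic).\<close>

definition numer :: "ratfun \<Rightarrow> real poly" where
  "numer f = fst (quot_of_fract f)"

definition denom :: "ratfun \<Rightarrow> real poly" where
  "denom f = snd (quot_of_fract f)"

definition rat_const :: "real \<Rightarrow> ratfun" where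
  "rat_const c = to_fract [:c:]"

text \<open>The rational function \<open>f(g(z))\<close>; it is used only for the nonconstant \<open>g(z) = 1/z\<close>,
  for which the denominator below does not vanish.\<close>

definition rat_comp :: "ratfun \<Rightarrow> ratfun \<Rightarrow> ratfun" where
  "rat_comp f g = poly (map_poly rat_const (numer f)) g / poly (map_poly rat_const (denom f)) g"

definition rat_z :: ratfun where
  "rat_z = to_fract [:0, 1:]"

text \<open>The value of \<open>f\<close> at \<open>z\<close>, meaningful when \<open>z\<close> is not a pole of \<open>f\<close>.\<close>

definition rat_eval :: "ratfun \<Rightarrow> complex \<Rightarrow> complex" where
  "rat_eval f z = poly (map_poly complex_of_real (numer f)) z / poly (map_poly complex_of_real (denom f)) z"

section \<open>Poles in the extended complex plane\<close>

datatype xcomplex = Fin complex | Infty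

fun xnorm :: "xcomplex \<Rightarrow> ereal" where
  "xnorm (Fin z) = ereal (cmod z)"
| "xnorm Infty = \<infinity>"

text \<open>Multiplicity of a point as a pole, with value \<open>0\<close> if the point is not a pole.  As numerator
  and denominator are coprime, a finite pole is a zero of the denominator; at infinity the
  truncated difference of the degrees counts.\<close>

fun pole_mult :: "ratfun \<Rightarrow> xcomplex \<Rightarrow> nat" where
  "pole_mult f (Fin z) = order z (map_poly complex_of_real (denom f))"
| "pole_mult f Infty = degree (numer f) - degree (denom f)"

definition is_pole_of :: "ratfun mat \<Rightarrow> xcomplex \<Rightarrow> bool" where
  "is_pole_of G p \<longleftrightarrow> (\<exists>i < dim_row G. \<exists>j < dim_col G. pole_mult (G $$ (i, j)) p > 0)"

definition rm_analytic :: "ratfun mat \<Rightarrow> xcomplex set \<Rightarrow> bool" where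
  "rm_analytic G T \<longleftrightarrow> (\<forall>p \<in> T. \<not> is_pole_of G p)"

definition outside_disc :: "xcomplex set" where
  "outside_disc = {p. xnorm p > 1}"

definition closed_outside_disc :: "xcomplex set" where
  "closed_outside_disc = {p. xnorm p \<ge> 1}"

definition unit_circle :: "xcomplex set" where
  "unit_circle = {p. xnorm p = 1}"

section \<open>Rational matrices\<close>

definition rm_eval :: "ratfun mat \<Rightarrow> complex \<Rightarrow> complex mat" where
  "rm_eval G z = map_mat (\<lambda>f. rat_eval f z) G"

text \<open>\<open>para_conj G\<close> is \<open>G\<^sup>*(z) = G\<^sup>T(1/z)\<close>.\<close>

definition para_conj :: "ratfun mat \<Rightarrow> ratfun mat" where
  "para_conj G = transpose_mat (map_mat (\<lambda>f. rat_comp f (inverse rat_z)) G)"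

definition para_unitary :: "nat \<Rightarrow> ratfun mat \<Rightarrow> bool" where
  "para_unitary n G \<longleftrightarrow> G \<in> carrier_mat n n \<and> para_conj G * G = 1\<^sub>m n \<and> G * para_conj G = 1\<^sub>m n"

definition cmat_rank :: "complex mat \<Rightarrow> nat" where
  "cmat_rank A = vec_space.rank (dim_row A) A"

definition has_normal_rank :: "ratfun mat \<Rightarrow> nat \<Rightarrow> bool" where
  "has_normal_rank G r \<longleftrightarrow>
    (AE z in lborel. \<not> is_pole_of G (Fin z) \<and> cmat_rank (rm_eval G z) = r)"

definition pos_semidef :: "nat \<Rightarrow> complex mat \<Rightarrow> bool" where
  "pos_semidef n A \<longleftrightarrow> A \<in> carrier_mat n n \<and> mat_adjoint A = A \<and>
    (\<forall>v \<in> carrier_vec n. Re ((A *\<^sub>v v) \<bullet>c v) \<ge> 0)"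

definition is_spectrum :: "nat \<Rightarrow> ratfun mat \<Rightarrow> bool" where
  "is_spectrum n \<Phi> \<longleftrightarrow> \<Phi> \<in> carrier_mat n n \<and> \<Phi> = para_conj \<Phi> \<and>
    (\<forall>\<omega> \<in> {0..<2 * pi}. \<not> is_pole_of \<Phi> (Fin (cis \<omega>)) \<longrightarrow> pos_semidef n (rm_eval \<Phi> (cis \<omega>)))"

definition has_analytic_right_inverse :: "nat \<Rightarrow> nat \<Rightarrow> ratfun mat \<Rightarrow> xcomplex set \<Rightarrow> bool" where
  "has_analytic_right_inverse r n W T \<longleftrightarrow>
    (\<exists>R \<in> carrier_mat n r. W * R = 1\<^sub>m r \<and> rm_analytic R T)"

definition real_orthogonal :: "nat \<Rightarrow> real mat \<Rightarrow> bool" where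
  "real_orthogonal r T \<longleftrightarrow> T \<in> carrier_mat r r \<and>
    transpose_mat T * T = 1\<^sub>m r \<and> T * transpose_mat T = 1\<^sub>m r"

section \<open>McMillan degree\<close>

text \<open>The empty minor (\<open>I = J = {}\<close>) equals \<open>1\<close> and has no poles, so including it does not change
  the maximum.\<close>

definition pole_degree :: "ratfun mat \<Rightarrow> xcomplex \<Rightarrow> nat" where
  "pole_degree G p = Max {pole_mult (det (submatrix G I J)) p | I J.
     I \<subseteq> {..<dim_row G} \<and> J \<subseteq> {..<dim_col G} \<and> card I = card J}"

definition mcmillan_degree :: "ratfun mat \<Rightarrow> nat" where
  "mcmillan_degree G = (\<Sum>p \<in> {p. is_pole_of G p}. pole_degree G p)"

section \<open>Spectral factors\<close>

definition is_spectral_factor :: "ratfun mat \<Rightarrow> ratfun mat \<Rightarrow> bool" where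
  "is_spectral_factor \<Phi> W \<longleftrightarrow> \<Phi> = para_conj W * W"

definition is_outer_factor :: "nat \<Rightarrow> nat \<Rightarrow> ratfun mat \<Rightarrow> ratfun mat \<Rightarrow> bool" where
  "is_outer_factor r n \<Phi> W \<longleftrightarrow> W \<in> carrier_mat r n \<and> is_spectral_factor \<Phi> W \<and>
    rm_analytic W outside_disc \<and> has_analytic_right_inverse r n W outside_disc"

end

(*
  Write f^*(z) = f(1/z).  Scalar Fejer-Riesz factorization shows that v^* Phi v = h^* h for every
  rational vector v, so Gram-Schmidt over the field R(z) gives some factorization Phi = L^* L with
  L right invertible, and evaluation at a generic point identifies the number of rows of L with
  the normal rank.  To make L outer, replace z by 1/z and clear the poles in the disc by a scalar
  all-pass factor.  The polynomial vectors in the module generated by the columns of L over the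
  functions regular in the disc form a module M with p R[z]^r <= M <= R[z]^r, where p has all its
  roots in the disc.  As in the Beurling-Lax theorem, M is generated by r orthonormal wandering
  vectors; a dimension count finds them among the vectors of degree at most deg p, divided by the
  reversal of p.  They are the columns of the para-unitary factor.

  On the unit circle a sum of terms f^* f is a sum of squares, so poles cannot cancel.  This gives
  the regularity of W on the circle, the constancy of para-unitary matrices without poles off the
  circle, and, together with the Cauchy-Binet formula, the local identity
  delta(Phi; p) = delta(W; p) + delta(W; 1/p) behind the statement on McMillan degrees.
*)
theory Submission
  imports Defs
begin

section \<open>Pole multiplicities and the reflection z -> 1/z\<close>

text \<open>All functions have real coefficients, so roots are split off in conjugate pairs, and
  only from regions closed under conjugation. Polynomials are regular in the disc but not at
  infinity; this is why the exterior is exchanged with the disc before a module over polynomials is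
  formed. The circle belongs to neither region: \<Phi> and W may have poles there, and only
  positivity controls them. The dimension count closes for the following reason. Divisibility of all
  pairings by p, tested by one nondegenerate functional on the residues modulo p, costs as many
  linear conditions as the dimension of M modulo multiples of p, while the space of candidates is
  larger by r. Orthonormality in the sense of \<open>para_conj\<close> need not be imposed entry by
  entry: a Gram entry of two wandering vectors is divisible by p and by its reversal, so it is a
  constant, and that constant is a euclidean inner product of coefficients.\<close>

abbreviation cpoly :: "real poly \<Rightarrow> complex poly" where
  "cpoly \<equiv> map_poly complex_of_real"

abbreviation ceval :: "real poly \<Rightarrow> complex \<Rightarrow> complex" where
  "ceval p \<equiv> poly (cpoly p)"

interpretation cpoly: map_poly_inj_idom_divide_hom complex_of_real ..

lemma denom_nonzero [simp]: "denom f \<noteq> 0"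
  by (simp add: denom_def)

lemma numer_eq_0_iff [simp]: "numer f = 0 \<longleftrightarrow> f = 0"
  by (simp add: numer_def)

lemma numer_denom: "f = to_fract (numer f) / to_fract (denom f)"
proof -
  have "to_fract (numer f) / to_fract (denom f) = Fract (numer f) (denom f)"
    by (simp add: to_fract_def divide_fract_def eq_fract)
  then show ?thesis by (simp add: numer_def denom_def)
qed

lemma coprime_numer_denom: "coprime (numer f) (denom f)"
  by (simp add: numer_def denom_def coprime_quot_of_fract)

lemma ratfun_cases:
  fixes f :: ratfun
  obtains a b where "b \<noteq> 0" "f = to_fract a / to_fract b"
  by (rule that[OF denom_nonzero numer_denom])

lemma numer_cross:
  assumes "f = to_fract a / to_fract b" "b \<noteq> 0"
  shows "numer f * b = a * denom f"
proof -
  have "to_fract (numer f) / to_fract (denom f) = to_fract a / to_fract b"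
    using assms(1) numer_denom[of f] by (rule trans[OF sym, rotated])
  then have "to_fract (numer f) * to_fract b = to_fract a * to_fract (denom f)"
    using assms by (simp add: frac_eq_eq)
  then show ?thesis by (simp flip: to_fract_mult)
qed

lemma coprime_no_common_root:
  fixes a b :: "real poly"
  assumes "coprime a b"
  shows "ceval a z \<noteq> 0 \<or> ceval b z \<noteq> 0"
proof -
  obtain u v where "u * a + v * b = 1"
    using assms bezout_coefficients_fst_snd[of a b] by (metis coprime_iff_gcd_eq_1)
  then have "ceval (u * a + v * b) z = 1" by simp
  then show ?thesis by (auto simp: hom_distribs)
qed

text \<open>Common factors shift the orders of numerator and denominator equally, and in lowest
  terms one of the two orders is 0; so the truncated difference can be read off from any
  representation.\<close>

lemma pole_mult_Fin_quot:
  assumes "f = to_fract a / to_fract b" "a \<noteq> 0" "b \<noteq> 0"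
  shows "pole_mult f (Fin z) = order z (cpoly b) - order z (cpoly a)"
proof -
  have eq: "cpoly (numer f) * cpoly b = cpoly a * cpoly (denom f)"
    using numer_cross[OF assms(1,3)] by (metis cpoly.hom_mult)
  have nz: "cpoly b \<noteq> 0" "cpoly a \<noteq> 0" "cpoly (denom f) \<noteq> 0" "cpoly (numer f) \<noteq> 0"
    using assms by auto
  have "order z (cpoly (numer f)) + order z (cpoly b) = order z (cpoly a) + order z (cpoly (denom f))"
    using arg_cong[OF eq, of "order z"] nz by (simp add: order_mult)
  moreover have "order z (cpoly (numer f)) = 0 \<or> order z (cpoly (denom f)) = 0"
    using coprime_no_common_root[OF coprime_numer_denom, of f z] by (auto dest: order_0I)
  ultimately show ?thesis by auto
qed

lemma pole_mult_Infty_quot: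
  assumes "f = to_fract a / to_fract b" "a \<noteq> 0" "b \<noteq> 0"
  shows "pole_mult f Infty = degree a - degree b"
proof -
  have eq: "numer f * b = a * denom f"
    using numer_cross[OF assms(1,3)] .
  have "degree (numer f) + degree b = degree a + degree (denom f)"
    using eq assms degree_mult_eq[of "numer f" b] degree_mult_eq[of a "denom f"] by auto
  then show ?thesis by auto
qed

lemma numer_denom_0 [simp]: "numer 0 = 0" "denom 0 = 1"
  by (simp_all add: numer_def denom_def)

lemma pole_mult_0 [simp]: "pole_mult 0 p = 0"
  by (cases p) simp_all

declare pole_mult.simps [simp del]

section \<open>The involution f(z) -> f(1/z) of the field of rational functions\<close>

definition recip_eval :: "real poly \<Rightarrow> ratfun" where
  "recip_eval a = poly (map_poly rat_const a) (inverse rat_z)"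

definition star :: "ratfun \<Rightarrow> ratfun" where
  "star f = rat_comp f (inverse rat_z)"

lemma rat_const_hom [simp]:
  "rat_const 0 = 0" "rat_const 1 = 1"
  "rat_const (a + b) = rat_const a + rat_const b"
  "rat_const (a - b) = rat_const a - rat_const b"
  "rat_const (a * b) = rat_const a * rat_const b"
  "rat_const (- a) = - rat_const a"
  by (simp_all add: rat_const_def one_pCons[symmetric] flip: to_fract_add to_fract_mult to_fract_diff to_fract_uminus)

interpretation rat_const: map_poly_comm_ring_hom rat_const
  by unfold_locales simp_all

lemma rat_z_nonzero [simp]: "rat_z \<noteq> 0"
  by (simp add: rat_z_def)

lemma rat_z_power: "rat_z ^ n = to_fract (monom 1 n)"
  by (induction n) (simp_all add: rat_z_def monom_Suc flip: to_fract_mult)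

lemma recip_eval_hom:
  "recip_eval (a + b) = recip_eval a + recip_eval b"
  "recip_eval (a * b) = recip_eval a * recip_eval b"
  by (simp_all add: recip_eval_def hom_distribs)

lemma recip_eval_pCons: "recip_eval (pCons c a) = rat_const c + recip_eval a / rat_z"
  by (cases "c = 0 \<and> a = 0") (auto simp: recip_eval_def map_poly_pCons field_simps)

lemma recip_eval_0 [simp]: "recip_eval 0 = 0"
  by (simp add: recip_eval_def)

lemma recip_eval_reflect: "recip_eval a * rat_z ^ degree a = to_fract (reflect_poly a)"
proof (induction a)
  case 0
  then show ?case by (simp add: recip_eval_def)
next
  case (pCons c a)
  show ?case
  proof (cases "a = 0")
    case True
    then show ?thesis by (simp add: recip_eval_pCons rat_const_def)
  next
    case False
    then have "recip_eval (pCons c a) * rat_z ^ degree (pCons c a)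
       = rat_const c * rat_z ^ Suc (degree a) + recip_eval a * rat_z ^ degree a"
      by (simp add: recip_eval_pCons field_simps)
    also have "\<dots> = to_fract (monom c (Suc (degree a))) + to_fract (reflect_poly a)"
      unfolding pCons.IH unfolding rat_z_power
      by (simp add: rat_const_def smult_monom flip: to_fract_mult)
    finally show ?thesis using False by (simp add: reflect_poly_pCons' algebra_simps flip: to_fract_add)
  qed
qed

lemma recip_eval_conv: "recip_eval a = to_fract (reflect_poly a) / rat_z ^ degree a"
  using recip_eval_reflect[of a] by (simp add: eq_divide_eq)

lemma recip_eval_eq_0_iff [simp]: "recip_eval a = 0 \<longleftrightarrow> a = 0"
  by (simp add: recip_eval_conv)

text \<open>\<open>rat_comp\<close> refers to lowest terms. Cross-multiplication frees it from that
  representation, after which additivity and multiplicativity of \<open>star\<close> are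
  computations with quotients.\<close>

lemma star_quot:
  assumes "b \<noteq> 0"
  shows "star (to_fract a / to_fract b) = recip_eval a / recip_eval b"
proof -
  let ?f = "to_fract a / to_fract b"
  have "recip_eval (numer ?f) * recip_eval b = recip_eval a * recip_eval (denom ?f)"
    using numer_cross[OF refl assms, of a] by (metis recip_eval_hom(2))
  then show ?thesis using assms
    by (simp add: star_def rat_comp_def flip: recip_eval_def) (simp add: field_simps)
qed

lemma star_0 [simp]: "star 0 = 0" 
  using star_quot[of 1 0] by simp

lemma star_to_fract: "star (to_fract a) = recip_eval a"
proof -
  have "recip_eval 1 = 1" by (simp add: recip_eval_def)
  then show ?thesis using star_quot[of 1 a] by simp
qed

lemma star_1 [simp]: "star 1 = 1"
  using star_to_fract[of 1] by (simp add: recip_eval_def)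

lemma star_const [simp]: "star (rat_const c) = rat_const c"
  unfolding rat_const_def star_to_fract by (simp add: recip_eval_pCons rat_const_def)

lemma star_rat_z: "star rat_z = 1 / rat_z"
  unfolding rat_z_def star_to_fract by (simp add: recip_eval_pCons flip: rat_z_def)

lemma star_mult [simp]: "star (f * g) = star f * star g"
proof -
  obtain a b c d where "b \<noteq> 0" "f = to_fract a / to_fract b" "d \<noteq> 0" "g = to_fract c / to_fract d"
    by (metis ratfun_cases)
  then show ?thesis
    using star_quot[of "b * d" "a * c"] by (simp add: star_quot recip_eval_hom)
qed

lemma star_add [simp]: "star (f + g) = star f + star g"
proof -
  obtain a b c d where *: "b \<noteq> 0" "f = to_fract a / to_fract b" "d \<noteq> 0" "g = to_fract c / to_fract d"
    by (metis ratfun_cases)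
  have "f + g = to_fract (a * d + c * b) / to_fract (b * d)"
    using * by (simp add: add_frac_eq)
  then show ?thesis
    using * star_quot[of "b * d" "a * d + c * b"] by (simp add: star_quot recip_eval_hom add_frac_eq)
qed

lemma star_uminus [simp]: "star (- f) = - star f"
  using star_add[of f "- f"] by (simp add: eq_neg_iff_add_eq_0)

lemma star_diff [simp]: "star (f - g) = star f - star g"
  using star_add[of f "- g"] by simp

lemma star_eq_0_iff [simp]: "star f = 0 \<longleftrightarrow> f = 0"
  by (metis mult_eq_0_iff star_0 star_1 star_mult zero_neq_one right_inverse)

lemma star_inverse [simp]: "star (inverse f) = inverse (star f)"
  by (metis inverse_unique left_inverse mult.commute star_0 star_1 star_mult inverse_zero)

lemma star_divide [simp]: "star (f / g) = star f / star g"
  by (simp add: divide_inverse)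

lemma star_power [simp]: "star (f ^ n) = star f ^ n"
  by (induction n) simp_all

lemma star_sum [simp]: "star (sum f A) = (\<Sum>x\<in>A. star (f x))"
  by (induction A rule: infinite_finite_induct) simp_all

lemma to_fract_pCons: "to_fract (pCons c a) = rat_const c + rat_z * to_fract a"
  by (simp add: rat_const_def rat_z_def flip: to_fract_mult to_fract_add)

lemma star_star [simp]: "star (star f) = f"
proof -
  have *: "star (recip_eval a) = to_fract a" for a
  proof (induction a)
    case 0
    then show ?case by (simp add: recip_eval_def)
  next
    case (pCons c a)
    then show ?case by (simp add: recip_eval_pCons to_fract_pCons star_rat_z)
  qed
  obtain a b where "b \<noteq> 0" "f = to_fract a / to_fract b" by (rule ratfun_cases)
  then show ?thesis by (simp add: star_to_fract *)
qed

interpretation star: comm_ring_hom star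
  by unfold_locales simp_all

fun xinv :: "xcomplex \<Rightarrow> xcomplex" where
  "xinv (Fin z) = (if z = 0 then Infty else Fin (inverse z))"
| "xinv Infty = Fin 0"

lemma xinv_xinv [simp]: "xinv (xinv p) = p"
  by (cases p) auto

lemma cpoly_reflect: "cpoly (reflect_poly a) = reflect_poly (cpoly a)"
  by (intro poly_eqI) (simp add: coeff_reflect_poly)

text \<open>Reversal is multiplicative and turns the factor X - 1/z into a nonzero multiple of X -
  z.\<close>

lemma order_reflect_poly:
  fixes q :: "complex poly"
  assumes "z \<noteq> 0" "q \<noteq> 0"
  shows "order z (reflect_poly q) = order (inverse z) q"
proof -
  let ?w = "inverse z"
  obtain s where s: "q = [:- ?w, 1:] ^ order ?w q * s" and "\<not> [:- ?w, 1:] dvd s"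
    using order_decomp[OF assms(2)] by blast
  then have sz: "poly s ?w \<noteq> 0" by (simp add: poly_eq_0_iff_dvd)
  have lin: "reflect_poly [:- ?w, 1:] = smult (- ?w) [:- z, 1:]"
    using assms by (intro poly_eqI) (simp add: coeff_reflect_poly coeff_pCons split: nat.split)
  have q: "reflect_poly q = smult ((- ?w) ^ order ?w q) ([:- z, 1:] ^ order ?w q * reflect_poly s)"
    by (subst s) (simp only: reflect_poly_mult reflect_poly_power lin smult_power mult_smult_left)
  have "poly (reflect_poly s) z \<noteq> 0"
    using sz assms by (simp add: poly_reflect_poly_nz)
  then have r: "reflect_poly s \<noteq> 0" "order z (reflect_poly s) = 0" by (auto intro: order_0I)
  show ?thesis
    using assms r by (subst q) (simp add: order_smult order_mult order_power_n_n)
qed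

text \<open>Away from 0 and infinity, reversal carries orders from 1/z to z. The two remaining
  points are exchanged because reversal deletes the zero at 0: the degree drops by exactly the order
  there.\<close>

lemma pole_mult_star: "pole_mult (star f) p = pole_mult f (xinv p)"
proof (cases "f = 0")
  case False
  obtain a b where b: "b \<noteq> 0" and f: "f = to_fract a / to_fract b" by (rule ratfun_cases)
  then have a: "a \<noteq> 0" using False by auto
  \<comment> \<open>The crossed powers of z clear the negative powers in a(1/z) / b(1/z).\<close>
  let ?A = "monom 1 (degree b) * reflect_poly a" and ?B = "monom 1 (degree a) * reflect_poly b"
  have s: "star f = to_fract ?A / to_fract ?B"
    using a b by (simp add: f star_quot recip_eval_conv star_to_fract flip: rat_z_power)
  have nz: "?A \<noteq> 0" "?B \<noteq> 0" using a b by (auto simp: monom_eq_0_iff)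
  have mon: "order z (cpoly (monom 1 n)) = (if z = 0 then n else 0)" for z n
    by (simp add: order_0I poly_monom)
  have o0: "order 0 (reflect_poly (cpoly q)) = 0" if "q \<noteq> 0" for q
    using that by (intro order_0I) simp
  have dr: "degree (reflect_poly q) + order 0 (cpoly q) = degree q" if q: "q \<noteq> 0" for q :: "real poly"
  proof -
    obtain s where s: "q = [:0, 1:] ^ order 0 q * s" and "\<not> [:0, 1:] dvd s"
      using order_decomp[OF q, of 0] by auto
    then have "poly s 0 \<noteq> 0" by (metis minus_zero poly_eq_0_iff_dvd)
    then have s0: "coeff s 0 \<noteq> 0" "s \<noteq> 0" by (auto simp: poly_0_coeff_0)
    have r1: "reflect_poly [:0, 1 :: real:] = 1"
      by (intro poly_eqI) (simp add: coeff_reflect_poly coeff_pCons split: nat.split)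
    have r: "reflect_poly q = reflect_poly s"
      by (subst s) (simp add: reflect_poly_mult reflect_poly_power r1 del: reflect_poly_simps(2))
    have "degree q = order 0 q + degree s"
      by (subst s) (simp add: degree_mult_eq s0 degree_power_eq)
    moreover have "order 0 (cpoly q) = order 0 q"
      using cpoly.order_hom[of 0 q] by simp
    ultimately show ?thesis using r s0 by simp
  qed
  show ?thesis
  proof (cases p)
    case Infty
    have "pole_mult (star f) p = degree ?A - degree ?B"
      using pole_mult_Infty_quot[OF s nz] Infty by simp
    also have "\<dots> = order 0 (cpoly b) - order 0 (cpoly a)"
      using dr[OF a] dr[OF b] a b by (simp add: degree_mult_eq monom_eq_0_iff degree_monom_eq)
    finally show ?thesis using Infty pole_mult_Fin_quot[OF f a b] by simp
  next
    case (Fin z)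
    have "pole_mult (star f) p = order z (cpoly ?B) - order z (cpoly ?A)"
      using pole_mult_Fin_quot[OF s nz] Fin by simp
    also have "\<dots> = order z (cpoly (monom 1 (degree a))) + order z (reflect_poly (cpoly b))
        - (order z (cpoly (monom 1 (degree b))) + order z (reflect_poly (cpoly a)))"
      using a b by (simp add: cpoly.hom_mult order_mult cpoly_reflect monom_eq_0_iff del: of_real_hom.map_poly_hom_monom)
    finally show ?thesis
      using Fin pole_mult_Fin_quot[OF f a b] pole_mult_Infty_quot[OF f a b] a b
      by (auto simp: mon o0 order_reflect_poly simp del: of_real_hom.map_poly_hom_monom)
  qed
qed simp

section \<open>Regular functions and real minimal polynomials\<close>

lemma pole_mult_Fin_le:
  assumes "f = to_fract a / to_fract b" "b \<noteq> 0"
  shows "pole_mult f (Fin z) \<le> order z (cpoly b)"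
proof (cases "a = 0")
  case True
  then show ?thesis using assms by simp
next
  case False
  then show ?thesis using pole_mult_Fin_quot[OF assms(1) False assms(2)] by simp
qed

lemma order_add_ge:
  fixes p q :: "'a::idom poly"
  assumes "p + q \<noteq> 0" "p = 0 \<or> k \<le> order z p" "q = 0 \<or> k \<le> order z q"
  shows "k \<le> order z (p + q)"
  using assms order_divides[of z k p] order_divides[of z k q] order_divides[of z k "p + q"]
  by (metis dvd_add)

lemma pole_mult_add_Fin: "pole_mult (f + g) (Fin z) \<le> max (pole_mult f (Fin z)) (pole_mult g (Fin z))"
proof (cases "f = 0 \<or> g = 0 \<or> f + g = 0")
  case True
  then show ?thesis by auto
next
  case False
  obtain a b where b: "b \<noteq> 0" and f: "f = to_fract a / to_fract b" by (rule ratfun_cases)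
  obtain c d where d: "d \<noteq> 0" and g: "g = to_fract c / to_fract d" by (rule ratfun_cases)
  have bd: "b * d \<noteq> 0" using b d by simp
  have f': "f = to_fract (a * d) / to_fract (b * d)" and g': "g = to_fract (c * b) / to_fract (b * d)"
    using b d f g by simp_all
  have fg: "f + g = to_fract (a * d + c * b) / to_fract (b * d)"
    by (subst f', subst g') (simp add: add_divide_distrib)
  have nz: "a * d \<noteq> 0" "c * b \<noteq> 0" "a * d + c * b \<noteq> 0"
    using False b d f g fg by (auto simp del: to_fract_add to_fract_mult)
  have "min (order z (cpoly (a * d))) (order z (cpoly (c * b))) \<le> order z (cpoly (a * d) + cpoly (c * b))"
    by (rule order_add_ge) (use nz in \<open>auto simp flip: cpoly.hom_add\<close>)
  then show ?thesis
    using pole_mult_Fin_quot[OF f' nz(1) bd] pole_mult_Fin_quot[OF g' nz(2) bd]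
      pole_mult_Fin_quot[OF fg nz(3) bd]
    by (auto simp: cpoly.hom_add)
qed

lemma pole_mult_mult_Fin: "pole_mult (f * g) (Fin z) \<le> pole_mult f (Fin z) + pole_mult g (Fin z)"
proof (cases "f = 0 \<or> g = 0")
  case True
  then show ?thesis by auto
next
  case False
  obtain a b where b: "b \<noteq> 0" and f: "f = to_fract a / to_fract b" by (rule ratfun_cases)
  obtain c d where d: "d \<noteq> 0" and g: "g = to_fract c / to_fract d" by (rule ratfun_cases)
  have nz: "a \<noteq> 0" "c \<noteq> 0" using False f g by auto
  have fg: "f * g = to_fract (a * c) / to_fract (b * d)" using f g by simp
  have "a * c \<noteq> 0" "b * d \<noteq> 0" using nz b d by auto
  then show ?thesis
    using pole_mult_Fin_quot[OF f nz(1) b] pole_mult_Fin_quot[OF g nz(2) d] pole_mult_Fin_quot[OF fg] nz b d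
    by (simp add: cpoly.hom_mult order_mult)
qed

lemma pole_mult_Infty_star: "pole_mult f Infty = pole_mult (star f) (Fin 0)"
  by (simp add: pole_mult_star)

text \<open>At infinity this is the claim for \<open>star f\<close> and \<open>star g\<close> at
  0.\<close>

lemma pole_mult_add: "pole_mult (f + g) p \<le> max (pole_mult f p) (pole_mult g p)"
  by (cases p) (metis pole_mult_add_Fin, metis pole_mult_add_Fin pole_mult_Infty_star star_add)

lemma pole_mult_mult: "pole_mult (f * g) p \<le> pole_mult f p + pole_mult g p"
  by (cases p) (metis pole_mult_mult_Fin, metis pole_mult_mult_Fin pole_mult_Infty_star star_mult)

lemma pole_mult_rat_const [simp]: "pole_mult (rat_const c) p = 0"
proof (cases "c = 0")
  case False
  have eq: "rat_const c = to_fract [:c:] / to_fract 1" by (simp add: rat_const_def)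
  show ?thesis
    using pole_mult_Fin_quot[OF eq] pole_mult_Infty_quot[OF eq] False
    by (cases p) auto
qed simp

lemma pole_mult_1 [simp]: "pole_mult 1 p = 0"
  using pole_mult_rat_const[of 1 p] by simp

lemma pole_mult_const_mult: "pole_mult (rat_const c * f) p \<le> pole_mult f p"
  using pole_mult_mult[of "rat_const c" f p] by simp

lemma pole_mult_const_mult_eq [simp]: "c \<noteq> 0 \<Longrightarrow> pole_mult (rat_const c * f) p = pole_mult f p"
proof (rule antisym[OF pole_mult_const_mult])
  assume "c \<noteq> 0"
  then have "rat_const (inverse c) * rat_const c = 1"
    using rat_const_hom(5)[of "inverse c" c] by simp
  then have eq: "rat_const (inverse c) * (rat_const c * f) = f"
    by (simp only: mult_1 flip: mult.assoc)
  then show "pole_mult f p \<le> pole_mult (rat_const c * f) p"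
    using pole_mult_const_mult[of "inverse c" "rat_const c * f" p] by (simp only: eq)
qed

lemma pole_mult_uminus [simp]: "pole_mult (- f) p = pole_mult f p"
  using pole_mult_const_mult_eq[of "- 1" f p] by simp

lemma pole_mult_sum:
  "(\<And>x. x \<in> A \<Longrightarrow> pole_mult (f x) p \<le> k) \<Longrightarrow> pole_mult (sum f A) p \<le> k"
proof (induction A rule: infinite_finite_induct)
  case (insert x A)
  have "pole_mult (f x + sum f A) p \<le> max (pole_mult (f x) p) (pole_mult (sum f A) p)"
    by (rule pole_mult_add)
  also have "\<dots> \<le> k" using insert by simp
  finally show ?case using insert by simp
qed simp_all

text \<open>Only finite points are covered; infinity is reached through \<open>star f\<close> at
  0.\<close>

definition regular :: "complex \<Rightarrow> ratfun \<Rightarrow> bool" where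
  "regular z f \<longleftrightarrow> pole_mult f (Fin z) = 0"

lemma regular_simps [simp]: "regular z 0" "regular z 1" "regular z (rat_const c)" "regular z (- f) \<longleftrightarrow> regular z f"
  by (simp_all add: regular_def)

lemma regular_add: "regular z f \<Longrightarrow> regular z g \<Longrightarrow> regular z (f + g)"
  unfolding regular_def by (metis le_zero_eq max.idem pole_mult_add)

lemma regular_mult: "regular z f \<Longrightarrow> regular z g \<Longrightarrow> regular z (f * g)"
  unfolding regular_def by (metis add_0 le_zero_eq pole_mult_mult)

lemma regular_power: "regular z f \<Longrightarrow> regular z (f ^ n)"
  by (induction n) (simp_all add: regular_mult)

lemma regular_sum: "(\<And>x. x \<in> A \<Longrightarrow> regular z (f x)) \<Longrightarrow> regular z (sum f A)"
  unfolding regular_def by (metis le_zero_eq pole_mult_sum)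

lemma regular_prod: "(\<And>x. x \<in> A \<Longrightarrow> regular z (f x)) \<Longrightarrow> regular z (prod f A)"
  by (induction A rule: infinite_finite_induct) (simp_all add: regular_mult)

lemma regularI:
  assumes "f = to_fract a / to_fract b" "ceval b z \<noteq> 0"
  shows "regular z f"
proof -
  have "b \<noteq> 0" using assms by auto
  then show ?thesis using pole_mult_Fin_le[OF assms(1), of z] assms(2)
    by (simp add: regular_def order_0I)
qed

lemma regular_to_fract [simp]: "regular z (to_fract a)"
  by (rule regularI[of _ a 1]) simp_all

lemma regular_iff_denom: "regular z f \<longleftrightarrow> ceval (denom f) z \<noteq> 0"
  by (simp add: regular_def order_eq_0_iff pole_mult.simps)

lemma rat_eval_quot:
  assumes "f = to_fract a / to_fract b" "ceval b z \<noteq> 0"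
  shows "rat_eval f z = ceval a z / ceval b z"
proof -
  have b: "b \<noteq> 0" using assms by auto
  have "ceval (numer f * b) z = ceval (a * denom f) z"
    by (simp only: numer_cross[OF assms(1) b])
  then have "ceval (numer f) z * ceval b z = ceval a z * ceval (denom f) z"
    by (simp add: cpoly.hom_mult)
  moreover have "ceval (denom f) z \<noteq> 0"
    using regularI[OF assms] by (simp add: regular_iff_denom)
  ultimately show ?thesis using assms(2) by (simp add: rat_eval_def frac_eq_eq)
qed

lemma regularE:
  assumes "regular z f"
  obtains a b where "f = to_fract a / to_fract b" "ceval b z \<noteq> 0" "b \<noteq> 0"
  by (rule that[OF numer_denom]) (use assms in \<open>auto simp: regular_iff_denom\<close>)

lemma rat_eval_to_fract [simp]: "rat_eval (to_fract a) z = ceval a z"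
  using rat_eval_quot[of "to_fract a" a 1 z] by simp

lemma rat_eval_const [simp]: "rat_eval (rat_const c) z = of_real c"
  by (simp add: rat_const_def hom_distribs)

lemma rat_eval_0 [simp]: "rat_eval 0 z = 0" 
  using rat_eval_const[of 0 z] by simp

lemma rat_eval_1 [simp]: "rat_eval 1 z = 1" 
  using rat_eval_const[of 1 z] by simp

lemma rat_eval_mult:
  assumes "regular z f" "regular z g"
  shows "rat_eval (f * g) z = rat_eval f z * rat_eval g z"
proof -
  obtain a b where f: "f = to_fract a / to_fract b" "ceval b z \<noteq> 0" "b \<noteq> 0"
    using assms(1) by (rule regularE)
  obtain c d where g: "g = to_fract c / to_fract d" "ceval d z \<noteq> 0" "d \<noteq> 0"
    using assms(2) by (rule regularE)
  have "f * g = to_fract (a * c) / to_fract (b * d)" using f g by simp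
  then show ?thesis
    using rat_eval_quot[of "f * g" "a * c" "b * d" z] rat_eval_quot[OF f(1,2)] rat_eval_quot[OF g(1,2)] f g
    by (simp add: cpoly.hom_mult)
qed

lemma rat_eval_add:
  assumes "regular z f" "regular z g"
  shows "rat_eval (f + g) z = rat_eval f z + rat_eval g z"
proof -
  obtain a b where f: "f = to_fract a / to_fract b" "ceval b z \<noteq> 0" "b \<noteq> 0"
    using assms(1) by (rule regularE)
  obtain c d where g: "g = to_fract c / to_fract d" "ceval d z \<noteq> 0" "d \<noteq> 0"
    using assms(2) by (rule regularE)
  have "f + g = to_fract (a * d + c * b) / to_fract (b * d)" using f g by (simp add: add_frac_eq)
  then show ?thesis
    using rat_eval_quot[of "f + g" "a * d + c * b" "b * d" z] rat_eval_quot[OF f(1,2)] rat_eval_quot[OF g(1,2)] f g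
    by (simp add: cpoly.hom_mult cpoly.hom_add add_frac_eq)
qed

lemma rat_eval_sum:
  "(\<And>x. x \<in> A \<Longrightarrow> regular z (f x)) \<Longrightarrow> rat_eval (sum f A) z = (\<Sum>x\<in>A. rat_eval (f x) z)"
  by (induction A rule: infinite_finite_induct) (simp_all add: rat_eval_add regular_sum)

lemma poly_cpoly_cnj: "ceval a (cnj z) = cnj (ceval a z)"
  by (induction a) (simp_all add: hom_distribs)

lemma rat_eval_cnj: "rat_eval f (cnj z) = cnj (rat_eval f z)"
  by (simp add: rat_eval_def poly_cpoly_cnj)

interpretation cnj: map_poly_inj_idom_divide_hom cnj
  by unfold_locales auto

lemma order_cpoly_cnj: "order (cnj z) (cpoly a) = order z (cpoly a)"
proof -
  have "map_poly cnj (cpoly a) = cpoly a" by (intro poly_eqI) simp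
  then show ?thesis using cnj.order_hom[of z "cpoly a"] by simp
qed

lemma pole_mult_cnj: "pole_mult f (Fin (cnj z)) = pole_mult f (Fin z)"
  by (simp add: order_cpoly_cnj pole_mult.simps)

lemma regular_cnj [simp]: "regular (cnj z) f \<longleftrightarrow> regular z f"
  by (simp add: regular_def pole_mult_cnj)

lemma regular_star: "z \<noteq> 0 \<Longrightarrow> regular z (star f) \<longleftrightarrow> regular (inverse z) f"
  by (simp add: regular_def pole_mult_star)

lemma rat_eval_star:
  assumes z: "z \<noteq> 0" and reg: "regular (inverse z) f"
  shows "rat_eval (star f) z = rat_eval f (inverse z)"
proof -
  obtain a b where f: "f = to_fract a / to_fract b" "ceval b (inverse z) \<noteq> 0" "b \<noteq> 0"
    using reg by (rule regularE)
  have s: "star f = to_fract (monom 1 (degree b) * reflect_poly a) / to_fract (monom 1 (degree a) * reflect_poly b)"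
    using f by (simp add: star_to_fract recip_eval_conv flip: rat_z_power)
  have ev: "ceval (monom 1 n * reflect_poly q) z = z ^ n * (z ^ degree q * ceval q (inverse z))" for n q
    using z by (simp add: cpoly.hom_mult cpoly_reflect poly_reflect_poly_nz poly_monom)
  have "ceval (monom 1 (degree a) * reflect_poly b) z \<noteq> 0"
    using f z by (simp add: ev)
  from rat_eval_quot[OF s this] show ?thesis
    using z f(2) by (simp add: ev rat_eval_quot[OF f(1,2)])
qed

lemma inverse_unit_complex:
  assumes "cmod z = 1"
  shows "inverse z = cnj z"
proof (rule inverse_unique)
  show "z * cnj z = 1" using complex_norm_square[of z] assms by simp
qed

lemma regular_star_circle: "cmod z = 1 \<Longrightarrow> regular z (star f) \<longleftrightarrow> regular z f"
  by (subst regular_star) (auto simp: inverse_unit_complex)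

lemma rat_eval_star_circle:
  assumes "cmod z = 1" "regular z f"
  shows "rat_eval (star f) z = cnj (rat_eval f z)"
  using assms by (subst rat_eval_star) (auto simp: inverse_unit_complex rat_eval_cnj)

text \<open>The minimal polynomial of z over the reals. It stands in for X - z, which cannot be
  split off from a real polynomial when z is not real.\<close>

definition real_minpoly :: "complex \<Rightarrow> real poly" where
  "real_minpoly z = (if Im z = 0 then [:- Re z, 1:] else [:(cmod z)\<^sup>2, - 2 * Re z, 1:])"

lemma cpoly_real_minpoly:
  "cpoly (real_minpoly z) = (if Im z = 0 then [:- z, 1:] else [:- z, 1:] * [:- cnj z, 1:])"
proof -
  have "Im z = 0 \<Longrightarrow> of_real (Re z) = z" by (simp add: complex_eq_iff)
  moreover have "- (2 * of_real (Re z)) = - z - cnj z" by (simp add: complex_eq_iff)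
  moreover have "(of_real (cmod z))\<^sup>2 = z * cnj z" using complex_norm_square[of z] by simp
  ultimately show ?thesis by (simp add: real_minpoly_def hom_distribs)
qed

lemma monic_real_minpoly: "lead_coeff (real_minpoly z) = 1"
  by (simp add: real_minpoly_def)

lemma degree_real_minpoly: "degree (real_minpoly z) > 0"
  by (simp add: real_minpoly_def)

lemma real_minpoly_nz [simp]: "real_minpoly z \<noteq> 0"
  using degree_real_minpoly[of z] by auto

lemma real_minpoly_root_iff: "ceval (real_minpoly z) w = 0 \<longleftrightarrow> w = z \<or> w = cnj z"
proof -
  have "Im z = 0 \<Longrightarrow> cnj z = z" by (simp add: complex_eq_iff)
  moreover have "poly ([:- z, 1:] * [:- cnj z, 1:]) w = (w - z) * (w - cnj z)"
    by (simp only: poly_mult) simp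
  ultimately show ?thesis
    unfolding cpoly_real_minpoly by (cases "Im z = 0") (simp_all del: mult_pCons_left mult_pCons_right)
qed

lemma order_real_minpoly: "order z (cpoly (real_minpoly z)) = 1"
proof (cases "Im z = 0")
  case True
  then show ?thesis using order_power_n_n[of z 1] by (simp add: cpoly_real_minpoly)
next
  case False
  then have "poly [:- cnj z, 1:] z \<noteq> 0" by (simp add: complex_eq_iff)
  then have "order z [:- cnj z, 1:] = 0" by (rule order_0I)
  moreover have "order z [:- z, 1:] = 1" using order_power_n_n[of z 1] by simp
  moreover have "order z ([:- z, 1:] * [:- cnj z, 1:]) = order z [:- z, 1:] + order z [:- cnj z, 1:]"
    by (rule order_mult) (simp only: mult_eq_0_iff pCons_eq_0_iff, simp)
  ultimately show ?thesis using False by (simp add: cpoly_real_minpoly del: mult_pCons_left mult_pCons_right)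
qed

text \<open>The remainder modulo \<open>real_minpoly z\<close> still vanishes at z, but its degree
  is too small: it is constant for real z, and a nonzero real polynomial of degree at most 1 has no
  non-real root.\<close>

lemma real_minpoly_dvd:
  assumes "ceval a z = 0"
  shows "real_minpoly z dvd a"
proof -
  let ?m = "real_minpoly z" and ?r = "a mod real_minpoly z"
  have root: "ceval ?m z = 0" by (simp add: real_minpoly_root_iff)
  have "cpoly a = cpoly (a div ?m) * cpoly ?m + cpoly ?r"
    by (metis cpoly.hom_add cpoly.hom_mult div_mult_mod_eq)
  from arg_cong[OF this, of "\<lambda>p. poly p z"] assms root have r0: "ceval ?r z = 0"
    by simp
  have "?r = 0"
  proof (rule ccontr)
    assume nz: "?r \<noteq> 0"
    then have dl: "degree ?r < degree ?m"
      by (metis degree_mod_less degree_real_minpoly real_minpoly_nz)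
    show False
    proof (cases "Im z = 0")
      case True
      then have "degree ?r = 0" using dl by (simp add: real_minpoly_def)
      then obtain c where "?r = [:c:]" by (metis degree_eq_zeroE)
      then show False using nz r0 by (simp add: hom_distribs)
    next
      case False
      then have "degree ?r \<le> 1" using dl by (simp add: real_minpoly_def)
      have "?r = [:coeff ?r 0, coeff ?r 1:]"
        using coeff_eq_0[of ?r] \<open>degree ?r \<le> 1\<close>
        by (intro poly_eqI) (auto simp: coeff_pCons split: nat.split)
      then obtain c d where cd: "?r = [:c, d:]" by blast
      then have "of_real c + z * of_real d = 0" using r0 by (simp add: hom_distribs)
      then have "d = 0" "c = 0" using False by (auto simp: complex_eq_iff)
      then show False using nz cd by simp
    qed
  qed
  then show ?thesis by (simp add: mod_eq_0_iff_dvd)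
qed

text \<open>A root in P is divided out together with its conjugate, hence the closure of P under
  conjugation.\<close>

lemma split_roots:
  fixes b :: "real poly"
  assumes "b \<noteq> 0" "\<And>z. P z \<Longrightarrow> P (cnj z)"
  shows "\<exists>q c. b = q * c \<and> lead_coeff q = 1 \<and> (\<forall>z. ceval q z = 0 \<longrightarrow> P z)
     \<and> (\<forall>z. ceval c z = 0 \<longrightarrow> \<not> P z)"
  using assms(1)
proof (induction "degree b" arbitrary: b rule: less_induct)
  case less
  show ?case
  proof (cases "\<exists>z. ceval b z = 0 \<and> P z")
    case False
    then show ?thesis by (intro exI[of _ 1] exI[of _ b]) auto
  next
    case True
    then obtain z where z: "ceval b z = 0" "P z" by blast
    then obtain b1 where b1: "b = real_minpoly z * b1" using real_minpoly_dvd by (metis dvdE)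
    have "b1 \<noteq> 0" using b1 less.prems by auto
    moreover from this have "degree b1 < degree b"
      using b1 degree_real_minpoly[of z] by (simp add: degree_mult_eq)
    ultimately obtain q c where qc: "b1 = q * c" "lead_coeff q = 1"
      "\<forall>z. ceval q z = 0 \<longrightarrow> P z" "\<forall>z. ceval c z = 0 \<longrightarrow> \<not> P z"
      using less.hyps by blast
    show ?thesis
    proof (intro exI conjI allI impI)
      show "b = (real_minpoly z * q) * c" using b1 qc by (simp add: mult.assoc)
      show "lead_coeff (real_minpoly z * q) = 1" using qc by (simp add: lead_coeff_mult monic_real_minpoly)
      show "P w" if "ceval (real_minpoly z * q) w = 0" for w
        using that qc z assms(2) by (auto simp: cpoly.hom_mult real_minpoly_root_iff)
      show "\<not> P w" if "ceval c w = 0" for w using that qc by blast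
    qed
  qed
qed

text \<open>The zero of \<open>real_minpoly z\<close> at z is simple, so each factor lowers the pole
  by one; the subtraction is truncated because zeros are not recorded.\<close>

lemma pole_mult_real_minpoly_power:
  "pole_mult (to_fract (real_minpoly z) ^ e * g) (Fin z) = pole_mult g (Fin z) - e"
proof (cases "g = 0")
  case False
  obtain a b where b: "b \<noteq> 0" and g: "g = to_fract a / to_fract b" by (rule ratfun_cases)
  then have a: "a \<noteq> 0" using False by auto
  have pw: "to_fract p ^ n = to_fract (p ^ n)" for p :: "real poly" and n by (induction n) simp_all
  have eq: "to_fract (real_minpoly z) ^ e * g = to_fract (real_minpoly z ^ e * a) / to_fract b"
    by (simp add: g pw)
  have "order z (cpoly (real_minpoly z) ^ n) = n" for n
    by (induction n) (simp_all add: order_mult order_real_minpoly)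
  then have "order z (cpoly (real_minpoly z ^ e * a)) = e + order z (cpoly a)"
    using a by (simp add: hom_distribs order_mult)
  then show ?thesis
    using pole_mult_Fin_quot[OF eq _ b] pole_mult_Fin_quot[OF g a b] a by simp
qed simp

lemma regular_zero_factor:
  assumes "regular z g" "rat_eval g z = 0"
  obtains h where "g = to_fract (real_minpoly z) * h" "regular z h"
proof -
  obtain a b where g: "g = to_fract a / to_fract b" "ceval b z \<noteq> 0" "b \<noteq> 0"
    using assms(1) by (rule regularE)
  then have "ceval a z = 0" using assms(2) rat_eval_quot[OF g(1,2)] by simp
  then obtain c where "a = real_minpoly z * c" using real_minpoly_dvd by (metis dvdE)
  then have "g = to_fract (real_minpoly z) * (to_fract c / to_fract b)" using g by simp
  then show ?thesis using that regularI[OF refl g(2)] by blast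
qed

text \<open>On the unit circle \<open>star f * f\<close> takes the value \<open>\<bar>f\<bar>\<^sup>2\<close>, so the leading singular parts of a
  sum of such terms cannot cancel.\<close>

lemma pole_mult_sum_squares_circle:
  assumes z: "cmod z = 1" and A: "finite A" "k \<in> A"
  shows "2 * pole_mult (f k) (Fin z) \<le> pole_mult (\<Sum>i\<in>A. star (f i) * f i) (Fin z)"
proof -
  let ?pm = "\<lambda>g. pole_mult g (Fin z)"
  define M where "M = Max ((\<lambda>i. ?pm (f i)) ` A)"
  define m where "m = to_fract (real_minpoly z)"
  define S where "S = (\<Sum>i\<in>A. star (f i) * f i)"
  have fM: "?pm (f i) \<le> M" if "i \<in> A" for i using that A by (simp add: M_def)
  have "2 * M \<le> ?pm S"
  proof (cases "M = 0")
    case False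
    have "M \<in> (\<lambda>i. ?pm (f i)) ` A" unfolding M_def using A by (intro Max_in) auto
    then obtain j where j: "j \<in> A" "?pm (f j) = M" by auto
    \<comment> \<open>Scaling by the largest pole order makes every g i regular at z and leaves g j
      nonzero there.\<close>
    define g where "g i = m ^ M * f i" for i
    have g: "regular z (g i)" if "i \<in> A" for i
      using fM[OF that] unfolding regular_def g_def m_def pole_mult_real_minpoly_power by simp
    have gj: "rat_eval (g j) z \<noteq> 0"
    proof
      assume "rat_eval (g j) z = 0"
      then obtain h where h: "g j = m * h" "regular z h"
        using regular_zero_factor[OF g[OF j(1)]] unfolding m_def by blast
      \<comment> \<open>Cancelling one factor m leaves \<open>m ^ (M - 1) * f j\<close>, which has a
        simple pole at z but would equal the regular h.\<close>
      have "m ^ M = m * m ^ (M - 1)" using False by (cases M) auto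
      then have "m * h = m * (m ^ (M - 1) * f j)"
        using h(1) by (simp only: g_def mult.assoc)
      then have "h = m ^ (M - 1) * f j" by (simp add: m_def)
      then have "?pm h = M - (M - 1)"
        using j(2) unfolding m_def by (simp only: pole_mult_real_minpoly_power)
      then show False using h(2) False by (simp add: regular_def)
    qed
    define G where "G = (\<Sum>i\<in>A. star (g i) * g i)"
    have sg: "regular z (star (g i))" if "i \<in> A" for i
      using g[OF that] z by (simp add: regular_star_circle)
    have "rat_eval G z = (\<Sum>i\<in>A. rat_eval (star (g i)) z * rat_eval (g i) z)"
      unfolding G_def using g sg by (simp add: rat_eval_sum regular_mult rat_eval_mult)
    also have "\<dots> = (\<Sum>i\<in>A. of_real ((cmod (rat_eval (g i) z))\<^sup>2))"
      using g z by (intro sum.cong refl) (simp add: rat_eval_star_circle complex_norm_square mult.commute del: of_real_power)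
    finally have "rat_eval G z = of_real (\<Sum>i\<in>A. (cmod (rat_eval (g i) z))\<^sup>2)" by simp
    moreover have "(\<Sum>i\<in>A. (cmod (rat_eval (g i) z))\<^sup>2) > 0"
      using j(1) gj A by (intro sum_pos2[of A j]) auto
    ultimately have Gnz: "rat_eval G z \<noteq> 0" by (metis less_irrefl of_real_eq_0_iff)
    have z0: "z \<noteq> 0" using z by auto
    \<comment> \<open>On the circle 1/z is the conjugate of z, so the reversal of m vanishes at z
      too: \<open>star m\<close> is m times a function u regular at z.\<close>
    have "ceval (reflect_poly (real_minpoly z)) z = 0"
      using z0 z by (simp add: cpoly_reflect poly_reflect_poly_nz real_minpoly_root_iff inverse_unit_complex)
    then obtain c where c: "reflect_poly (real_minpoly z) = real_minpoly z * c"
      using real_minpoly_dvd by (metis dvdE)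
    define u where "u = to_fract c / to_fract (monom 1 (degree (real_minpoly z)))"
    have u: "regular z u" unfolding u_def by (rule regularI[OF refl]) (use z0 in \<open>simp add: poly_monom\<close>)
    have sm: "star m = m * u"
      by (simp add: m_def u_def star_to_fract recip_eval_conv c rat_z_power)
    have "G = (star m * m) ^ M * S"
      by (simp add: G_def g_def S_def sum_distrib_left power_mult_distrib algebra_simps)
    also have "\<dots> = u ^ M * (m ^ (2 * M) * S)"
      by (simp add: sm power_mult_distrib power_mult power2_eq_square algebra_simps)
    finally have G: "G = u ^ M * (m ^ (2 * M) * S)" .
    show ?thesis
    proof (rule ccontr)
      assume "\<not> 2 * M \<le> ?pm S"
      \<comment> \<open>If the pole of S had order below 2 M, a factor m would be left over in G and
        make its value at z vanish.\<close>
      then have "?pm (m ^ (2 * M - 1) * S) = 0" unfolding m_def pole_mult_real_minpoly_power by simp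
      then have r: "regular z (m ^ (2 * M - 1) * S)" by (simp add: regular_def)
      have "m ^ (2 * M) = m * m ^ (2 * M - 1)" using False by (cases "2 * M") auto
      then have "G = u ^ M * (m * (m ^ (2 * M - 1) * S))"
        using G by (simp only: mult.assoc)
      moreover have "regular z m" by (simp add: m_def)
      ultimately have "rat_eval G z = rat_eval (u ^ M) z * (rat_eval m z * rat_eval (m ^ (2 * M - 1) * S) z)"
        using r u by (simp add: rat_eval_mult regular_mult regular_power)
      then show False using Gnz by (simp add: m_def real_minpoly_root_iff)
    qed
  qed simp
  then show ?thesis using fM[OF A(2)] unfolding S_def by simp
qed

section \<open>Scalar Fejer-Riesz factorization\<close>

text \<open>On an open interval of length 2 pi around t0 the map \<open>cis\<close> is injective.
  This supplies circle points outside a finite set and lets inequalities pass to exceptional points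
  by continuity.\<close>

lemma cis_eventually_avoids:
  assumes "finite S"
  shows "\<forall>\<^sub>F t in at t0. cis t \<notin> S"
proof -
  have "\<forall>\<^sub>F t in at t0. cis t \<noteq> s" for s
  proof (cases "s = cis t0")
    case False
    have "(cis \<longlongrightarrow> cis t0) (at t0)" by (intro tendsto_intros)
    then show ?thesis using False by (intro tendsto_imp_eventually_ne) auto
  next
    case True
    have "\<forall>\<^sub>F t in at t0. dist t t0 < pi \<and> t \<noteq> t0"
      by (metis (mono_tags, lifting) eventually_at pi_gt_zero)
    then show ?thesis
    proof (rule eventually_mono)
      fix t assume t: "dist t t0 < pi \<and> t \<noteq> t0"
      show "cis t \<noteq> s"
      proof
        assume "cis t = s"
        then have "cis (t - t0) = cis 0" using True by (simp flip: cis_divide)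
        moreover have "Arg (cis (t - t0)) = t - t0"
          using t by (intro cis_Arg_unique) (auto simp: dist_real_def)
        moreover have "Arg (cis 0) = 0" by (intro cis_Arg_unique) auto
        ultimately have "t - t0 = 0" by simp
        then show False using t by simp
      qed
    qed
  qed
  then have "\<forall>\<^sub>F t in at t0. \<forall>s\<in>S. cis t \<noteq> s"
    using assms by (simp add: eventually_ball_finite_distrib)
  then show ?thesis by (rule eventually_mono) auto
qed

lemma has_vector_derivative_poly_circle:
  "((\<lambda>t. poly p (cis t) / cis t ^ d) has_vector_derivative
     (poly (pderiv p) (cis t) * \<i> * cis t / cis t ^ d - of_nat d * \<i> * poly p (cis t) / cis t ^ d)) (at t)"
proof -
  \<comment> \<open>Extended to complex arguments the curve becomes holomorphic, and the usual rules
    for derivatives apply; the result is restricted to the real line at the end.\<close>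
  define E where "E w = exp (\<i> * w)" for w :: complex
  have E: "E (of_real s) = cis s" for s by (simp add: E_def cis_conv_exp)
  have Enz: "E w \<noteq> 0" for w by (simp add: E_def)
  have dE: "(E has_field_derivative (\<i> * E w)) (at w)" for w
    unfolding E_def by (auto intro!: derivative_eq_intros)
  have dp: "((\<lambda>w. poly p (E w)) has_field_derivative (poly (pderiv p) (E w) * (\<i> * E w))) (at w)" for w
    by (rule DERIV_chain2[OF poly_DERIV dE])
  have dd: "((\<lambda>w. inverse (E w) ^ d) has_field_derivative (- (of_nat d * \<i> * inverse (E w) ^ d))) (at w)" for w
  proof -
    have "inverse (E w) ^ d = exp (- (of_nat d * \<i> * w))" for w
      by (simp add: E_def exp_minus power_inverse mult.assoc flip: exp_of_nat_mult)
    then show ?thesis by (simp only:) (auto intro!: derivative_eq_intros)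
  qed
  have "((\<lambda>w. poly p (E w) * inverse (E w) ^ d) has_field_derivative
      (poly (pderiv p) (E w) * (\<i> * E w)) * inverse (E w) ^ d + (- (of_nat d * \<i> * inverse (E w) ^ d)) * poly p (E w)) (at w)" for w
    by (rule DERIV_mult[OF dp dd])
  from has_vector_derivative_real_field[OF this[of "of_real t"], of UNIV] show ?thesis
    by (simp add: E divide_inverse power_inverse algebra_simps del: cis_inverse)
qed

text \<open>The function \<open>p(e\<^sup>i\<^sup>t) e\<^sup>-\<^sup>i\<^sup>d\<^sup>t\<close> of \<open>t\<close> is real and has a minimum at its zero.\<close>

lemma circle_zero_derivative:
  assumes S: "finite S" and z: "cmod z = 1" and root: "poly p z = 0"
    and real: "\<And>w. cmod w = 1 \<Longrightarrow> Im (poly p w / w ^ d) = 0"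
    and nonneg: "\<And>w. cmod w = 1 \<Longrightarrow> w \<notin> S \<Longrightarrow> 0 \<le> Re (poly p w / w ^ d)"
  shows "poly (pderiv p) z = 0"
proof -
  define g where "g t = poly p (cis t) / cis t ^ d" for t
  define t0 where "t0 = Arg z"
  have zt: "cis t0 = z" using rcis_cmod_Arg[of z] z by (simp add: t0_def rcis_def)
  have z0: "z \<noteq> 0" using z by auto
  have der: "(g has_vector_derivative (poly (pderiv p) z * \<i> * z / z ^ d)) (at t0)"
    using has_vector_derivative_poly_circle[of p d t0] root unfolding g_def by (simp add: zt)
  have cont: "continuous (at t) (\<lambda>t. Re (g t))" for t
    using has_vector_derivative_continuous[OF has_vector_derivative_poly_circle, of t p d]
    unfolding g_def by (rule continuous_Re)
  \<comment> \<open>The inequality is given off S only; the exceptional points follow by taking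
    limits.\<close>
  have g0: "0 \<le> Re (g t)" for t
  proof (rule tendsto_lowerbound)
    show "((\<lambda>t. Re (g t)) \<longlongrightarrow> Re (g t)) (at t)" using cont[of t] by (simp add: continuous_at)
    show "\<forall>\<^sub>F t in at t. 0 \<le> Re (g t)"
      using cis_eventually_avoids[OF S] by (rule eventually_mono) (simp add: g_def nonneg)
  qed simp
  have gt0: "g t0 = 0" by (simp add: g_def zt root)
  have "((\<lambda>t. Re (g t)) has_field_derivative Re (poly (pderiv p) z * \<i> * z / z ^ d)) (at t0)"
    using der by (rule has_field_derivative_Re)
  then have 1: "Re (poly (pderiv p) z * \<i> * z / z ^ d) = 0"
    by (rule DERIV_local_min[of _ _ _ 1]) (use g0 gt0 in auto)
  have "((\<lambda>t. Im (g t)) has_field_derivative Im (poly (pderiv p) z * \<i> * z / z ^ d)) (at t0)"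
    using der by (rule has_field_derivative_Im)
  moreover have "(\<lambda>t. Im (g t)) = (\<lambda>t. 0)" unfolding g_def by (intro ext real) simp
  ultimately have 2: "Im (poly (pderiv p) z * \<i> * z / z ^ d) = 0"
    by (metis DERIV_const DERIV_unique)
  have "poly (pderiv p) z * \<i> * z / z ^ d = 0"
    using 1 2 by (simp only: complex_eq_iff) simp
  then show ?thesis using z0 by simp
qed

lemma Im_rat_eval_circle:
  assumes "cmod z = 1" "regular z f" "star f = f"
  shows "Im (rat_eval f z) = 0"
  using rat_eval_star_circle[OF assms(1,2)] assms(3) by (simp add: complex_eq_iff)

lemma laurent_facts:
  assumes "z \<noteq> 0"
  shows "regular z (to_fract P / rat_z ^ d)"
    and "rat_eval (to_fract P / rat_z ^ d) z = ceval P z / z ^ d"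
  unfolding rat_z_power
  by (rule regularI[OF refl], use assms in \<open>simp add: poly_monom\<close>)
    (subst rat_eval_quot[OF refl], use assms in \<open>simp_all add: poly_monom\<close>)

text \<open>Symmetry under \<open>star\<close> makes P self-reversed up to a power of z, so a root
  \<zeta> is accompanied by 1/\<zeta>, and a factor \<open>star M * M\<close> splits off, where M is
  the minimal polynomial of \<zeta>. The set S varies in the induction because the sign of the
  quotient is lost at the circle zeros of M.\<close>

lemma fejer_riesz_laurent:
  assumes "star (to_fract P / rat_z ^ d) = to_fract P / rat_z ^ d" "finite S"
    and "\<And>z. cmod z = 1 \<Longrightarrow> z \<notin> S \<Longrightarrow> 0 \<le> Re (ceval P z / z ^ d)"
  shows "\<exists>h. to_fract P / rat_z ^ d = star h * h"
  using assms
proof (induction "degree P" arbitrary: P d S rule: less_induct)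
  case less
  let ?F = "to_fract P / rat_z ^ d"
  have nz: "cmod z = 1 \<Longrightarrow> z \<noteq> 0" for z :: complex by auto
  show ?case
  proof (cases "P = 0")
    case True
    then show ?thesis by (intro exI[of _ 0]) simp
  next
    case P0: False
    have "recip_eval P * rat_z ^ d = to_fract P / rat_z ^ d"
      using less.prems(1) by (simp add: star_rat_z star_to_fract field_simps power_divide)
    then have "to_fract (reflect_poly P) * (rat_z ^ d * rat_z ^ d) = to_fract P * rat_z ^ degree P"
      by (simp add: recip_eval_conv field_simps)
    then have "to_fract (reflect_poly P) * rat_z ^ (2 * d) = to_fract P * rat_z ^ degree P"
      by (simp only: mult_2 power_add)
    then have sym: "reflect_poly P * monom 1 (2 * d) = P * monom 1 (degree P)"
      unfolding rat_z_power by (simp flip: to_fract_mult)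
    show ?thesis
    proof (cases "coeff P 0 = 0")
      case True
      \<comment> \<open>A zero of P at 0 is to be cancelled against a power of z in the denominator;
        for d = 0 the symmetry excludes such a zero.\<close>
      have "d \<noteq> 0"
      proof
        assume "d = 0"
        have "coeff (reflect_poly P * monom 1 (2 * d)) 0 = coeff (P * monom 1 (degree P)) 0"
          by (simp only: sym)
        then show False using True P0 \<open>d = 0\<close> by (simp add: coeff_mult_0)
      qed
      then obtain e where d: "d = Suc e" by (cases d) auto
      obtain P1 where P1: "P = [:0, 1:] * P1"
        using True poly_eq_0_iff_dvd[of P 0] by (auto simp: poly_0_coeff_0 elim: dvdE)
      then have P1': "to_fract P = rat_z * to_fract P1" by (simp only: to_fract_mult rat_z_def)
      have F: "?F = to_fract P1 / rat_z ^ e" by (simp add: P1' d)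
      have deg: "degree P1 < degree P" using P0 P1 by (cases "P1 = 0") (auto simp: degree_mult_eq)
      have "\<exists>h. to_fract P1 / rat_z ^ e = star h * h"
      proof (rule less.hyps[OF deg])
        show "star (to_fract P1 / rat_z ^ e) = to_fract P1 / rat_z ^ e"
          using less.prems(1) by (simp only: F)
        show "finite S" by fact
        show "0 \<le> Re (ceval P1 z / z ^ e)" if z: "cmod z = 1" "z \<notin> S" for z
        proof -
          have "ceval P z / z ^ d = ceval P1 z / z ^ e"
            using nz[OF z(1)] by (simp add: P1 d hom_distribs)
          then show ?thesis using less.prems(3)[OF z] by simp
        qed
      qed
      then show ?thesis by (simp only: F)
    next
      case c0: False
      \<comment> \<open>The two sides of \<open>sym\<close> are compared by their order at 0, where
        neither P nor its reversal vanishes.\<close>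
      have dP: "degree P = 2 * d"
      proof -
        have "order 0 (reflect_poly P * monom 1 (2 * d)) = order 0 (reflect_poly P) + 2 * d"
          using P0 by (subst order_mult) (auto simp: monom_eq_0_iff)
        moreover have "order 0 (P * monom 1 (degree P)) = order 0 P + degree P"
          using P0 by (subst order_mult) (auto simp: monom_eq_0_iff)
        moreover have "order 0 (reflect_poly P) = 0" "order 0 P = 0"
          using P0 c0 by (auto intro!: order_0I simp: poly_0_coeff_0)
        ultimately show ?thesis using sym by simp
      qed
      show ?thesis
      proof (cases "d = 0")
        case True
        then obtain c where c: "P = [:c:]" using dP by (metis degree_eq_zeroE mult_0_right)
        \<comment> \<open>P is constant, and a single circle point outside S decides its
          sign.\<close>
        obtain z where "cmod z = 1" "z \<notin> S"
          using eventually_happens'[OF _ cis_eventually_avoids[OF less.prems(2)]] norm_cis by (metis at_neq_bot)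
        then have "0 \<le> Re (ceval P z / z ^ d)" by (rule less.prems(3))
        then have "c \<ge> 0" using c True by (simp add: hom_distribs)
        moreover have "?F = rat_const c" using c True by (simp add: rat_const_def)
        ultimately have "?F = star (rat_const (sqrt c)) * rat_const (sqrt c)"
          by (simp flip: rat_const_hom(5))
        then show ?thesis by blast
      next
        case False
        then have "degree (cpoly P) \<noteq> 0" using dP by simp
        then obtain \<zeta> where \<zeta>: "ceval P \<zeta> = 0"
          using fundamental_theorem_of_algebra constant_degree by metis
        have \<zeta>0: "\<zeta> \<noteq> 0" using \<zeta> c0
          by (metis of_real_eq_0_iff of_real_hom.coeff_map_poly_hom poly_0_coeff_0)
        let ?m = "real_minpoly \<zeta>"
        obtain Q1 where Q1: "P = ?m * Q1" using real_minpoly_dvd[OF \<zeta>] by (metis dvdE)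
        have pz: "ceval P (inverse \<zeta>) = 0"
        proof -
          have "ceval (reflect_poly P * monom 1 (2 * d)) (inverse \<zeta>) = 0"
            using \<zeta> \<zeta>0 by (simp add: cpoly.hom_mult cpoly_reflect poly_reflect_poly_nz)
          then show ?thesis using \<zeta>0 unfolding sym by (simp add: cpoly.hom_mult poly_monom)
        qed
        \<comment> \<open>Off the circle, 1/\<zeta> is a root of P but not of \<open>?m\<close>,
          whose roots are \<zeta> and its conjugate. On the circle, 1/\<zeta> is the conjugate of
          \<zeta>, and a second factor remains because \<zeta> is a double root of P.\<close>
        have Qz: "ceval Q1 (inverse \<zeta>) = 0"
        proof (cases "cmod \<zeta> = 1")
          case False
          have "inverse \<zeta> \<noteq> \<zeta>"
          proof
            assume "inverse \<zeta> = \<zeta>"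
            then have "\<zeta> * \<zeta> = 1" using \<zeta>0 by (metis right_inverse)
            then have "cmod \<zeta> * cmod \<zeta> = 1" by (metis norm_mult norm_one)
            then show False using False by (metis abs_norm_cancel abs_square_eq_1 power2_eq_square)
          qed
          moreover have "inverse \<zeta> \<noteq> cnj \<zeta>"
          proof
            assume "inverse \<zeta> = cnj \<zeta>"
            then have "\<zeta> * cnj \<zeta> = 1" using \<zeta>0 by (metis right_inverse)
            then have "cmod \<zeta> * cmod \<zeta> = 1" by (metis norm_mult norm_one complex_mod_cnj)
            then show False using False by (metis abs_norm_cancel abs_square_eq_1 power2_eq_square)
          qed
          ultimately have "ceval ?m (inverse \<zeta>) \<noteq> 0" by (simp add: real_minpoly_root_iff)
          then show ?thesis using pz by (simp add: Q1 cpoly.hom_mult)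
        next
          case True
          have "poly (pderiv (cpoly P)) \<zeta> = 0"
          proof (rule circle_zero_derivative[OF less.prems(2) True \<zeta>])
            show "Im (ceval P w / w ^ d) = 0" if w: "cmod w = 1" for w
              using Im_rat_eval_circle[OF w laurent_facts(1)[OF nz[OF w]] less.prems(1)]
                laurent_facts(2)[OF nz[OF w]] by simp
          qed (rule less.prems(3))
          moreover have "poly (pderiv (cpoly ?m)) \<zeta> \<noteq> 0"
          proof -
            have r: "ceval ?m \<zeta> = 0" by (simp add: real_minpoly_root_iff)
            have "order \<zeta> (pderiv (cpoly ?m)) = 0" "pderiv (cpoly ?m) \<noteq> 0"
              using order_pderiv[OF _ r] order_real_minpoly[of \<zeta>] degree_real_minpoly[of \<zeta>]
              by (auto simp: pderiv_eq_0_iff)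
            then show ?thesis by (simp add: order_eq_0_iff)
          qed
          moreover have "ceval ?m \<zeta> = 0" by (simp add: real_minpoly_root_iff)
          ultimately have "ceval Q1 \<zeta> = 0"
            by (simp add: Q1 cpoly.hom_mult pderiv_mult)
          then show ?thesis using True by (simp add: inverse_unit_complex poly_cpoly_cnj)
        qed
        let ?m' = "reflect_poly ?m"
        have m0: "coeff ?m 0 \<noteq> 0"
          using \<zeta>0 by (auto simp: real_minpoly_def complex_eq_iff)
        \<comment> \<open>The reversal of \<open>?m\<close> vanishes at 1/\<zeta> and has the degree
          of the minimal polynomial of 1/\<zeta>, so it is a constant multiple of it.\<close>
        have "?m' dvd Q1"
        proof -
          let ?m1 = "real_minpoly (inverse \<zeta>)"
          have "ceval ?m' (inverse \<zeta>) = 0"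
            using \<zeta>0 by (simp add: cpoly_reflect poly_reflect_poly_nz real_minpoly_root_iff)
          then obtain c where c: "?m' = ?m1 * c" using real_minpoly_dvd by (metis dvdE)
          have "degree ?m1 = degree ?m" using \<zeta>0 by (auto simp: real_minpoly_def)
          moreover have "degree ?m' = degree ?m" using m0 by simp
          moreover have "?m' \<noteq> 0" by simp
          ultimately have "degree c = 0" "c \<noteq> 0" using c by (auto simp: degree_mult_eq)
          then obtain k where "c = [:k:]" "k \<noteq> 0" by (metis degree_eq_zeroE pCons_0_0)
          then have "?m' = smult k ?m1" using c by simp
          then show ?thesis using real_minpoly_dvd[OF Qz] \<open>k \<noteq> 0\<close> by (simp add: smult_dvd_iff)
        qed
        then obtain Q where Q: "Q1 = ?m' * Q" by (metis dvdE)
        have PQ: "P = ?m * (?m' * Q)" using Q1 Q by simp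
        then have Qnz: "Q \<noteq> 0" using P0 by auto
        have dQ: "degree P = 2 * degree ?m + degree Q"
          using m0 Qnz by (simp add: PQ degree_mult_eq)
        then have dd: "degree ?m \<le> d" using dP by simp
        define F1 where "F1 = to_fract Q / rat_z ^ (d - degree ?m)"
        define M where "M = to_fract ?m"
        have sM: "star M = to_fract ?m' / rat_z ^ degree ?m"
          by (simp add: M_def star_to_fract recip_eval_conv)
        have PF: "to_fract P = M * (to_fract ?m' * to_fract Q)" by (subst PQ) (simp add: M_def)
        have "rat_z ^ d = rat_z ^ degree ?m * rat_z ^ (d - degree ?m)"
          using dd by (simp flip: power_add)
        then have F: "?F = star M * M * F1"
          using PF by (simp add: F1_def sM field_simps)
        have Mnz: "M \<noteq> 0" by (simp add: M_def)
        have "star ?F = star (star M * M * F1)" by (simp only: F)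
        then have "star M * M * star F1 = star M * M * F1"
          using less.prems(1) F by (simp add: mult.commute mult.left_commute)
        then have sF1: "star F1 = F1" using Mnz by simp
        have "\<exists>h. F1 = star h * h"
          unfolding F1_def
        proof (rule less.hyps)
          show "degree Q < degree P" using dQ degree_real_minpoly[of \<zeta>] by simp
          show "star (to_fract Q / rat_z ^ (d - degree ?m)) = to_fract Q / rat_z ^ (d - degree ?m)"
            using sF1 by (simp only: F1_def)
          show "finite (S \<union> {z. ceval ?m z = 0})"
            using less.prems(2) by (simp add: poly_roots_finite)
          show "0 \<le> Re (ceval Q z / z ^ (d - degree ?m))"
            if z: "cmod z = 1" "z \<notin> S \<union> {z. ceval ?m z = 0}" for z
          proof -
            have rM: "regular z M" "regular z F1" "regular z (star M)"
              unfolding F1_def using laurent_facts(1)[OF nz[OF z(1)]] z by (auto simp: M_def regular_star_circle)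
            have "rat_eval ?F z = rat_eval (star M) z * rat_eval M z * rat_eval F1 z"
              unfolding F using rM by (simp add: rat_eval_mult regular_mult)
            also have "\<dots> = of_real ((cmod (rat_eval M z))\<^sup>2) * rat_eval F1 z"
              using rM z by (simp add: rat_eval_star_circle complex_norm_square mult.commute del: of_real_power)
            finally have "Re (rat_eval ?F z) = (cmod (rat_eval M z))\<^sup>2 * Re (rat_eval F1 z)"
              by (simp only: Re_complex_of_real Im_complex_of_real times_complex.sel)
            moreover have "0 \<le> Re (rat_eval ?F z)"
              using less.prems(3)[of z] z laurent_facts(2)[OF nz[OF z(1)]] by simp
            moreover have "(cmod (rat_eval M z))\<^sup>2 > 0" using z by (simp add: M_def)
            ultimately have "0 \<le> Re (rat_eval F1 z)" by (simp add: zero_le_mult_iff)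
            then show ?thesis unfolding F1_def using laurent_facts(2)[OF nz[OF z(1)]] by simp
          qed
        qed
        then obtain h where "F1 = star h * h" by blast
        then have "?F = star (M * h) * (M * h)" by (simp add: F)
        then show ?thesis by blast
      qed
    qed
  qed
qed

text \<open>Multiplication by \<open>star B * B\<close>, with B the denominator, leaves a Laurent
  polynomial. The factor is nonnegative on the circle, and its zeros there join the exceptional
  set.\<close>

lemma fejer_riesz:
  assumes "star f = f" "finite S"
    and "\<And>z. cmod z = 1 \<Longrightarrow> z \<notin> S \<Longrightarrow> regular z f \<Longrightarrow> 0 \<le> Re (rat_eval f z)"
  shows "\<exists>h. f = star h * h"
proof -
  obtain a b where b: "b \<noteq> 0" and f: "f = to_fract a / to_fract b" by (rule ratfun_cases)
  define B where "B = to_fract b"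
  have B: "B \<noteq> 0" using b by (simp add: B_def)
  define P where "P = a * reflect_poly b"
  have F: "to_fract P / rat_z ^ degree b = star B * B * f"
    using b by (simp add: P_def B_def f star_to_fract recip_eval_conv)
  have "\<exists>h. to_fract P / rat_z ^ degree b = star h * h"
  proof (rule fejer_riesz_laurent)
    show "star (to_fract P / rat_z ^ degree b) = to_fract P / rat_z ^ degree b"
      unfolding F using assms(1) by simp
    show "finite (S \<union> {z. ceval b z = 0})" using b assms(2) by (simp add: poly_roots_finite)
    show "0 \<le> Re (ceval P z / z ^ degree b)"
      if z: "cmod z = 1" "z \<notin> S \<union> {z. ceval b z = 0}" for z
    proof -
      have z0: "z \<noteq> 0" using z by auto
      have r: "regular z f" "regular z B" "regular z (star B)"
        using regularI[OF f] z by (auto simp: B_def regular_star_circle)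
      have "ceval P z / z ^ degree b = rat_eval (star B) z * rat_eval B z * rat_eval f z"
        using r laurent_facts(2)[OF z0, of P "degree b"] by (simp add: F rat_eval_mult regular_mult)
      also have "\<dots> = of_real ((cmod (rat_eval B z))\<^sup>2) * rat_eval f z"
        using r z by (simp add: rat_eval_star_circle complex_norm_square mult.commute del: of_real_power)
      finally show ?thesis
        using assms(3)[of z] z r
        by (simp only: Re_complex_of_real Im_complex_of_real times_complex.sel) simp
    qed
  qed
  then obtain h where h: "star B * B * f = star h * h" by (auto simp: F)
  then have "f = star (h / B) * (h / B)" using B by (simp add: field_simps)
  then show ?thesis by blast
qed

section \<open>Hermitian forms and rank\<close>

text \<open>Padding with zero rows gives a square matrix; every term of its Leibniz expansion
  contains an entry of the zero last row, so its determinant vanishes.\<close>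

lemma ex_kernel:
  fixes a :: "nat \<Rightarrow> nat \<Rightarrow> 'a::field"
  assumes "m < k"
  shows "\<exists>c. (\<exists>j<k. c j \<noteq> 0) \<and> (\<forall>i<m. (\<Sum>j<k. a i j * c j) = 0)"
proof -
  define A where "A = mat k k (\<lambda>(i, j). if i < m then a i j else 0)"
  have A: "A \<in> carrier_mat k k" by (simp add: A_def)
  have "det A = (\<Sum>p\<in>{p. p permutes {0..<k}}. signof p * (\<Prod>i = 0..<k. A $$ (i, p i)))"
    using A by (rule det_def')
  also have "\<dots> = 0"
  proof (rule sum.neutral, rule ballI)
    fix p assume "p \<in> {p. p permutes {0..<k}}"
    then have "p (k - 1) < k" using assms permutes_in_image[of p "{0..<k}" "k - 1"] by auto
    then have "A $$ (k - 1, p (k - 1)) = 0" using assms by (simp add: A_def)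
    then have "(\<Prod>i = 0..<k. A $$ (i, p i)) = 0"
      using assms by (intro prod_zero) auto
    then show "signof p * (\<Prod>i = 0..<k. A $$ (i, p i)) = 0" by simp
  qed
  finally obtain v where v: "v \<in> carrier_vec k" "v \<noteq> 0\<^sub>v k" "A *\<^sub>v v = 0\<^sub>v k"
    using det_0_iff_vec_prod_zero_field[OF A] by blast
  have "\<exists>j<k. v $ j \<noteq> 0"
  proof (rule ccontr)
    assume "\<not> ?thesis"
    then have "v = 0\<^sub>v k" using v(1) by (intro eq_vecI) auto
    then show False using v(2) by simp
  qed
  moreover have "(\<Sum>j<k. a i j * v $ j) = 0" if "i < m" for i
  proof -
    have "(A *\<^sub>v v) $ i = (\<Sum>j<k. a i j * v $ j)"
      using that assms v(1) by (simp add: A_def scalar_prod_def atLeast0LessThan)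
    then show ?thesis using v(3) that assms by simp
  qed
  ultimately show ?thesis by blast
qed

lemma mat_mult_index:
  assumes "A \<in> carrier_mat n m" "B \<in> carrier_mat m k" "i < n" "j < k"
  shows "(A * B) $$ (i, j) = (\<Sum>l<m. A $$ (i, l) * B $$ (l, j))"
  using assms by (simp add: scalar_prod_def atLeast0LessThan)

text \<open>If n > m, then B kills a nonzero vector, and so does A * B.\<close>

lemma right_inverse_dim_le:
  fixes A B :: "'a::field mat"
  assumes "A \<in> carrier_mat n m" "B \<in> carrier_mat m n" "A * B = 1\<^sub>m n"
  shows "n \<le> m"
proof (rule ccontr)
  assume "\<not> n \<le> m"
  then obtain c where c: "\<exists>j<n. c j \<noteq> 0" "\<forall>i<m. (\<Sum>j<n. B $$ (i, j) * c j) = 0"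
    using ex_kernel[of m n "\<lambda>i j. B $$ (i, j)"] by auto
  define v where "v = vec n c"
  have v: "v \<in> carrier_vec n" by (simp add: v_def)
  have "B *\<^sub>v v = 0\<^sub>v m"
    using assms(2) c(2) by (intro eq_vecI) (auto simp: v_def scalar_prod_def atLeast0LessThan)
  then have "A *\<^sub>v (B *\<^sub>v v) = 0\<^sub>v n" using assms(1) by auto
  then have "v = 0\<^sub>v n"
    using assms v by (simp flip: assoc_mult_mat_vec)
  then have "c j = 0" if "j < n" for j using that unfolding v_def by (metis index_vec index_zero_vec(1))
  then show False using c(1) by blast
qed

lemma right_inverse_square:
  fixes A B :: "'a::field mat"
  assumes "A \<in> carrier_mat n n" "B \<in> carrier_mat n n" "A * B = 1\<^sub>m n"
  shows "B * A = 1\<^sub>m n"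
  using mat_mult_left_right_inverse[OF assms] .

section \<open>Para-conjugation and the Hermitian form of a matrix\<close>

lemma para_conj_carrier [simp]: "A \<in> carrier_mat n m \<Longrightarrow> para_conj A \<in> carrier_mat m n"
  by (simp add: para_conj_def)

lemma para_conj_index [simp]:
  "A \<in> carrier_mat n m \<Longrightarrow> i < m \<Longrightarrow> j < n \<Longrightarrow> para_conj A $$ (i, j) = star (A $$ (j, i))"
  by (simp add: para_conj_def star_def)

lemma para_conj_dim [simp]: "dim_row (para_conj A) = dim_col A" "dim_col (para_conj A) = dim_row A"
  by (simp_all add: para_conj_def)

lemma para_conj_mult:
  assumes "A \<in> carrier_mat n m" "B \<in> carrier_mat m k"
  shows "para_conj (A * B) = para_conj B * para_conj A"
  using assms unfolding para_conj_def star_def[symmetric]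
  by (simp add: star.mat_hom_mult[OF assms] transpose_mult[of _ n m _ k])

lemma para_conj_para_conj [simp]: "para_conj (para_conj A) = A"
  by (intro eq_matI) (auto simp: para_conj_def simp flip: star_def)

lemma para_conj_one [simp]: "para_conj (1\<^sub>m n) = 1\<^sub>m n"
  by (intro eq_matI) (auto simp: para_conj_def simp flip: star_def)

text \<open>The sesquilinear form of \<Phi>, conjugate-linear under \<open>star\<close> in the first
  argument. Vectors are functions of which the first n values count, so that families are extended
  by function update.\<close>

definition sform :: "nat \<Rightarrow> ratfun mat \<Rightarrow> (nat \<Rightarrow> ratfun) \<Rightarrow> (nat \<Rightarrow> ratfun) \<Rightarrow> ratfun" where
  "sform n \<Phi> u v = (\<Sum>i<n. \<Sum>j<n. star (u i) * \<Phi> $$ (i, j) * v j)"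

lemma sform_right:
  "sform n \<Phi> u (\<lambda>i. v i + c * w i) = sform n \<Phi> u v + c * sform n \<Phi> u w"
  by (simp add: sform_def sum.distrib sum_distrib_left algebra_simps)

lemma sform_right_sum:
  "sform n \<Phi> u (\<lambda>i. \<Sum>k\<in>K. c k * w k i) = (\<Sum>k\<in>K. c k * sform n \<Phi> u (w k))"
proof (induction K rule: infinite_finite_induct)
  case (insert x K)
  then have "sform n \<Phi> u (\<lambda>i. \<Sum>k\<in>insert x K. c k * w k i)
    = sform n \<Phi> u (\<lambda>i. (\<Sum>k\<in>K. c k * w k i) + c x * w x i)"
    by (simp add: add.commute)
  then show ?case using insert by (simp only: sform_right) simp
qed (simp_all add: sform_def)

lemma star_sform:
  assumes "\<Phi> \<in> carrier_mat n n" "para_conj \<Phi> = \<Phi>"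
  shows "star (sform n \<Phi> u v) = sform n \<Phi> v u"
proof -
  have s: "star (\<Phi> $$ (i, j)) = \<Phi> $$ (j, i)" if "i < n" "j < n" for i j
    using para_conj_index[OF assms(1) that(2,1)] assms(2) by simp
  have "star (sform n \<Phi> u v) = (\<Sum>i<n. \<Sum>j<n. star (v j) * \<Phi> $$ (j, i) * u i)"
    unfolding sform_def by (simp add: s algebra_simps)
  also have "\<dots> = sform n \<Phi> v u" unfolding sform_def by (rule sum.swap)
  finally show ?thesis .
qed

lemma sform_left:
  assumes "\<Phi> \<in> carrier_mat n n" "para_conj \<Phi> = \<Phi>"
  shows "sform n \<Phi> (\<lambda>i. v i + c * w i) u = sform n \<Phi> v u + star c * sform n \<Phi> w u"
  using sform_right[of n \<Phi> u v c w] star_sform[OF assms] by (metis star_add star_mult)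

lemma sform_left_sum:
  assumes "\<Phi> \<in> carrier_mat n n" "para_conj \<Phi> = \<Phi>"
  shows "sform n \<Phi> (\<lambda>i. \<Sum>k\<in>K. c k * w k i) u = (\<Sum>k\<in>K. star (c k) * sform n \<Phi> (w k) u)"
proof -
  have "sform n \<Phi> (\<lambda>i. \<Sum>k\<in>K. c k * w k i) u = star (\<Sum>k\<in>K. c k * sform n \<Phi> u (w k))"
    by (simp only: sform_right_sum[symmetric] star_sform[OF assms])
  then show ?thesis by (simp add: star_sform[OF assms])
qed

definition sbasis :: "nat \<Rightarrow> nat \<Rightarrow> ratfun" where
  "sbasis k i = (if i = k then 1 else 0)"

lemma sform_sbasis_right:
  "j < n \<Longrightarrow> sform n \<Phi> u (sbasis j) = (\<Sum>i<n. star (u i) * \<Phi> $$ (i, j))"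
  by (simp add: sform_def sbasis_def sum.delta if_distrib cong: if_cong)

lemma sform_sbasis:
  "i < n \<Longrightarrow> j < n \<Longrightarrow> sform n \<Phi> (sbasis i) (sbasis j) = \<Phi> $$ (i, j)"
  by (subst sform_sbasis_right) (simp_all add: sbasis_def if_distrib[of star] if_distrib[of "\<lambda>x. x * _"] sum.delta cong: if_cong)

text \<open>Subtracting from the form its part on a maximal orthonormal family leaves a form that vanishes on
  the diagonal, hence everywhere, because \<open>star z \<noteq> z\<close>.\<close>

lemma hermitian_form_factorization:
  assumes \<Phi>: "\<Phi> \<in> carrier_mat n n" "para_conj \<Phi> = \<Phi>"
    and sq: "\<And>v. \<exists>h. sform n \<Phi> v v = star h * h"
  shows "\<exists>s L Y. L \<in> carrier_mat s n \<and> Y \<in> carrier_mat n s \<and> para_conj L * L = \<Phi> \<and> L * Y = 1\<^sub>m s"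
proof -
  let ?f = "sform n \<Phi>"
  \<comment> \<open>Q s says that s orthonormal vectors exist. Pairing a linear relation with each
    of the vectors kills its coefficients, which bounds s by n.\<close>
  define Q where "Q s \<longleftrightarrow> (\<exists>u. \<forall>i<s. \<forall>j<s. ?f (u i) (u j) = (if i = j then 1 else 0))" for s :: nat
  have bound: "s \<le> n" if Qs: "Q s" for s :: nat
  proof (rule ccontr)
    assume sn: "\<not> s \<le> n"
    obtain u where u: "\<And>i j. i < s \<Longrightarrow> j < s \<Longrightarrow> ?f (u i) (u j) = (if i = j then 1 else 0)"
      using Qs unfolding Q_def by metis
    obtain c where c: "\<exists>j<s. c j \<noteq> 0" "\<forall>i<n. (\<Sum>j<s. u j i * c j) = 0"
      using ex_kernel[of n s "\<lambda>i j. u j i"] sn by auto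
    have "c l = 0" if l: "l < s" for l
    proof -
      have "?f (u l) (\<lambda>i. \<Sum>j<s. c j * u j i) = (\<Sum>j<s. c j * (if l = j then 1 else 0))"
        unfolding sform_right_sum using u l by (intro sum.cong) auto
      also have "\<dots> = c l" using l by (simp add: if_distrib cong: if_cong)
      also have "?f (u l) (\<lambda>i. \<Sum>j<s. c j * u j i) = 0"
        unfolding sform_def using c(2) by (intro sum.neutral ballI) (simp add: mult.commute)
      finally show ?thesis by simp
    qed
    then show False using c(1) by blast
  qed
  have "Q 0" by (simp add: Q_def)
  define s where "s = (GREATEST s. Q s)"
  have "Q s" unfolding s_def using \<open>Q 0\<close> bound by (rule GreatestI_nat)
  then obtain u where u: "\<And>i j. i < s \<Longrightarrow> j < s \<Longrightarrow> ?f (u i) (u j) = (if i = j then 1 else 0)"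
    unfolding Q_def by blast
  have nQ: "\<not> Q (Suc s)" using Greatest_le_nat[of Q "Suc s" n] bound unfolding s_def by auto
  define g where "g x y = ?f x y - (\<Sum>k<s. ?f x (u k) * ?f (u k) y)" for x y
  have g0: "g v v = 0" for v
  proof (rule ccontr)
    assume gv: "g v v \<noteq> 0"
    \<comment> \<open>w is the component of v orthogonal to all u k, and its square is
      \<open>g v v\<close>. Were this nonzero, it would be \<open>star h * h\<close>, and w / h
      would extend the maximal family.\<close>
    define w where "w = (\<lambda>i. v i + (- 1) * (\<Sum>k<s. ?f (u k) v * u k i))"
    have w_alt: "w = (\<lambda>i. v i - (\<Sum>k<s. ?f (u k) v * u k i))" by (simp add: w_def)
    have uw: "?f (u l) w = 0" if l: "l < s" for l
    proof -
      have "?f (u l) (\<lambda>i. \<Sum>k<s. ?f (u k) v * u k i) = (\<Sum>k<s. ?f (u k) v * (if l = k then 1 else 0))"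
        unfolding sform_right_sum using u l by (intro sum.cong) auto
      also have "\<dots> = ?f (u l) v" using l by (simp add: if_distrib cong: if_cong)
      finally show ?thesis unfolding w_def sform_right by simp
    qed
    have "?f w w = ?f v w - ?f (\<lambda>i. \<Sum>k<s. ?f (u k) v * u k i) w"
      using sform_left[OF \<Phi>, of v "- 1" "\<lambda>i. \<Sum>k<s. ?f (u k) v * u k i" w] by (simp flip: w_alt)
    also have "?f (\<lambda>i. \<Sum>k<s. ?f (u k) v * u k i) w = 0"
      unfolding sform_left_sum[OF \<Phi>] using uw by simp
    also have "?f v w - 0 = g v v"
      unfolding w_def sform_right sform_right_sum g_def by (simp add: mult.commute)
    finally have ww: "?f w w = g v v" by simp
    obtain h where h: "?f w w = star h * h" using sq by blast
    then have hnz: "h \<noteq> 0" using ww gv by auto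
    define y where "y = (\<lambda>i. 0 + inverse h * w i)"
    have f0: "?f x (\<lambda>_. 0) = 0" "?f (\<lambda>_. 0) x = 0" for x by (simp_all add: sform_def)
    have fl: "?f y x = inverse (star h) * ?f w x" for x
      using sform_left[OF \<Phi>, of "\<lambda>_. 0" "inverse h" w x] by (simp add: y_def f0)
    have fr: "?f x y = inverse h * ?f x w" for x
      using sform_right[of n \<Phi> x "\<lambda>_. 0" "inverse h" w] by (simp add: y_def f0)
    have yy: "?f y y = 1"
      unfolding fl fr h using hnz by (simp add: field_simps)
    have uy: "?f (u l) y = 0" if "l < s" for l
      using that by (simp add: fr uw)
    then have yu: "?f y (u l) = 0" if "l < s" for l
      using star_sform[OF \<Phi>, of "u l" y] that by simp
    have "\<forall>i<Suc s. \<forall>j<Suc s. ?f ((u(s := y)) i) ((u(s := y)) j) = (if i = j then 1 else 0)"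
      using u yy uy yu by (auto simp: less_Suc_eq)
    then show False using nQ unfolding Q_def by blast
  qed
  have gstar: "star (g x y) = g y x" for x y
    unfolding g_def by (simp add: star_sform[OF \<Phi>] mult.commute)
  have gr: "g x (\<lambda>i. v i + c * w i) = g x v + c * g x w" for x v c w
    unfolding g_def by (simp add: sform_right sum.distrib sum_distrib_left algebra_simps)
  have gl: "g (\<lambda>i. v i + c * w i) x = g v x + star c * g w x" for x v c w
    using gr[of x v c w] gstar by (metis star_add star_mult)
  have g: "g x y = 0" for x y
  proof -
    \<comment> \<open>Polarization: c = 1 gives \<open>g y x = - g x y\<close>, and c =
      \<open>rat_z\<close> then says that multiplying \<open>g x y\<close> by z or by 1/z has the
      same effect.\<close>
    have *: "c * g x y + star c * g y x = 0" for c
      using g0[of "\<lambda>i. x i + c * y i"] by (simp add: gr gl g0)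
    have "g y x = - g x y" using *[of 1] by (simp add: eq_neg_iff_add_eq_0 add.commute)
    then have "rat_z * g x y = 1 / rat_z * g x y" using *[of rat_z] by (simp add: star_rat_z)
    then have "(rat_z * rat_z - 1) * g x y = 0" by (simp add: field_simps)
    moreover have "rat_z * rat_z - 1 \<noteq> 0"
    proof -
      have "rat_z * rat_z - 1 = to_fract [:-1, 0, 1:]"
        by (simp add: rat_z_def one_pCons flip: to_fract_mult to_fract_1 to_fract_diff)
      then show ?thesis by simp
    qed
    ultimately show ?thesis by simp
  qed
  \<comment> \<open>The columns of Y are the orthonormal vectors, and row k of L is the functional
    \<open>?f (u k)\<close>. So L * Y is their Gram matrix, and the vanishing of g says that
    \<open>para_conj L * L\<close> is \<Phi>.\<close>
  define Y where "Y = mat n s (\<lambda>(i, k). u k i)"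
  define L where "L = mat s n (\<lambda>(k, j). ?f (u k) (sbasis j))"
  have Y: "Y \<in> carrier_mat n s" and L: "L \<in> carrier_mat s n" by (simp_all add: Y_def L_def)
  have "L * Y = 1\<^sub>m s"
  proof (rule eq_matI)
    fix k l assume "k < dim_row (1\<^sub>m s)" "l < dim_col (1\<^sub>m s)"
    then have kl: "k < s" "l < s" by auto
    have "(L * Y) $$ (k, l) = (\<Sum>j<n. ?f (u k) (sbasis j) * u l j)"
      using kl mat_mult_index[OF L Y kl] by (simp add: L_def Y_def)
    also have "\<dots> = (\<Sum>j<n. \<Sum>i<n. star (u k i) * \<Phi> $$ (i, j) * u l j)"
      by (simp add: sform_sbasis_right sum_distrib_right)
    also have "\<dots> = ?f (u k) (u l)" unfolding sform_def by (rule sum.swap)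
    finally show "(L * Y) $$ (k, l) = 1\<^sub>m s $$ (k, l)" using kl u by simp
  qed (simp_all add: L_def Y_def)
  moreover have "para_conj L * L = \<Phi>"
  proof (rule eq_matI)
    fix i j assume "i < dim_row \<Phi>" "j < dim_col \<Phi>"
    then have ij: "i < n" "j < n" using \<Phi> by auto
    have "(para_conj L * L) $$ (i, j) = (\<Sum>k<s. star (L $$ (k, i)) * L $$ (k, j))"
      using mat_mult_index[OF para_conj_carrier[OF L] L ij] L ij by simp
    also have "\<dots> = (\<Sum>k<s. ?f (sbasis i) (u k) * ?f (u k) (sbasis j))"
      using ij by (simp add: L_def star_sform[OF \<Phi>])
    also have "\<dots> = ?f (sbasis i) (sbasis j)" using g[of "sbasis i" "sbasis j"] by (simp add: g_def)
    finally show "(para_conj L * L) $$ (i, j) = \<Phi> $$ (i, j)" using ij by (simp add: sform_sbasis)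
  qed (use L \<Phi> in auto)
  ultimately show ?thesis using Y L by blast
qed

section \<open>Rank as the least inner dimension of a factorization\<close>

lemma (in vec_space) rank_column_basis:
  assumes A: "A \<in> carrier_mat n m"
  obtains xs where "distinct xs" "set xs \<subseteq> set (cols A)" "lin_indpt (set xs)"
    "rank A = length xs" "set (cols A) \<subseteq> span (set xs)"
proof -
  have Cc: "set (cols A) \<subseteq> carrier_vec n" using cols_dim[of A] A by auto
  obtain S where S: "maximal S (\<lambda>T. T \<subseteq> set (cols A) \<and> lin_indpt T)"
    using maximal_exists[of "(\<lambda>T. T \<subseteq> set (cols A) \<and> lin_indpt T)" "card (set (cols A))" "{}"]
    by (meson List.finite_set card_mono empty_iff empty_subsetI finite_lin_indpt2 rev_finite_subset)
  then have Ss: "S \<subseteq> set (cols A)" "lin_indpt S"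
    and Smax: "\<And>T. S \<subseteq> T \<Longrightarrow> T \<subseteq> set (cols A) \<Longrightarrow> lin_indpt T \<Longrightarrow> T = S"
    by (auto simp: maximal_def)
  then have Sc: "S \<subseteq> carrier_vec n" using Cc by blast
  have fS: "finite S" using Ss finite_subset by blast
  obtain xs where xs: "set xs = S" "distinct xs" using finite_distinct_list[OF fS] by blast
  have "rank A = length xs"
    using rank_card_indpt[OF A S] xs distinct_card by metis
  moreover have "set (cols A) \<subseteq> span S"
  proof
    fix a assume a: "a \<in> set (cols A)"
    show "a \<in> span S"
    proof (rule ccontr)
      assume na: "a \<notin> span S"
      have aS: "a \<notin> S" using na span_mem[OF Sc] by blast
      have "lin_indpt (S \<union> {a})"
        using lin_dep_iff_in_span[of S a] Ss Sc a Cc na aS by auto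
      then show False using Smax[of "S \<union> {a}"] a Ss aS by auto
    qed
  qed
  ultimately show ?thesis using that[of xs] xs Ss by simp
qed

text \<open>Columns of P * Q are images under P of vectors of length k; more than k such vectors are
  dependent, and so are their images.\<close>

lemma rank_le_inner_dim:
  fixes P Q :: "'a::field mat"
  assumes "P \<in> carrier_mat n k" "Q \<in> carrier_mat k m"
  shows "vec_space.rank n (P * Q) \<le> k"
proof -
  interpret vec_space "TYPE('a)" n .
  let ?A = "P * Q"
  have A: "?A \<in> carrier_mat n m" using assms by simp
  obtain xs where xs': "distinct xs" "set xs \<subseteq> set (cols ?A)" "lin_indpt (set xs)" and rk: "rank ?A = length xs"
    using rank_column_basis[OF A] by metis
  define S where "S = set xs"
  have xs: "set xs = S" "distinct xs" and Ss: "S \<subseteq> set (cols ?A)" "lin_indpt S" using xs' by (auto simp: S_def)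
  have Sc: "S \<subseteq> carrier_vec n" using Ss(1) cols_dim[of ?A] A by (metis carrier_matD(1) subset_trans)
  show ?thesis
  proof (rule ccontr)
    assume "\<not> ?thesis"
    then have lt: "k < length xs" using rk by simp
    have "\<exists>q\<in>carrier_vec k. a = P *\<^sub>v q" if aS: "a \<in> S" for a
    proof -
      have "set (cols ?A) = col ?A ` {0..<m}" using A unfolding cols_def by (simp only: carrier_matD set_map set_upt)
      then obtain j where j: "j < m" "a = col ?A j"
        using aS Ss(1) by (auto simp del: col_mult2)
      have "a = P *\<^sub>v col Q j" unfolding j(2) by (rule col_mult2[OF assms j(1)])
      moreover have "col Q j \<in> carrier_vec k" using assms by auto
      ultimately show ?thesis by blast
    qed
    then obtain q where q: "\<And>a. a \<in> S \<Longrightarrow> q a \<in> carrier_vec k" "\<And>a. a \<in> S \<Longrightarrow> a = P *\<^sub>v q a" by metis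
    obtain c where c: "\<exists>j<length xs. c j \<noteq> 0" "\<forall>i<k. (\<Sum>j<length xs. q (xs ! j) $ i * c j) = 0"
      using ex_kernel[OF lt, of "\<lambda>i j. q (xs ! j) $ i"] by auto
    define B where "B = mat_of_cols n xs"
    define R where "R = mat_of_cols k (map q xs)"
    define v where "v = vec (length xs) c"
    have B: "B \<in> carrier_mat n (length xs)" and R: "R \<in> carrier_mat k (length xs)"
      using mat_of_cols_carrier(1)[of k "map q xs"] mat_of_cols_carrier(1)[of n xs] by (simp_all add: B_def R_def)
    have v: "v \<in> carrier_vec (length xs)" by (simp add: v_def)
    have cB: "cols B = xs" unfolding B_def using Sc xs by simp
    have "B = P * R"
    proof (rule mat_col_eqI)
      fix j assume "j < dim_col (P * R)"
      then have j: "j < length xs" by (simp add: R_def)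
      then have xj: "xs ! j \<in> S" using xs by auto
      have "col B j = xs ! j" using cB j B by (metis carrier_matD(2) cols_nth)
      also have "\<dots> = P *\<^sub>v col R j"
        using q[OF xj] j unfolding R_def by (simp add: col_mat_of_cols)
      finally show "col B j = col (P * R) j" by (simp only: col_mult2[OF assms(1) R j])
    qed (use B R assms in auto)
    moreover have "R *\<^sub>v v = 0\<^sub>v k"
      using c(2) R by (intro eq_vecI)
        (auto simp: v_def R_def scalar_prod_def atLeast0LessThan mat_of_cols_def)
    ultimately have "B *\<^sub>v v = 0\<^sub>v n" using assms(1) R v by (auto simp: assoc_mult_mat_vec)
    moreover have "v \<noteq> 0\<^sub>v (length xs)" using c(1) unfolding v_def by (metis index_vec index_zero_vec(1))
    ultimately have "lin_dep (set (cols B))" using lin_depI[OF B v] cB xs by auto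
    then show False using Ss(2) cB xs by simp
  qed
qed

text \<open>P consists of independent columns of A that span all columns, and Q of the
  coordinates.\<close>

lemma rank_factorization:
  fixes A :: "'a::field mat"
  assumes A: "A \<in> carrier_mat n m"
  shows "\<exists>P Q. P \<in> carrier_mat n (vec_space.rank n A) \<and> Q \<in> carrier_mat (vec_space.rank n A) m \<and> A = P * Q"
proof -
  interpret vec_space "TYPE('a)" n .
  obtain xs where xs': "distinct xs" "set xs \<subseteq> set (cols A)" and sp: "set (cols A) \<subseteq> span (set xs)"
    and rk: "rank A = length xs"
    using rank_column_basis[OF A] by metis
  define S where "S = set xs"
  have xs: "set xs = S" "distinct xs" and Ss: "S \<subseteq> set (cols A)" using xs' by (auto simp: S_def)
  have fS: "finite S" by (simp add: S_def)
  have Cc: "set (cols A) \<subseteq> carrier_vec n" using cols_dim[of A] A by auto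
  then have Sc: "S \<subseteq> carrier_vec n" using Ss by auto
  define P where "P = mat_of_cols n xs"
  have P: "P \<in> carrier_mat n (length xs)" by (simp add: P_def)
  have cP: "cols P = xs" unfolding P_def using Sc xs by simp
  have "\<exists>q\<in>carrier_vec (length xs). col A j = P *\<^sub>v q" if j: "j < m" for j
  proof -
    let ?a = "col A j"
    have aC: "?a \<in> set (cols A)" using A j by (metis carrier_matD(2) cols_length cols_nth nth_mem)
    have "?a \<in> span S" using sp aC S_def by blast
    then obtain b where "lincomb b S = ?a"
      using finite_in_span[OF fS Sc] by auto
    then have "?a = P *\<^sub>v vec (length xs) (\<lambda>i. b (col P i))"
      using mat_mult_eq_lincomb[OF P, of b] cP xs by simp
    then show ?thesis by auto
  qed
  then obtain q where q: "\<And>j. j < m \<Longrightarrow> q j \<in> carrier_vec (length xs)" "\<And>j. j < m \<Longrightarrow> col A j = P *\<^sub>v q j"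
    by metis
  define Q where "Q = mat_of_cols (length xs) (map q [0..<m])"
  have Q: "Q \<in> carrier_mat (length xs) m" by (auto simp: Q_def)
  have "A = P * Q"
  proof (rule mat_col_eqI)
    fix j assume "j < dim_col (P * Q)"
    then have j: "j < m" by (simp add: Q_def)
    have "col Q j = q j" using q(1) j unfolding Q_def by (simp add: col_mat_of_cols)
    then show "col A j = col (P * Q) j" by (simp only: col_mult2[OF P Q j] q(2)[OF j])
  qed (use A P Q in auto)
  then show ?thesis using P Q rk by auto
qed

lemma mat_mult_regroup:
  fixes A B C D :: "'a::comm_ring_1 mat"
  assumes "A \<in> carrier_mat a b" "B \<in> carrier_mat b c" "C \<in> carrier_mat c d" "D \<in> carrier_mat d e"
  shows "(A * B) * (C * D) = A * (B * C) * D"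
proof -
  have "(A * B) * (C * D) = (A * B) * C * D"
    using assoc_mult_mat[of "A * B" a c C d D e] assms by simp
  also have "(A * B) * C = A * (B * C)" using assms by simp
  finally show ?thesis .
qed

text \<open>Multiplication by C and D turns any factorization of P * Q into one of
  \<open>1\<^sub>m k\<close>, whose inner dimension is at least k.\<close>

lemma rank_eq_inner_dim:
  fixes P Q :: "'a::field mat"
  assumes "P \<in> carrier_mat n k" "Q \<in> carrier_mat k m" "C \<in> carrier_mat k n" "D \<in> carrier_mat m k"
    and "C * P = 1\<^sub>m k" "Q * D = 1\<^sub>m k"
  shows "vec_space.rank n (P * Q) = k"
proof (rule antisym[OF rank_le_inner_dim[OF assms(1,2)]])
  let ?r = "vec_space.rank n (P * Q)"
  obtain P' Q' where PQ: "P' \<in> carrier_mat n ?r" "Q' \<in> carrier_mat ?r m" "P * Q = P' * Q'"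
    using rank_factorization[of "P * Q" n m] assms by auto
  have "(C * P') * (Q' * D) = C * (P' * Q') * D"
    by (rule mat_mult_regroup[OF assms(3) PQ(1,2) assms(4)])
  also have "\<dots> = (C * P) * (Q * D)"
    unfolding PQ(3)[symmetric] by (rule mat_mult_regroup[OF assms(3,1,2,4), symmetric])
  also have "\<dots> = 1\<^sub>m k" using assms by simp
  finally show "k \<le> ?r"
    using right_inverse_dim_le[of "C * P'" k ?r "Q' * D"] assms PQ by auto
qed

section \<open>Wandering vectors\<close>

text \<open>Reversal with respect to a fixed length: z^d p(1/z) for degree at most d. Unlike
  \<open>reflect_poly\<close> it is linear in p, as the dimension count requires.\<close>

definition revp :: "nat \<Rightarrow> real poly \<Rightarrow> real poly" where
  "revp d p = (\<Sum>i\<le>d. monom (coeff p (d - i)) i)"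

lemma coeff_revp [simp]: "coeff (revp d p) i = (if i \<le> d then coeff p (d - i) else 0)"
  by (simp add: revp_def coeff_sum sum.delta if_distrib cong: if_cong)

lemma revp_add: "revp d (p + q) = revp d p + revp d q"
  by (intro poly_eqI) simp

lemma revp_smult: "revp d (smult c p) = smult c (revp d p)"
  by (intro poly_eqI) simp

lemma revp_0 [simp]: "revp d 0 = 0"
  by (intro poly_eqI) simp

lemma revp_sum: "revp d (sum f A) = (\<Sum>x\<in>A. revp d (f x))"
  by (induction A rule: infinite_finite_induct) (simp_all add: revp_add)

lemma degree_revp: "degree (revp d p) \<le> d"
  by (rule degree_le) simp

lemma revp_revp: "degree p \<le> d \<Longrightarrow> revp d (revp d p) = p"
  by (intro poly_eqI) (auto simp: coeff_eq_0)

lemma to_fract_revp: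
  assumes "degree p \<le> d"
  shows "to_fract (revp d p) = rat_z ^ d * star (to_fract p)"
proof -
  have "revp d p = monom 1 (d - degree p) * reflect_poly p"
    using assms by (intro poly_eqI) (auto simp: coeff_monom_mult coeff_reflect_poly coeff_eq_0)
  then have "to_fract (revp d p) = rat_z ^ (d - degree p) * to_fract (reflect_poly p)"
    by (simp add: rat_z_power)
  also have "\<dots> = rat_z ^ (d - degree p) * rat_z ^ degree p * star (to_fract p)"
    by (simp add: star_to_fract recip_eval_conv)
  finally show ?thesis using assms by (simp flip: power_add)
qed

lemma star_revp:
  assumes "degree p \<le> d"
  shows "star (to_fract (revp d p)) = to_fract p / rat_z ^ d"
  by (simp add: to_fract_revp[OF assms] star_rat_z power_divide)

text \<open>For u of degree at most d this is z^d times the pairing of \<open>star u\<close> with v;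
  the power of z keeps it polynomial, so that divisibility by p makes sense.\<close>

definition pdot :: "nat \<Rightarrow> nat \<Rightarrow> (nat \<Rightarrow> real poly) \<Rightarrow> (nat \<Rightarrow> real poly) \<Rightarrow> real poly" where
  "pdot r d u v = (\<Sum>k<r. revp d (u k) * v k)"

text \<open>The euclidean inner product of the coefficients up to degree d. It is also the
  coefficient of z^d in \<open>pdot\<close>, which links it to the Gram entries.\<close>

definition pinner :: "nat \<Rightarrow> nat \<Rightarrow> (nat \<Rightarrow> real poly) \<Rightarrow> (nat \<Rightarrow> real poly) \<Rightarrow> real" where
  "pinner r d u v = (\<Sum>k<r. \<Sum>e\<le>d. coeff (u k) e * coeff (v k) e)"

lemma coeff_revp_mult: "coeff (revp d a * b) d = (\<Sum>e\<le>d. coeff a e * coeff b e)"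
proof -
  have "coeff (revp d a * b) d = (\<Sum>i\<le>d. coeff a (d - i) * coeff b (d - i))"
    unfolding coeff_mult by (intro sum.cong) auto
  also have "\<dots> = (\<Sum>e\<le>d. coeff a e * coeff b e)"
    by (rule sum.reindex_bij_witness[of _ "\<lambda>i. d - i" "\<lambda>i. d - i"]) auto
  finally show ?thesis .
qed

lemma coeff_pdot: "coeff (pdot r d u v) d = pinner r d u v"
  by (simp add: pdot_def pinner_def coeff_sum coeff_revp_mult)

lemma pinner_commute: "pinner r d u v = pinner r d v u"
  by (simp add: pinner_def mult.commute)

lemma pinner_smult_right: "pinner r d u (\<lambda>k. smult c (v k)) = c * pinner r d u v"
  by (simp add: pinner_def sum_distrib_left mult.left_commute)

lemma pinner_pos:
  assumes "k < r" "v k \<noteq> 0" "degree (v k) \<le> d"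
  shows "pinner r d v v > 0"
proof -
  have "0 < (\<Sum>e\<le>d. coeff (v k) e * coeff (v k) e)"
    using assms by (intro sum_pos2[of _ "degree (v k)"]) (auto simp flip: power2_eq_square)
  then show ?thesis unfolding pinner_def
    using assms(1) by (intro sum_pos2[of "{..<r}" k] sum_nonneg) auto
qed

definition pcomb :: "nat \<Rightarrow> (nat \<Rightarrow> real) \<Rightarrow> (nat \<Rightarrow> nat \<Rightarrow> real poly) \<Rightarrow> nat \<Rightarrow> real poly" where
  "pcomb t c m k = (\<Sum>i<t. smult (c i) (m i k))"

lemma pinner_pcomb: "pinner r d u (pcomb t c m) = (\<Sum>i<t. pinner r d u (m i) * c i)"
proof -
  have "pinner r d u (pcomb t c m) = (\<Sum>k<r. \<Sum>e\<le>d. \<Sum>i<t. coeff (u k) e * coeff (m i k) e * c i)"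
    by (simp add: pinner_def pcomb_def coeff_sum sum_distrib_left algebra_simps)
  also have "\<dots> = (\<Sum>k<r. \<Sum>i<t. \<Sum>e\<le>d. coeff (u k) e * coeff (m i k) e * c i)"
    by (intro sum.cong refl sum.swap)
  also have "\<dots> = (\<Sum>i<t. \<Sum>k<r. \<Sum>e\<le>d. coeff (u k) e * coeff (m i k) e * c i)"
    by (rule sum.swap)
  finally show ?thesis by (simp add: pinner_def sum_distrib_right)
qed

lemma pdot_pcomb_left: "pdot r d (pcomb t c m) v = (\<Sum>i<t. smult (c i) (pdot r d (m i) v))"
proof -
  have "pdot r d (pcomb t c m) v = (\<Sum>k<r. \<Sum>i<t. smult (c i) (revp d (m i k) * v k))"
    by (simp add: pdot_def pcomb_def revp_sum revp_smult sum_distrib_right)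
  also have "\<dots> = (\<Sum>i<t. \<Sum>k<r. smult (c i) (revp d (m i k) * v k))" by (rule sum.swap)
  finally show ?thesis by (simp add: pdot_def smult_sum2)
qed

lemma pdot_pcomb_right: "pdot r d v (pcomb t c m) = (\<Sum>i<t. smult (c i) (pdot r d v (m i)))"
proof -
  have "pdot r d v (pcomb t c m) = (\<Sum>k<r. \<Sum>i<t. smult (c i) (revp d (v k) * m i k))"
    by (simp add: pdot_def pcomb_def sum_distrib_left)
  also have "\<dots> = (\<Sum>i<t. \<Sum>k<r. smult (c i) (revp d (v k) * m i k))" by (rule sum.swap)
  finally show ?thesis by (simp add: pdot_def smult_sum2)
qed

lemma poly_mod_sum: "(\<Sum>i\<in>A. f i) mod p = (\<Sum>i\<in>A. f i mod (p :: real poly))"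
  by (induction A rule: infinite_finite_induct) (simp_all add: poly_mod_add_left)

lemma coeff_mod_ge:
  fixes p x :: "real poly"
  assumes "p \<noteq> 0" "degree p \<le> e"
  shows "coeff (x mod p) e = 0"
proof (cases "x mod p = 0")
  case False
  then have "degree (x mod p) < degree p" using assms(1) by (rule degree_mod_less'[rotated])
  then show ?thesis using assms by (intro coeff_eq_0) auto
qed simp

text \<open>The module \<open>M\<close> lies between \<open>p R[z]\<^sup>r\<close> and \<open>R[z]\<^sup>r\<close>.  Wandering vectors of \<open>M\<close> are found among
  the vectors of degree at most \<open>degree p\<close> by a dimension count.\<close>

locale poly_submodule =
  fixes r :: nat and p :: "real poly" and M :: "(nat \<Rightarrow> real poly) \<Rightarrow> bool"
  assumes M_add: "M u \<Longrightarrow> M v \<Longrightarrow> M (\<lambda>k. u k + v k)"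
    and M_mult: "M u \<Longrightarrow> M (\<lambda>k. a * u k)"
    and M_p: "M (\<lambda>k. p * w k)"
    and monic: "lead_coeff p = 1"
begin

abbreviation "d \<equiv> degree p"

lemma p_nz: "p \<noteq> 0" using monic by auto

lemma M_pcomb: "(\<And>i. i < t \<Longrightarrow> M (m i)) \<Longrightarrow> M (pcomb t c m)"
proof (induction t)
  case 0
  then show ?case using M_p[of "\<lambda>_. 0"] by (simp add: pcomb_def[abs_def])
next
  case (Suc t)
  have "M (\<lambda>k. pcomb t c m k + [:c t:] * m t k)"
    by (intro M_add M_mult) (use Suc in auto)
  then show ?case by (simp add: pcomb_def[abs_def])
qed

text \<open>Canonical representatives of M modulo multiples of p. In the first r components they
  form a real space of dimension at most r * d, open to linear algebra.\<close>

definition N :: "(nat \<Rightarrow> real poly) \<Rightarrow> bool" where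
  "N u \<longleftrightarrow> M u \<and> (\<forall>k<r. u k mod p = u k)"

lemma N_mod: "M u \<Longrightarrow> N (\<lambda>k. u k mod p)"
proof -
  assume "M u"
  then have "M (\<lambda>k. u k + p * (- (u k div p)))" by (intro M_add M_p)
  moreover have "(\<lambda>k. u k + p * (- (u k div p))) = (\<lambda>k. u k mod p)"
    by (simp add: fun_eq_iff minus_mult_div_eq_mod)
  ultimately show ?thesis by (simp add: N_def)
qed

definition indep :: "nat \<Rightarrow> (nat \<Rightarrow> nat \<Rightarrow> real poly) \<Rightarrow> bool" where
  "indep t m \<longleftrightarrow> (\<forall>i<t. N (m i)) \<and> (\<forall>c. (\<forall>k<r. pcomb t c m k = 0) \<longrightarrow> (\<forall>i<t. c i = 0))"

lemma indep_bound: assumes "indep t m" shows "t \<le> r * d"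
proof (rule ccontr)
  assume "\<not> t \<le> r * d"
  \<comment> \<open>One equation per coefficient: index i stands for coefficient
    \<open>i mod d\<close> of component \<open>i div d\<close>.\<close>
  then obtain c where c: "\<exists>j<t. c j \<noteq> 0"
    "\<forall>i<r * d. (\<Sum>j<t. coeff (m j (i div d)) (i mod d) * c j) = 0"
    using ex_kernel[of "r * d" t "\<lambda>i j. coeff (m j (i div d)) (i mod d)"] by auto
  have "pcomb t c m k = 0" if k: "k < r" for k
  proof (rule poly_eqI)
    fix e
    show "coeff (pcomb t c m k) e = coeff 0 e"
    proof (cases "e < d")
      case True
      have "k * d + e < Suc k * d" using True by simp
      also have "\<dots> \<le> r * d" using k by (intro mult_right_mono) auto
      finally have "k * d + e < r * d" .
      moreover have "(k * d + e) div d = k" "(k * d + e) mod d = e" using True by auto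
      ultimately have "(\<Sum>j<t. coeff (m j k) e * c j) = 0" using c(2) by metis
      then show ?thesis by (simp add: pcomb_def coeff_sum mult.commute)
    next
      case False
      have "coeff (m j k) e = 0" if "j < t" for j
        using assms that k coeff_mod_ge[OF p_nz, of e "m j k"] False by (simp add: indep_def N_def)
      then show ?thesis by (simp add: pcomb_def coeff_sum)
    qed
  qed
  then show False using assms c(1) unfolding indep_def by blast
qed

lemma N_basis:
  obtains t m where "indep t m" "\<And>u. N u \<Longrightarrow> \<exists>b. \<forall>k<r. u k = pcomb t b m k"
proof -
  define t where "t = (GREATEST t. \<exists>m. indep t m)"
  have ex0: "\<exists>m. indep 0 m" by (simp add: indep_def)
  have bd: "\<And>y. \<exists>m. indep y m \<Longrightarrow> y \<le> r * d" using indep_bound by blast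
  have "\<exists>m. indep t m" unfolding t_def by (rule GreatestI_nat[where P = "\<lambda>t. \<exists>m. indep t m", OF ex0 bd])
  then obtain m where m: "indep t m" by blast
  have no: "\<not> indep (Suc t) m'" for m'
    using Greatest_le_nat[of "\<lambda>t. \<exists>m. indep t m" "Suc t", OF _ bd] unfolding t_def by fastforce
  have "\<exists>b. \<forall>k<r. u k = pcomb t b m k" if u: "N u" for u
  proof -
    define m' where "m' = m(t := u)"
    have pc: "pcomb (Suc t) c m' k = pcomb t c m k + smult (c t) (u k)" for c k
      by (simp add: pcomb_def m'_def)
    have "\<forall>i<Suc t. N (m' i)" using m u by (auto simp: m'_def indep_def less_Suc_eq)
    then obtain c where c: "\<forall>k<r. pcomb (Suc t) c m' k = 0" "\<exists>i<Suc t. c i \<noteq> 0"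
      using no[of m'] unfolding indep_def by blast
    have ct: "c t \<noteq> 0"
    proof
      assume "c t = 0"
      then have "\<forall>k<r. pcomb t c m k = 0" using c(1) by (simp add: pc)
      then have "\<forall>i<t. c i = 0" using m unfolding indep_def by blast
      then show False using c(2) \<open>c t = 0\<close> by (auto simp: less_Suc_eq)
    qed
    have "u k = pcomb t (\<lambda>i. - c i / c t) m k" if "k < r" for k
    proof -
      have "smult (c t) (u k) = - pcomb t c m k" using c(1) that by (simp add: pc eq_neg_iff_add_eq_0 add.commute)
      then have "smult (inverse (c t)) (smult (c t) (u k)) = smult (- inverse (c t)) (pcomb t c m k)" by simp
      then show ?thesis using ct
        by (simp add: pcomb_def smult_sum2 sum_negf[symmetric] divide_inverse mult.commute)
    qed
    then show ?thesis by blast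
  qed
  then show ?thesis using that m by blast
qed

text \<open>By \<open>star_wandering_mult\<close>, divisibility means that v, divided by the
  reversal of p, has a polynomial pairing with every m in M. When the roots of p lie in the disc,
  this says on the circle that the quotient is orthogonal to z^k m for all k > 0, as a wandering
  vector of the shift is.\<close>

definition wandering :: "(nat \<Rightarrow> real poly) \<Rightarrow> bool" where
  "wandering v \<longleftrightarrow> M v \<and> (\<forall>k<r. degree (v k) \<le> d) \<and> (\<forall>m. M m \<longrightarrow> p dvd pdot r d v m)"

lemma wandering_smult: "wandering v \<Longrightarrow> wandering (\<lambda>k. smult c (v k))"
proof -
  assume v: "wandering v"
  then have "M (\<lambda>k. [:c:] * v k)" unfolding wandering_def by (blast intro: M_mult)
  moreover have "pdot r d (\<lambda>k. smult c (v k)) m = smult c (pdot r d v m)" for m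
    by (simp add: pdot_def revp_smult smult_sum2)
  ultimately show ?thesis using v unfolding wandering_def
    by (auto intro: order_trans[OF degree_smult_le] dvd_smult)
qed

text \<open>The candidates are combinations of a basis of N, t vectors, and of p times the r unit
  vectors. The wandering property costs t linear conditions and orthogonality to the given vectors
  s, so s < r leaves a nonzero solution.\<close>

lemma ex_wandering:
  assumes "s < r"
  shows "\<exists>v. wandering v \<and> (\<exists>k<r. v k \<noteq> 0) \<and> (\<forall>j<s. pinner r d (u j) v = 0)"
proof -
  obtain t m where m: "indep t m" and sp: "\<And>u. N u \<Longrightarrow> \<exists>b. \<forall>k<r. u k = pcomb t b m k"
    by (rule N_basis) blast
  \<comment> \<open>The coefficient of z^(d-1) in the residue modulo p is a functional that makes
    multiplication of residues a nondegenerate pairing. Hence p divides all pairings with v once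
    \<open>\<phi> v\<close> vanishes on N, which is t conditions.\<close>
  define \<phi> where "\<phi> v w = coeff (pdot r d v w mod p) (d - 1)" for v w
  have \<phi>_left: "\<phi> (pcomb l c b) w = (\<Sum>i<l. \<phi> (b i) w * c i)" for l c b w
    by (simp add: \<phi>_def pdot_pcomb_left poly_mod_sum coeff_sum mod_smult_left mult.commute)
  have \<phi>_right: "\<phi> v (pcomb l c b) = (\<Sum>i<l. \<phi> v (b i) * c i)" for l c b v
    by (simp add: \<phi>_def pdot_pcomb_right poly_mod_sum coeff_sum mod_smult_left mult.commute)
  define b where "b l = (if l < t then m l else (\<lambda>k. p * (if k = l - t then 1 else 0)))" for l
  define f where "f i v = (if i < t then \<phi> v (m i) else pinner r d (u (i - t)) v)" for i v
  have f: "f i (pcomb l c b) = (\<Sum>j<l. f i (b j) * c j)" for i l c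
    by (simp add: f_def \<phi>_left pinner_pcomb)
  obtain c where c: "\<exists>j<t + r. c j \<noteq> 0" "\<forall>i<t + s. (\<Sum>j<t + r. f i (b j) * c j) = 0"
    using ex_kernel[of "t + s" "t + r" "\<lambda>i j. f i (b j)"] assms by auto
  define v where "v = pcomb (t + r) c b"
  have fv: "f i v = 0" if "i < t + s" for i using c(2) that by (simp add: v_def f)
  have mN: "N (m i)" if "i < t" for i using m that by (simp add: indep_def)
  have Mb: "M (b i)" for i using mN M_p by (auto simp: b_def N_def)
  have Mv: "M v" unfolding v_def by (intro M_pcomb Mb)
  have mc: "coeff (m i k) e = 0" if "i < t" "k < r" "d \<le> e" for i k e
    using mN[OF that(1)] coeff_mod_ge[OF p_nz that(3), of "m i k"] that by (simp add: N_def)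
  have bdeg: "degree (b i k) \<le> d" if "k < r" for i k
  proof (rule degree_le, intro allI impI)
    fix e assume "d < e"
    then show "coeff (b i k) e = 0" using mc[of i k e] that by (auto simp: b_def coeff_eq_0)
  qed
  have vdeg: "degree (v k) \<le> d" if "k < r" for k
    unfolding v_def pcomb_def using bdeg[OF that]
    by (intro degree_sum_le) (auto intro: order_trans[OF degree_smult_le])
  have split: "(\<Sum>i<t + l. g i) = (\<Sum>i<t. g i) + (\<Sum>j<l. g (t + j))" for g :: "nat \<Rightarrow> real poly" and l
    by (induction l) (simp_all add: add.assoc)
  have vk: "v k = pcomb t c m k + smult (c (t + k)) p" if k: "k < r" for k
  proof -
    have "v k = (\<Sum>i<t. smult (c i) (b i k)) + (\<Sum>j<r. smult (c (t + j)) (b (t + j) k))"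
      unfolding v_def pcomb_def by (rule split)
    also have "(\<Sum>j<r. smult (c (t + j)) (b (t + j) k)) = (\<Sum>j<r. if j = k then smult (c (t + j)) p else 0)"
      by (intro sum.cong) (auto simp: b_def)
    also have "\<dots> = smult (c (t + k)) p" using k by simp
    finally show ?thesis by (simp add: pcomb_def b_def)
  qed
  have vnz: "\<exists>k<r. v k \<noteq> 0"
  proof (rule ccontr)
    assume "\<not> ?thesis"
    then have v0: "v k = 0" if "k < r" for k using that by blast
    \<comment> \<open>Elements of N have degree below d and p is monic, so coefficient d of
      \<open>v k\<close> isolates \<open>c (t + k)\<close>.\<close>
    have ct: "c (t + k) = 0" if k: "k < r" for k
    proof -
      have "coeff (v k) d = c (t + k)"
        using mc[OF _ k, of _ d] monic by (simp add: vk[OF k] pcomb_def coeff_sum)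
      then show ?thesis using v0[OF k] by simp
    qed
    then have "\<forall>k<r. pcomb t c m k = 0" using v0 vk by simp
    then have "\<forall>i<t. c i = 0" using m unfolding indep_def by blast
    then have "c j = 0" if "j < t + r" for j
      using ct[of "j - t"] that by (cases "j < t") auto
    then show False using c(1) by blast
  qed
  have \<phi>N: "\<phi> v w = 0" if w: "N w" for w
  proof -
    obtain a where a: "\<forall>k<r. w k = pcomb t a m k" using sp[OF w] by blast
    then have "\<phi> v w = \<phi> v (pcomb t a m)" by (simp add: \<phi>_def pdot_def)
    also have "\<dots> = (\<Sum>i<t. f i v * a i)" unfolding \<phi>_right by (simp add: f_def)
    also have "\<dots> = 0" using fv by (intro sum.neutral) auto
    finally show ?thesis .
  qed
  have "p dvd pdot r d v w" if w: "M w" for w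
  proof (rule ccontr)
    assume "\<not> p dvd pdot r d v w"
    define g where "g = pdot r d v w mod p"
    have g0: "g \<noteq> 0" using \<open>\<not> p dvd pdot r d v w\<close> by (simp add: g_def mod_eq_0_iff_dvd)
    then have gd: "degree g < d" unfolding g_def using p_nz by (intro degree_mod_less') auto
    \<comment> \<open>The shift by q moves the leading coefficient of g to position d - 1, where
      \<phi> sees it, without any reduction modulo p.\<close>
    define q where "q = monom (1 :: real) (d - 1 - degree g)"
    define w' where "w' k = (q * w k) mod p" for k
    have "N w'" unfolding w'_def[abs_def] by (intro N_mod M_mult w)
    then have 0: "\<phi> v w' = 0" by (rule \<phi>N)
    have "pdot r d v w' mod p = (\<Sum>k<r. revp d (v k) * (q * w k)) mod p"
      unfolding pdot_def w'_def poly_mod_sum by (simp add: mod_mult_right_eq)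
    also have "\<dots> = (q * pdot r d v w) mod p"
      by (simp add: pdot_def sum_distrib_left mult.left_commute)
    also have "\<dots> = (q * g) mod p" by (simp add: g_def mod_mult_right_eq)
    also have "\<dots> = q * g"
    proof (rule mod_poly_less)
      have "degree (q * g) = d - 1" using g0 gd by (simp add: q_def degree_mult_eq degree_monom_eq monom_eq_0_iff)
      then show "degree (q * g) < degree p" using gd by simp
    qed
    finally have "\<phi> v w' = coeff g (degree g)"
      using gd by (simp add: \<phi>_def q_def coeff_monom_mult)
    then show False using 0 g0 by simp
  qed
  then have "wandering v" unfolding wandering_def using Mv vdeg by blast
  moreover have "pinner r d (u j) v = 0" if "j < s" for j
    using fv[of "t + j"] that by (simp add: f_def)
  ultimately show ?thesis using vnz by blast
qed

text \<open>\<open>ex_wandering\<close> already yields a vector orthogonal to the earlier ones; only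
  its length is adjusted. The square norm \<kappa> is left open because the later division by the
  reversal of p calls for that of p.\<close>

lemma ex_orthogonal_wandering:
  assumes "\<kappa> > 0" "s \<le> r"
  shows "\<exists>u. (\<forall>i<s. wandering (u i)) \<and> (\<forall>i<s. \<forall>j<s. pinner r d (u i) (u j) = (if i = j then \<kappa> else 0))"
  using assms(2)
proof (induction s)
  case (Suc s)
  then obtain u where u: "\<forall>i<s. wandering (u i)"
    "\<forall>i<s. \<forall>j<s. pinner r d (u i) (u j) = (if i = j then \<kappa> else 0)" by auto
  obtain v where v: "wandering v" "\<exists>k<r. v k \<noteq> 0" "\<forall>j<s. pinner r d (u j) v = 0"
    using ex_wandering[of s u] Suc.prems by auto
  have pos: "pinner r d v v > 0" using v pinner_pos unfolding wandering_def by blast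
  define w where "w = (\<lambda>k. smult (sqrt (\<kappa> / pinner r d v v)) (v k))"
  have uw: "pinner r d (u j) w = 0" if "j < s" for j
    using v(3) that by (simp add: w_def pinner_smult_right)
  then have wu: "pinner r d w (u j) = 0" if "j < s" for j
    using that by (simp add: pinner_commute[of r d w])
  have "pinner r d w v = sqrt (\<kappa> / pinner r d v v) * pinner r d v v"
    unfolding pinner_commute[of r d w v] unfolding w_def by (rule pinner_smult_right)
  then have "pinner r d w w = sqrt (\<kappa> / pinner r d v v) * (sqrt (\<kappa> / pinner r d v v) * pinner r d v v)"
    using pinner_smult_right[of r d w "sqrt (\<kappa> / pinner r d v v)" v] by (simp only: flip: w_def)
  also have "\<dots> = (sqrt (\<kappa> / pinner r d v v))\<^sup>2 * pinner r d v v"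
    by (simp only: power2_eq_square mult.assoc)
  also have "\<dots> = \<kappa>" using pos assms(1) by simp
  finally have ww: "pinner r d w w = \<kappa>" .
  have "wandering w" unfolding w_def by (intro wandering_smult v)
  then show ?case using u ww uw wu
    by (intro exI[of _ "u(s := w)"]) (auto simp: less_Suc_eq)
qed simp

end

section \<open>Inner-outer factorization\<close>

definition regular_mat :: "complex set \<Rightarrow> ratfun mat \<Rightarrow> bool" where
  "regular_mat T A \<longleftrightarrow> (\<forall>i<dim_row A. \<forall>j<dim_col A. \<forall>z\<in>T. regular z (A $$ (i, j)))"

lemma regular_matD:
  "regular_mat T A \<Longrightarrow> A \<in> carrier_mat n m \<Longrightarrow> i < n \<Longrightarrow> j < m \<Longrightarrow> z \<in> T \<Longrightarrow> regular z (A $$ (i, j))"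
  by (auto simp: regular_mat_def)

lemma regular_mat_mult:
  assumes "regular_mat T A" "regular_mat T B" "A \<in> carrier_mat n m" "B \<in> carrier_mat m k"
  shows "regular_mat T (A * B)"
  unfolding regular_mat_def
proof (intro allI impI ballI)
  fix i j z assume "i < dim_row (A * B)" "j < dim_col (A * B)" "z \<in> T"
  then have ij: "i < n" "j < k" and z: "z \<in> T" using assms by auto
  show "regular z ((A * B) $$ (i, j))"
    unfolding mat_mult_index[OF assms(3,4) ij]
    by (intro regular_sum regular_mult regular_matD[OF assms(1,3)] regular_matD[OF assms(2,4)] ij z) auto
qed

lemma dvd_prod_denom:
  assumes "finite I" "i \<in> I"
  shows "denom (f i) dvd (\<Prod>i\<in>I. denom (f i))"
  using assms by (rule dvd_prodI)

text \<open>q is the part with roots in T of the product of all denominators. Where all the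
  functions are regular this product does not vanish, and hence neither does q.\<close>

lemma clear_poles:
  fixes f :: "'a \<Rightarrow> ratfun"
  assumes "finite I" "\<And>z. z \<in> T \<Longrightarrow> cnj z \<in> T"
  obtains q where "lead_coeff q = 1" "\<And>z. ceval q z = 0 \<Longrightarrow> z \<in> T"
    "\<And>i z. i \<in> I \<Longrightarrow> z \<in> T \<Longrightarrow> regular z (to_fract q * f i)"
    "\<And>z. (\<And>i. i \<in> I \<Longrightarrow> regular z (f i)) \<Longrightarrow> ceval q z \<noteq> 0"
proof -
  define b where "b = (\<Prod>i\<in>I. denom (f i))"
  have "b \<noteq> 0" using assms(1) by (simp add: b_def)
  then obtain q c where qc: "b = q * c" "lead_coeff q = 1" "\<And>z. ceval q z = 0 \<Longrightarrow> z \<in> T"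
    "\<And>z. ceval c z = 0 \<Longrightarrow> z \<notin> T"
    using split_roots[of b "\<lambda>z. z \<in> T"] assms(2) by blast
  have "regular z (to_fract q * f i)" if i: "i \<in> I" and z: "z \<in> T" for i z
  proof -
    obtain e where e: "b = denom (f i) * e"
      using dvd_prod_denom[OF assms(1) i, of f] unfolding b_def[symmetric] by (metis dvdE)
    have c0: "c \<noteq> 0" using qc(1) \<open>b \<noteq> 0\<close> by auto
    have "to_fract q * to_fract c = to_fract (denom (f i)) * to_fract e"
      using qc(1) e by (simp flip: to_fract_mult)
    then have tq: "to_fract q = to_fract (denom (f i)) * to_fract e / to_fract c"
      using c0 by (simp add: eq_divide_eq)
    define N D where "N = numer (f i)" and "D = denom (f i)"
    have fi: "f i = to_fract N / to_fract D" unfolding N_def D_def by (rule numer_denom)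
    have "D \<noteq> 0" by (simp add: D_def)
    then have "to_fract q * f i = to_fract (N * e) / to_fract c"
      unfolding tq D_def[symmetric] using c0 by (simp add: fi field_simps)
    moreover have "ceval c z \<noteq> 0" using qc(4) z by blast
    ultimately show ?thesis by (rule regularI)
  qed
  moreover have "ceval q z \<noteq> 0" if r: "\<And>i. i \<in> I \<Longrightarrow> regular z (f i)" for z
  proof -
    have "ceval b z = (\<Prod>i\<in>I. ceval (denom (f i)) z)"
      unfolding b_def by (simp add: hom_distribs poly_prod)
    also have "\<dots> \<noteq> 0" using r assms(1) by (simp add: regular_iff_denom)
    finally show ?thesis using qc(1) by (auto simp: cpoly.hom_mult)
  qed
  ultimately show ?thesis using that[of q] qc by blast
qed

text \<open>For q with all roots in the disc this quotient is the finite Blaschke product with these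
  zeros.\<close>

lemma star_unimodular_quotient:
  assumes "q \<noteq> 0"
  shows "star (to_fract q / to_fract (revp (degree q) q)) * (to_fract q / to_fract (revp (degree q) q)) = 1"
proof -
  let ?r = "to_fract (revp (degree q) q)"
  have r: "?r = rat_z ^ degree q * star (to_fract q)" by (simp add: to_fract_revp)
  then have r0: "?r \<noteq> 0" using assms by simp
  have "star ?r = to_fract q / rat_z ^ degree q" by (simp add: star_revp)
  then show ?thesis using r r0 assms by (simp add: field_simps)
qed

text \<open>Roots of the reversal are inverses of roots of q, hence outside the closed disc; at 0
  its value is the leading coefficient.\<close>

lemma poly_revp_ne_0:
  assumes "lead_coeff q = 1" "\<And>w. ceval q w = 0 \<Longrightarrow> cmod w < 1" "cmod z \<le> 1"
  shows "ceval (revp (degree q) q) z \<noteq> 0"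
proof (cases "z = 0")
  case True
  then show ?thesis using assms(1) by (simp add: poly_0_coeff_0)
next
  case False
  have "revp (degree q) q = reflect_poly q"
    by (intro poly_eqI) (auto simp: coeff_reflect_poly)
  moreover have "ceval q (inverse z) \<noteq> 0"
  proof
    assume "ceval q (inverse z) = 0"
    then have "cmod (inverse z) < 1" by (rule assms(2))
    then show False using assms(3) False by (simp add: norm_inverse inverse_less_1_iff)
  qed
  ultimately show ?thesis using False by (simp add: cpoly_reflect poly_reflect_poly_nz)
qed

lemma coprime_if_no_common_root:
  fixes a b :: "real poly"
  assumes "a \<noteq> 0" "\<And>z. ceval a z = 0 \<Longrightarrow> ceval b z \<noteq> 0"
  shows "coprime a b"
proof -
  have "degree (gcd a b) = 0"
  proof (rule ccontr)
    assume "degree (gcd a b) \<noteq> 0"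
    then have "degree (cpoly (gcd a b)) \<noteq> 0" by simp
    then obtain z where z: "ceval (gcd a b) z = 0"
      using fundamental_theorem_of_algebra constant_degree by metis
    have "ceval c z = 0" if "gcd a b dvd c" for c
      using that z by (auto elim!: dvdE simp: cpoly.hom_mult)
    then show False using assms(2) by (meson gcd_dvd1 gcd_dvd2)
  qed
  then have "is_unit (gcd a b)" using assms(1) by (simp add: is_unit_iff_degree)
  then show ?thesis using is_unit_gcd by blast
qed

context poly_submodule
begin

abbreviation "p' \<equiv> revp d p"

lemma p'_nz: "p' \<noteq> 0"
proof -
  have "coeff p' 0 = 1" using monic by simp
  then show ?thesis by (metis coeff_0 zero_neq_one)
qed

lemma star_p': "star (to_fract p') = to_fract p / rat_z ^ d"
  by (simp add: star_revp)

lemma pdot_fract: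
  assumes "\<forall>k<r. degree (u k) \<le> d"
  shows "to_fract (pdot r d u v) = rat_z ^ d * (\<Sum>k<r. star (to_fract (u k)) * to_fract (v k))"
  using assms by (simp add: pdot_def to_fract_sum to_fract_revp sum_distrib_left mult.assoc)

text \<open>\<open>star\<close> turns the denominator \<open>p'\<close> back into p, up to the power
  of z that \<open>pdot\<close> carries. So the pairing is polynomial exactly if p divides
  \<open>pdot\<close>.\<close>

lemma star_wandering_mult:
  assumes "\<forall>k<r. degree (u k) \<le> d"
  shows "(\<Sum>k<r. star (to_fract (u k) / to_fract p') * to_fract (v k)) = to_fract (pdot r d u v) / to_fract p"
proof -
  have "star (to_fract (u k) / to_fract p') * to_fract (v k)
      = rat_z ^ d * (star (to_fract (u k)) * to_fract (v k)) / to_fract p" for k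
    using p_nz by (simp add: star_p' field_simps)
  then show ?thesis
    unfolding pdot_fract[OF assms] by (simp only: sum_distrib_left sum_divide_distrib)
qed

text \<open>The quotient by \<open>p\<^sup>* p\<close> has no poles: \<open>p\<close> divides the numerator because \<open>u\<close> is wandering, and its
  reversal does because \<open>v\<close> is.\<close>

lemma wandering_gram:
  assumes u: "wandering u" and v: "wandering v"
    and roots: "\<And>w. ceval p w = 0 \<Longrightarrow> cmod w < 1"
  shows "(\<Sum>k<r. star (to_fract (u k) / to_fract p') * (to_fract (v k) / to_fract p'))
    = rat_const (pinner r d u v / pinner 1 d (\<lambda>_. p) (\<lambda>_. p))"
proof -
  have du: "\<forall>k<r. degree (u k) \<le> d" and dv: "\<forall>k<r. degree (v k) \<le> d"
    using u v by (simp_all add: wandering_def)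
  define h where "h = pdot r d u v"
  define h' where "h' = pdot r d v u"
  obtain s where s: "h = p * s" using u v unfolding h_def wandering_def by (metis dvdE)
  obtain s' where s': "h' = p * s'" using u v unfolding h'_def wandering_def by (metis dvdE)
  have dh: "degree h \<le> 2 * d"
    unfolding h_def pdot_def
  proof (rule degree_sum_le)
    fix k assume "k \<in> {..<r}"
    then show "degree (revp d (u k) * v k) \<le> 2 * d"
      using dv degree_revp[of d "u k"] degree_mult_le[of "revp d (u k)" "v k"] by fastforce
  qed simp
  have ds: "degree s \<le> d"
  proof (cases "s = 0")
    case False
    then have "degree h = d + degree s" using s p_nz by (simp add: degree_mult_eq)
    then show ?thesis using dh by simp
  qed simp
  have Z: "rat_z ^ d \<noteq> 0" by simp
  have fh: "to_fract h = rat_z ^ d * (\<Sum>k<r. star (to_fract (u k)) * to_fract (v k))"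
    unfolding h_def by (rule pdot_fract[OF du])
  have fh': "to_fract h' = rat_z ^ d * (\<Sum>k<r. star (to_fract (v k)) * to_fract (u k))"
    unfolding h'_def by (rule pdot_fract[OF dv])
  \<comment> \<open>Exchanging u and v reverses h with respect to length 2 d.\<close>
  have "star (to_fract h) * rat_z ^ d * rat_z ^ d = to_fract h'"
    unfolding fh fh' by (simp add: star_rat_z power_divide mult.commute)
  then have "to_fract (p' * revp d s) = to_fract (p * s')"
    unfolding s s' by (simp add: to_fract_revp[OF ds] to_fract_revp[OF order_refl] algebra_simps)
  then have eq: "p' * revp d s = p * s'" by (simp only: to_fract_eq_iff)
  \<comment> \<open>The roots of p lie in the disc and those of \<open>p'\<close> outside, so p
    divides the reversal of s; by degrees s is a constant multiple of \<open>p'\<close>.\<close>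
  have "coprime p p'"
  proof (rule coprime_if_no_common_root[OF p_nz])
    fix z assume "ceval p z = 0"
    then show "ceval p' z \<noteq> 0"
      using poly_revp_ne_0[OF monic roots, of z] roots[of z] by simp
  qed
  then have "p dvd revp d s"
    using eq by (metis coprime_dvd_mult_right_iff dvd_triv_left)
  then obtain e where e: "revp d s = p * e" by (metis dvdE)
  have "degree e = 0"
  proof (cases "e = 0")
    case False
    then have "degree (revp d s) = d + degree e" using e p_nz by (simp add: degree_mult_eq)
    then show ?thesis using degree_revp[of d s] by simp
  qed simp
  then obtain c where c: "e = [:c:]" by (metis degree_eq_zeroE)
  have "s = revp d (smult c p)" using revp_revp[OF ds] e c by simp
  then have h: "h = smult c (p' * p)" using s by (simp add: revp_smult mult.commute)
  define K where "K = pinner 1 d (\<lambda>_. p) (\<lambda>_. p)"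
  have Kp: "K > 0" unfolding K_def by (rule pinner_pos[of 0]) (use p_nz in auto)
  \<comment> \<open>Coefficient d determines the constant: in h it is the inner product of u and v,
    in \<open>p' * p\<close> the square norm of p.\<close>
  have "coeff h d = c * coeff (p' * p) d" using h by simp
  moreover have "coeff (p' * p) d = K" by (simp add: coeff_revp_mult K_def pinner_def)
  ultimately have cK: "c = pinner r d u v / K" using Kp coeff_pdot[of r d u v] by (simp add: h_def)
  have "to_fract h = rat_const c * (to_fract p' * to_fract p)"
    unfolding h rat_const_def by (simp flip: to_fract_mult)
  moreover have "(\<Sum>k<r. star (to_fract (u k) / to_fract p') * (to_fract (v k) / to_fract p'))
      = to_fract h / to_fract p / to_fract p'"
    unfolding h_def star_wandering_mult[OF du, symmetric] by (simp add: sum_divide_distrib)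
  ultimately show ?thesis using p_nz p'_nz by (simp add: cK K_def)
qed

end

abbreviation "disc \<equiv> ball (0::complex) 1"

text \<open>M consists of the polynomial vectors L c with c regular in the disc. That the vectors u
  i lie in M provides the right inverse of U * L; that they are wandering provides the regularity of
  U * L.\<close>

lemma inner_outer_regular:
  assumes L: "L \<in> carrier_mat r n" and R: "R \<in> carrier_mat n r"
    and LR: "L * R = 1\<^sub>m r" and reg: "regular_mat disc L"
  shows "\<exists>U C. para_unitary r U \<and> C \<in> carrier_mat n r \<and> (U * L) * C = 1\<^sub>m r
     \<and> regular_mat disc (U * L) \<and> regular_mat disc C"
proof -
  define I where "I = {..<n} \<times> {..<r}"
  \<comment> \<open>p clears the poles of R in the disc, so p w = L (p R w) lies in M for every
    polynomial vector w.\<close>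
  obtain p where p: "lead_coeff p = 1" "\<And>z. ceval p z = 0 \<Longrightarrow> z \<in> disc"
    "\<And>i z. i \<in> I \<Longrightarrow> z \<in> disc \<Longrightarrow> regular z (to_fract p * R $$ i)"
    by (rule clear_poles[of I disc "\<lambda>i. R $$ i"]) (auto simp: I_def)
  define M where "M u \<longleftrightarrow> (\<exists>c. (\<forall>j<n. \<forall>z\<in>disc. regular z (c j)) \<and> (\<forall>k<r. to_fract (u k) = (\<Sum>j<n. L $$ (k, j) * c j)))"
    for u :: "nat \<Rightarrow> real poly"
  interpret poly_submodule r p M
  proof
    fix u v assume "M u" "M v"
    then obtain c e where
      "\<forall>j<n. \<forall>z\<in>disc. regular z (c j)" "\<forall>k<r. to_fract (u k) = (\<Sum>j<n. L $$ (k, j) * c j)"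
      "\<forall>j<n. \<forall>z\<in>disc. regular z (e j)" "\<forall>k<r. to_fract (v k) = (\<Sum>j<n. L $$ (k, j) * e j)"
      unfolding M_def by blast
    then show "M (\<lambda>k. u k + v k)" unfolding M_def
      by (intro exI[of _ "\<lambda>j. c j + e j"]) (auto simp: regular_add distrib_left sum.distrib)
  next
    fix u a assume "M u"
    then obtain c where "\<forall>j<n. \<forall>z\<in>disc. regular z (c j)" "\<forall>k<r. to_fract (u k) = (\<Sum>j<n. L $$ (k, j) * c j)"
      unfolding M_def by blast
    then show "M (\<lambda>k. a * u k)" unfolding M_def
      by (intro exI[of _ "\<lambda>j. to_fract a * c j"]) (auto simp: regular_mult sum_distrib_left mult.left_commute)
  next
    fix w :: "nat \<Rightarrow> real poly"
    define c where "c j = (\<Sum>l<r. (to_fract p * R $$ (j, l)) * to_fract (w l))" for j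
    have "regular z (c j)" if "j < n" "z \<in> disc" for j z
      unfolding c_def using that by (intro regular_sum regular_mult p(3)) (auto simp: I_def)
    moreover have "to_fract (p * w k) = (\<Sum>j<n. L $$ (k, j) * c j)" if k: "k < r" for k
    proof -
      have "(\<Sum>j<n. L $$ (k, j) * c j) = (\<Sum>j<n. \<Sum>l<r. L $$ (k, j) * R $$ (j, l) * (to_fract p * to_fract (w l)))"
        by (simp add: c_def sum_distrib_left algebra_simps)
      also have "\<dots> = (\<Sum>l<r. \<Sum>j<n. L $$ (k, j) * R $$ (j, l) * (to_fract p * to_fract (w l)))"
        by (rule sum.swap)
      also have "\<dots> = (\<Sum>l<r. (L * R) $$ (k, l) * (to_fract p * to_fract (w l)))"
        using k by (simp add: mat_mult_index[OF L R] sum_distrib_right del: index_mult_mat)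
      also have "\<dots> = to_fract p * to_fract (w k)"
        using k by (simp add: LR if_distrib[of "\<lambda>x. x * _"] sum.delta cong: if_cong)
      finally show ?thesis by simp
    qed
    ultimately show "M (\<lambda>k. p * w k)" unfolding M_def by blast
  qed (rule p(1))
  have roots: "cmod w < 1" if "ceval p w = 0" for w using p(2)[OF that] by simp
  define K where "K = pinner 1 d (\<lambda>_. p) (\<lambda>_. p)"
  have Kp: "K > 0" unfolding K_def by (rule pinner_pos[of 0]) (use p_nz in auto)
  obtain u where u: "\<forall>i<r. wandering (u i)"
    "\<forall>i<r. \<forall>j<r. pinner r d (u i) (u j) = (if i = j then K else 0)"
    using ex_orthogonal_wandering[OF Kp order_refl] by blast
  have du: "\<forall>k<r. degree (u i k) \<le> d" if "i < r" for i using u(1) that by (auto simp: wandering_def)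
  \<comment> \<open>The columns of X are orthonormal by \<open>wandering_gram\<close> and the choice
    of K as the square norm of p.\<close>
  define X where "X = mat r r (\<lambda>(k, i). to_fract (u i k) / to_fract p')"
  have X: "X \<in> carrier_mat r r" by (simp add: X_def)
  define U where "U = para_conj X"
  have U: "U \<in> carrier_mat r r" using X by (simp add: U_def)
  have UX: "U * X = 1\<^sub>m r"
  proof (rule eq_matI)
    fix i j assume "i < dim_row (1\<^sub>m r)" "j < dim_col (1\<^sub>m r)"
    then have ij: "i < r" "j < r" by auto
    have "(U * X) $$ (i, j) = (\<Sum>k<r. star (to_fract (u i k) / to_fract p') * (to_fract (u j k) / to_fract p'))"
      unfolding mat_mult_index[OF U X ij] using ij X by (simp add: U_def) (simp add: X_def)
    also have "\<dots> = rat_const (pinner r d (u i) (u j) / K)"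
      unfolding K_def using u(1) ij roots by (intro wandering_gram) auto
    finally show "(U * X) $$ (i, j) = 1\<^sub>m r $$ (i, j)" using u(2) ij Kp by simp
  qed (use U X in auto)
  then have XU: "X * U = 1\<^sub>m r" by (rule right_inverse_square[OF U X])
  have "para_unitary r U" unfolding para_unitary_def using U UX XU by (simp add: U_def)
  moreover
  have "\<forall>i<r. \<exists>c. (\<forall>j<n. \<forall>z\<in>disc. regular z (c j)) \<and> (\<forall>k<r. to_fract (u i k) = (\<Sum>j<n. L $$ (k, j) * c j))"
    using u(1) unfolding wandering_def M_def by blast
  then obtain c where c: "\<And>i j z. i < r \<Longrightarrow> j < n \<Longrightarrow> z \<in> disc \<Longrightarrow> regular z (c i j)"
    "\<And>i k. i < r \<Longrightarrow> k < r \<Longrightarrow> to_fract (u i k) = (\<Sum>j<n. L $$ (k, j) * c i j)"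
    by metis
  \<comment> \<open>Preimages of the columns of X under L; the denominator \<open>p'\<close> has no
    zero in the disc.\<close>
  define C where "C = mat n r (\<lambda>(j, i). c i j / to_fract p')"
  have C: "C \<in> carrier_mat n r" by (simp add: C_def)
  have p'z: "ceval p' z \<noteq> 0" if "z \<in> disc" for z
    by (rule poly_revp_ne_0[OF monic roots]) (use that in auto)
  have "regular_mat disc C"
    unfolding regular_mat_def
  proof (intro allI impI ballI)
    fix j i z assume "j < dim_row C" "i < dim_col C" and z: "z \<in> disc"
    then have ji: "j < n" "i < r" using C by auto
    have "regular z (1 / to_fract p')" by (rule regularI[of _ 1 p']) (use p'z[OF z] in auto)
    then have "regular z (c i j * (1 / to_fract p'))" using c(1)[OF ji(2,1) z] by (rule regular_mult[rotated])
    then show "regular z (C $$ (j, i))" using ji by (simp add: C_def)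
  qed
  moreover have LC: "L * C = X"
  proof (rule eq_matI)
    fix k i assume "k < dim_row X" "i < dim_col X"
    then have ki: "k < r" "i < r" using X by auto
    show "(L * C) $$ (k, i) = X $$ (k, i)"
      unfolding mat_mult_index[OF L C ki] using ki by (simp add: C_def X_def c(2) sum_divide_distrib)
  qed (use L C X in auto)
  have "(U * L) * C = 1\<^sub>m r" using U L C by (simp add: assoc_mult_mat[OF U L C] LC UX)
  moreover have "regular_mat disc (U * L)"
    unfolding regular_mat_def
  proof (intro allI impI ballI)
    fix i j z assume "i < dim_row (U * L)" "j < dim_col (U * L)" and z: "z \<in> disc"
    then have ij: "i < r" "j < n" using U L by auto
    \<comment> \<open>b clears all finite poles of column j of L and so turns it into a polynomial
      vector a in M; b does not vanish at z because L is regular there.\<close>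
    obtain b where b: "lead_coeff b = 1" "\<And>i z. i \<in> {..<r} \<Longrightarrow> z \<in> UNIV \<Longrightarrow> regular z (to_fract b * L $$ (i, j))"
      "\<And>z. (\<And>i. i \<in> {..<r} \<Longrightarrow> regular z (L $$ (i, j))) \<Longrightarrow> ceval b z \<noteq> 0"
      by (rule clear_poles[of "{..<r}" UNIV "\<lambda>i. L $$ (i, j)"]) auto
    have bz: "ceval b z \<noteq> 0"
      by (rule b(3)) (use regular_matD[OF reg L _ ij(2) z] in auto)
    have "\<exists>a. to_fract a = to_fract b * L $$ (k, j)" if k: "k < r" for k
    proof -
      let ?g = "to_fract b * L $$ (k, j)"
      have "degree (cpoly (denom ?g)) = 0"
      proof (rule ccontr)
        assume "degree (cpoly (denom ?g)) \<noteq> 0"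
        then obtain z where "ceval (denom ?g) z = 0"
          using fundamental_theorem_of_algebra constant_degree by metis
        then show False using b(2)[of k z] k by (simp add: regular_iff_denom)
      qed
      then have "degree (denom ?g) = 0" by simp
      then obtain e where e: "denom ?g = [:e:]" by (rule degree_eq_zeroE)
      have "e \<noteq> 0" using denom_nonzero[of ?g] e by auto
      have "?g = to_fract (numer ?g) / to_fract [:e:]" using numer_denom[of ?g] by (simp only: e)
      also have "\<dots> = to_fract (smult (inverse e) (numer ?g))"
      proof -
        have "to_fract (smult (inverse e) (numer ?g)) * to_fract [:e:] = to_fract (numer ?g)"
          using \<open>e \<noteq> 0\<close> by (simp flip: to_fract_mult)
        then show ?thesis using \<open>e \<noteq> 0\<close> by (simp add: field_simps)
      qed
      finally show ?thesis by metis
    qed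
    then obtain a where a: "\<And>k. k < r \<Longrightarrow> to_fract (a k) = to_fract b * L $$ (k, j)" by metis
    have "M a" unfolding M_def
      by (intro exI[of _ "\<lambda>l. if l = j then to_fract b else 0"])
        (auto simp: a ij if_distrib[of "\<lambda>x. _ * x"] sum.delta mult.commute cong: if_cong)
    then obtain s where s: "pdot r d (u i) a = p * s"
      using u(1) ij(1) unfolding wandering_def by (metis dvdE)
    have b0: "to_fract b \<noteq> 0" using b(1) by auto
    \<comment> \<open>The pairing of a with the wandering vector u i is a polynomial s, so the entry
      of U * L is s / b.\<close>
    have "to_fract b * (U * L) $$ (i, j) = (\<Sum>k<r. star (to_fract (u i k) / to_fract p') * to_fract (a k))"
      unfolding mat_mult_index[OF U L ij] using ij X
      by (simp add: U_def a sum_distrib_left mult.left_commute del: star_divide) (simp add: X_def mult.left_commute)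
    also have "\<dots> = to_fract s"
      unfolding star_wandering_mult[OF du[OF ij(1)]] s using p_nz by simp
    finally have "(U * L) $$ (i, j) = to_fract s / to_fract b" using b0 by (simp add: field_simps)
    then show "regular z ((U * L) $$ (i, j))" using bz by (rule regularI)
  qed
  ultimately show ?thesis using C by blast
qed

lemma inner_outer:
  assumes L: "L \<in> carrier_mat r n" and R: "R \<in> carrier_mat n r" and LR: "L * R = 1\<^sub>m r"
  shows "\<exists>U C. para_unitary r U \<and> C \<in> carrier_mat n r \<and> (U * L) * C = 1\<^sub>m r
     \<and> regular_mat disc (U * L) \<and> regular_mat disc C"
proof -
  define I where "I = {..<r} \<times> {..<n}"
  obtain q where q: "lead_coeff q = 1" "\<And>z. ceval q z = 0 \<Longrightarrow> z \<in> disc"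
    "\<And>i z. i \<in> I \<Longrightarrow> z \<in> disc \<Longrightarrow> regular z (to_fract q * L $$ i)"
    by (rule clear_poles[of I disc "\<lambda>i. L $$ i"]) (auto simp: I_def)
  \<comment> \<open>q cancels the poles of L in the disc, and its reversal has no zeros there. The
    scalar matrix B is para-unitary and is absorbed into U at the end.\<close>
  define b where "b = to_fract q / to_fract (revp (degree q) q)"
  have q0: "q \<noteq> 0" using q(1) by auto
  have bb: "star b * b = 1" unfolding b_def by (rule star_unimodular_quotient[OF q0])
  then have b0: "b \<noteq> 0" by auto
  define B where "B = b \<cdot>\<^sub>m 1\<^sub>m r"
  have B: "B \<in> carrier_mat r r" by (simp add: B_def)
  have pB: "para_conj B = star b \<cdot>\<^sub>m 1\<^sub>m r"
    by (intro eq_matI) (auto simp: B_def para_conj_def simp flip: star_def)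
  have BL: "B * L = b \<cdot>\<^sub>m L" using L by (simp add: B_def mult_smult_assoc_mat[of _ r r])
  define R' where "R' = inverse b \<cdot>\<^sub>m R"
  have R': "R' \<in> carrier_mat n r" using R by (simp add: R'_def)
  have BL': "B * L \<in> carrier_mat r n" using B L by simp
  have "inverse b \<cdot>\<^sub>m (b \<cdot>\<^sub>m 1\<^sub>m r) = 1\<^sub>m r" using b0 by (intro eq_matI) auto
  then have "(B * L) * R' = 1\<^sub>m r"
    unfolding BL R'_def using L R b0
    by (simp add: mult_smult_assoc_mat[of _ r n _ r] mult_smult_distrib[of _ r n _ r] LR)
  moreover have "regular_mat disc (B * L)"
    unfolding regular_mat_def
  proof (intro allI impI ballI)
    fix i j z assume "i < dim_row (B * L)" "j < dim_col (B * L)" and z: "z \<in> disc"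
    then have ij: "i < r" "j < n" using B L by auto
    have "regular z (1 / to_fract (revp (degree q) q))"
      by (rule regularI[of _ 1 "revp (degree q) q"], simp, rule poly_revp_ne_0[OF q(1)]) (use q(2) z in auto)
    moreover have "regular z (to_fract q * L $$ (i, j))" using q(3)[of "(i, j)"] ij z by (simp add: I_def)
    ultimately have "regular z (1 / to_fract (revp (degree q) q) * (to_fract q * L $$ (i, j)))"
      by (rule regular_mult)
    then show "regular z ((B * L) $$ (i, j))" using ij L unfolding BL by (simp add: b_def mult.commute)
  qed
  ultimately obtain U C where UC: "para_unitary r U" "C \<in> carrier_mat n r" "(U * (B * L)) * C = 1\<^sub>m r"
    "regular_mat disc (U * (B * L))" "regular_mat disc C"
    using inner_outer_regular[OF BL' R'] by blast
  have U: "U \<in> carrier_mat r r" "para_conj U * U = 1\<^sub>m r" "U * para_conj U = 1\<^sub>m r"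
    using UC(1) by (auto simp: para_unitary_def)
  have UB: "U * B \<in> carrier_mat r r" using U B by simp
  have "b \<cdot>\<^sub>m (star b \<cdot>\<^sub>m 1\<^sub>m r) = 1\<^sub>m r"
    using bb by (intro eq_matI) (auto simp: mult.commute)
  then have BB: "para_conj B * B = 1\<^sub>m r"
    unfolding pB by (simp add: B_def mult_smult_assoc_mat[of _ r r _ r] mult_smult_distrib[of _ r r _ r] bb)
  have pBc: "para_conj B \<in> carrier_mat r r" and pUc: "para_conj U \<in> carrier_mat r r" using B U by auto
  have "para_conj (U * B) * (U * B) = para_conj B * (para_conj U * U) * B"
    unfolding para_conj_mult[OF U(1) B] by (rule mat_mult_regroup[OF pBc pUc U(1) B])
  also have "\<dots> = 1\<^sub>m r" unfolding U(2) right_mult_one_mat[OF pBc] by (rule BB)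
  finally have 1: "para_conj (U * B) * (U * B) = 1\<^sub>m r" .
  then have "(U * B) * para_conj (U * B) = 1\<^sub>m r"
    by (rule right_inverse_square[OF para_conj_carrier[OF UB] UB])
  then have "para_unitary r (U * B)" using 1 UB by (simp add: para_unitary_def)
  moreover have "U * (B * L) = (U * B) * L" using U(1) B L by simp
  ultimately show ?thesis using UC by metis
qed

section \<open>Existence and uniqueness of outer factors\<close>

lemma rm_analytic_alt:
  "rm_analytic A T \<longleftrightarrow> (\<forall>i<dim_row A. \<forall>j<dim_col A. \<forall>p\<in>T. pole_mult (A $$ (i, j)) p = 0)"
  by (auto simp: rm_analytic_def is_pole_of_def)

lemma rm_analyticD:
  "rm_analytic A T \<Longrightarrow> A \<in> carrier_mat n m \<Longrightarrow> i < n \<Longrightarrow> j < m \<Longrightarrow> p \<in> T \<Longrightarrow> pole_mult (A $$ (i, j)) p = 0"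
  by (auto simp: rm_analytic_alt)

lemma rm_analytic_mult:
  assumes "rm_analytic A T" "rm_analytic B T" "A \<in> carrier_mat n m" "B \<in> carrier_mat m k"
  shows "rm_analytic (A * B) T"
  unfolding rm_analytic_alt
proof (intro allI impI ballI)
  fix i j p assume "i < dim_row (A * B)" "j < dim_col (A * B)" and p: "p \<in> T"
  then have ij: "i < n" "j < k" using assms by auto
  have "pole_mult (A $$ (i, l) * B $$ (l, j)) p \<le> 0" if "l < m" for l
    using pole_mult_mult[of "A $$ (i, l)" "B $$ (l, j)" p]
      rm_analyticD[OF assms(1,3) ij(1) that p] rm_analyticD[OF assms(2,4) that ij(2) p] by simp
  then show "pole_mult ((A * B) $$ (i, j)) p = 0"
    unfolding mat_mult_index[OF assms(3,4) ij]
    using pole_mult_sum[of "{..<m}" "\<lambda>l. A $$ (i, l) * B $$ (l, j)" p 0] by simp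
qed

lemma rm_analytic_para_conj: "rm_analytic (para_conj A) T \<longleftrightarrow> rm_analytic A (xinv ` T)"
proof -
  have "para_conj A $$ (i, j) = star (A $$ (j, i))" if "i < dim_col A" "j < dim_row A" for i j
    using that by (simp add: para_conj_def star_def)
  then show ?thesis
    unfolding rm_analytic_alt by (auto simp: pole_mult_star)
qed

lemma rm_analytic_Un: "rm_analytic A (S \<union> T) \<longleftrightarrow> rm_analytic A S \<and> rm_analytic A T"
  by (auto simp: rm_analytic_def)

lemma rm_analytic_Fin: "rm_analytic A (Fin ` T) \<longleftrightarrow> regular_mat T A"
  by (auto simp: rm_analytic_alt regular_mat_def regular_def)

text \<open>Without the transposition in \<open>para_conj\<close> products keep their order. The
  exterior with infinity is carried to the disc, where \<open>regular_mat\<close> applies.\<close>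

definition smap :: "ratfun mat \<Rightarrow> ratfun mat" where
  "smap A = map_mat star A"

lemma smap_simps [simp]:
  "dim_row (smap A) = dim_row A" "dim_col (smap A) = dim_col A"
  "smap A \<in> carrier_mat n m \<longleftrightarrow> A \<in> carrier_mat n m"
  unfolding smap_def by simp_all

lemma smap_smap [simp]: "smap (smap A) = A"
  by (rule eq_matI) (simp_all add: smap_def)

lemma smap_one [simp]: "smap (1\<^sub>m n) = 1\<^sub>m n"
  by (rule eq_matI) (simp_all add: smap_def)

lemma smap_index [simp]: "i < dim_row A \<Longrightarrow> j < dim_col A \<Longrightarrow> smap A $$ (i, j) = star (A $$ (i, j))"
  by (simp add: smap_def)

lemma smap_mult:
  assumes "A \<in> carrier_mat n m" "B \<in> carrier_mat m k"
  shows "smap (A * B) = smap A * smap B"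
  unfolding smap_def by (rule star.mat_hom_mult[OF assms])

lemma para_conj_smap: "para_conj (smap A) = smap (para_conj A)"
  by (intro eq_matI) (auto simp: para_conj_def smap_def simp flip: star_def)

lemma rm_analytic_smap: "rm_analytic (smap A) T \<longleftrightarrow> rm_analytic A (xinv ` T)"
  unfolding rm_analytic_alt by (auto simp: pole_mult_star)

lemma xinv_image_disc: "xinv ` Fin ` disc = outside_disc"
proof -
  have "p \<in> xinv ` Fin ` disc" if "p \<in> outside_disc" for p
    by (rule image_eqI[of _ _ "xinv p"], simp, cases p)
      (use that in \<open>auto simp: outside_disc_def norm_inverse inverse_less_1_iff\<close>)
  moreover have "xinv (Fin z) \<in> outside_disc" if "z \<in> disc" for z
    using that by (auto simp: outside_disc_def norm_inverse one_less_inverse_iff)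
  ultimately show ?thesis by auto
qed

lemma xinv_image_cball: "xinv ` Fin ` cball 0 1 = closed_outside_disc"
proof -
  have "p \<in> xinv ` Fin ` cball 0 1" if "p \<in> closed_outside_disc" for p
    by (rule image_eqI[of _ _ "xinv p"], simp, cases p)
      (use that in \<open>auto simp: closed_outside_disc_def norm_inverse inverse_le_1_iff\<close>)
  moreover have "xinv (Fin z) \<in> closed_outside_disc" if "z \<in> cball 0 1" for z
    using that by (auto simp: closed_outside_disc_def norm_inverse one_le_inverse_iff)
  ultimately show ?thesis by auto
qed

lemma unit_circle_eq: "unit_circle = Fin ` sphere 0 1"
proof -
  have "p \<in> Fin ` sphere 0 1" if "p \<in> unit_circle" for p
    using that by (cases p) (auto simp: unit_circle_def one_ereal_def)
  then show ?thesis by (auto simp: unit_circle_def one_ereal_def)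
qed

lemma closed_outside_disc_eq: "closed_outside_disc = outside_disc \<union> unit_circle"
proof -
  have "1 \<le> x \<longleftrightarrow> 1 < x \<or> x = 1" for x :: ereal by (metis order_le_less)
  then show ?thesis unfolding closed_outside_disc_def outside_disc_def unit_circle_def by blast
qed

lemma rm_analytic_outside_disc: "rm_analytic A outside_disc \<longleftrightarrow> regular_mat disc (smap A)"
  by (metis rm_analytic_Fin rm_analytic_smap xinv_image_disc)

lemma rm_analytic_closed_outside_disc: "rm_analytic A closed_outside_disc \<longleftrightarrow> regular_mat (cball 0 1) (smap A)"
  by (metis rm_analytic_Fin rm_analytic_smap xinv_image_cball)

lemma UNIV_xcomplex: "(UNIV :: xcomplex set) = outside_disc \<union> xinv ` outside_disc \<union> unit_circle"
proof -
  have "p \<in> outside_disc \<union> xinv ` outside_disc \<union> unit_circle" for p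
  proof (cases p)
    case (Fin z)
    consider "cmod z < 1" | "cmod z = 1" | "cmod z > 1" by linarith
    then show ?thesis
    proof cases
      case 1
      then have "xinv p \<in> xinv ` Fin ` disc" unfolding Fin by (intro imageI) simp
      then have "xinv (xinv p) \<in> xinv ` outside_disc" unfolding xinv_image_disc by (rule imageI)
      then show ?thesis by simp
    qed (auto simp: Fin outside_disc_def unit_circle_def one_ereal_def)
  qed (auto simp: outside_disc_def)
  then show ?thesis by blast
qed

section \<open>Evaluation at generic points\<close>

lemma finite_not_regular: "finite {z. \<not> regular z f}"
  by (simp add: regular_iff_denom poly_roots_finite)

lemma finite_not_regular_mat: "finite {z. \<not> regular_mat {z} A}"
proof -
  have "{z. \<not> regular_mat {z} A} \<subseteq> (\<Union>i<dim_row A. \<Union>j<dim_col A. {z. \<not> regular z (A $$ (i, j))})"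
    by (auto simp: regular_mat_def)
  then show ?thesis by (rule finite_subset) (simp add: finite_not_regular)
qed

lemma rm_eval_carrier [simp]: "rm_eval A z \<in> carrier_mat n m \<longleftrightarrow> A \<in> carrier_mat n m"
  by (auto simp: rm_eval_def)

lemma rm_eval_index [simp]:
  "A \<in> carrier_mat n m \<Longrightarrow> i < n \<Longrightarrow> j < m \<Longrightarrow> rm_eval A z $$ (i, j) = rat_eval (A $$ (i, j)) z"
  by (auto simp: rm_eval_def)

lemma rm_eval_one [simp]: "rm_eval (1\<^sub>m n) z = 1\<^sub>m n"
  by (intro eq_matI) (auto simp: rm_eval_def)

lemma rm_eval_mult:
  assumes "regular_mat {z} A" "regular_mat {z} B" "A \<in> carrier_mat n m" "B \<in> carrier_mat m k"
  shows "rm_eval (A * B) z = rm_eval A z * rm_eval B z"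
proof (rule eq_matI)
  have c: "rm_eval A z \<in> carrier_mat n m" "rm_eval B z \<in> carrier_mat m k" using assms by auto
  have AB: "A * B \<in> carrier_mat n k" using assms by simp
  fix i j assume "i < dim_row (rm_eval A z * rm_eval B z)" "j < dim_col (rm_eval A z * rm_eval B z)"
  then have ij: "i < n" "j < k" using c by auto
  have r: "regular z (A $$ (i, l))" "regular z (B $$ (l, j))" if "l < m" for l
    using regular_matD[OF assms(1,3) ij(1) that] regular_matD[OF assms(2,4) that ij(2)] by auto
  have "rm_eval (A * B) z $$ (i, j) = rat_eval (\<Sum>l<m. A $$ (i, l) * B $$ (l, j)) z"
    unfolding rm_eval_index[OF AB ij] mat_mult_index[OF assms(3,4) ij] ..
  also have "\<dots> = (\<Sum>l<m. rat_eval (A $$ (i, l)) z * rat_eval (B $$ (l, j)) z)"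
    using r by (subst rat_eval_sum) (auto simp: rat_eval_mult regular_mult)
  also have "\<dots> = (rm_eval A z * rm_eval B z) $$ (i, j)"
    unfolding mat_mult_index[OF c ij] using ij assms by simp
  finally show "rm_eval (A * B) z $$ (i, j) = (rm_eval A z * rm_eval B z) $$ (i, j)" .
qed (use assms in \<open>auto simp: rm_eval_def\<close>)

text \<open>On the circle the form takes its sign from \<Phi> wherever \<Phi> and v are regular; the
  finitely many other points form the exceptional set of \<open>fejer_riesz\<close>.\<close>

lemma spectrum_form_square:
  assumes "is_spectrum n \<Phi>"
  shows "\<exists>h. sform n \<Phi> v v = star h * h"
proof (rule fejer_riesz)
  have \<Phi>: "\<Phi> \<in> carrier_mat n n" "para_conj \<Phi> = \<Phi>" using assms by (auto simp: is_spectrum_def)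
  show "star (sform n \<Phi> v v) = sform n \<Phi> v v" by (rule star_sform[OF \<Phi>])
  define S where "S = {z. \<not> regular_mat {z} \<Phi>} \<union> (\<Union>i<n. {z. \<not> regular z (v i)})"
  show "finite S" unfolding S_def by (simp add: finite_not_regular_mat finite_not_regular)
  fix z assume z: "cmod z = 1" "z \<notin> S"
  then have r: "regular_mat {z} \<Phi>" "regular z (v i)" if "i < n" for i using that by (auto simp: S_def)
  have r\<Phi>: "regular_mat {z} \<Phi>" using z by (auto simp: S_def)
  have rs: "regular z (star (v i))" if "i < n" for i using r(2)[OF that] z by (simp add: regular_star_circle)
  have rij: "regular z (\<Phi> $$ (i, j))" if "i < n" "j < n" for i j
    using regular_matD[OF r\<Phi> \<Phi>(1) that] by simp
  define x where "x = vec n (\<lambda>i. rat_eval (v i) z)"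
  have x: "x \<in> carrier_vec n" by (simp add: x_def)
  \<comment> \<open>\<open>Arg\<close> ranges from -pi to pi; negative values are shifted to fit the
    interval in \<open>is_spectrum\<close>.\<close>
  define \<omega> where "\<omega> = (if Arg z < 0 then Arg z + 2 * pi else Arg z)"
  have "cis (Arg z) = z" using rcis_cmod_Arg[of z] z(1) by (simp add: rcis_def)
  then have "z = cis \<omega>" by (simp add: \<omega>_def cis_mult[symmetric])
  moreover have "\<omega> \<in> {0..<2 * pi}" using Arg_bounded[of z] by (auto simp: \<omega>_def)
  moreover have "\<not> is_pole_of \<Phi> (Fin z)"
    using r\<Phi> by (auto simp: is_pole_of_def regular_mat_def regular_def)
  ultimately have "pos_semidef n (rm_eval \<Phi> z)" using assms unfolding is_spectrum_def by metis
  then have "0 \<le> Re ((rm_eval \<Phi> z *\<^sub>v x) \<bullet>c x)" using x by (simp add: pos_semidef_def)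
  also have "(rm_eval \<Phi> z *\<^sub>v x) \<bullet>c x
      = (\<Sum>i<n. (\<Sum>j<n. rat_eval (\<Phi> $$ (i, j)) z * rat_eval (v j) z) * cnj (rat_eval (v i) z))"
  proof -
    have d: "dim_row (rm_eval \<Phi> z) = n" "dim_col (rm_eval \<Phi> z) = n" using \<Phi>(1) by (auto simp: rm_eval_def)
    show ?thesis using \<Phi>(1) d
      by (simp add: scalar_prod_def atLeast0LessThan x_def)
  qed
  also have "\<dots> = (\<Sum>i<n. \<Sum>j<n. cnj (rat_eval (v i) z) * rat_eval (\<Phi> $$ (i, j)) z * rat_eval (v j) z)"
    by (intro sum.cong refl, subst sum_distrib_right, intro sum.cong refl, simp)
  also have "\<dots> = rat_eval (sform n \<Phi> v v) z"
    unfolding sform_def using r(2) rs rij z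
    by (subst rat_eval_sum, intro regular_sum regular_mult; simp)
      (intro sum.cong refl, subst rat_eval_sum, auto simp: rat_eval_mult regular_mult rat_eval_star_circle)
  finally show "0 \<le> Re (rat_eval (sform n \<Phi> v v) z)" .
qed

text \<open>The identity L * Y = 1 and its para-conjugate survive evaluation off the poles and make
  the evaluated product a factorization through dimension s with one-sided inverses.\<close>

lemma generic_rank:
  assumes L: "L \<in> carrier_mat s n" and Y: "Y \<in> carrier_mat n s" and LY: "L * Y = 1\<^sub>m s"
  obtains F where "finite F" "\<And>z. z \<notin> F \<Longrightarrow> cmat_rank (rm_eval (para_conj L * L) z) = s"
proof
  define F where "F = {z. \<not> regular_mat {z} L} \<union> {z. \<not> regular_mat {z} Y}
     \<union> {z. \<not> regular_mat {z} (para_conj L)} \<union> {z. \<not> regular_mat {z} (para_conj Y)}"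
  show "finite F" unfolding F_def by (simp add: finite_not_regular_mat)
  fix z assume "z \<notin> F"
  then have r: "regular_mat {z} L" "regular_mat {z} Y" "regular_mat {z} (para_conj L)" "regular_mat {z} (para_conj Y)"
    by (auto simp: F_def)
  have cL: "para_conj L \<in> carrier_mat n s" and cY: "para_conj Y \<in> carrier_mat s n" using L Y by auto
  have "rm_eval (para_conj Y) z * rm_eval (para_conj L) z = 1\<^sub>m s"
    unfolding rm_eval_mult[OF r(4,3) cY cL, symmetric] para_conj_mult[OF L Y, symmetric] LY by simp
  moreover have "rm_eval L z * rm_eval Y z = 1\<^sub>m s"
    unfolding rm_eval_mult[OF r(1,2) L Y, symmetric] LY by simp
  ultimately have "vec_space.rank n (rm_eval (para_conj L) z * rm_eval L z) = s"
    using L Y cL cY by (intro rank_eq_inner_dim[of _ n s _ n]) auto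
  then show "cmat_rank (rm_eval (para_conj L * L) z) = s"
    unfolding cmat_rank_def rm_eval_mult[OF r(3,1) cL L] using L by (simp add: rm_eval_def)
qed

text \<open>A finite set is a null set, so some point outside it also satisfies the
  almost-everywhere condition.\<close>

lemma normal_rank_eq:
  assumes L: "L \<in> carrier_mat s n" and Y: "Y \<in> carrier_mat n s" and LY: "L * Y = 1\<^sub>m s"
    and r: "has_normal_rank (para_conj L * L) r"
  shows "s = r"
proof -
  obtain F where F: "finite F" "\<And>z. z \<notin> F \<Longrightarrow> cmat_rank (rm_eval (para_conj L * L) z) = s"
    using generic_rank[OF L Y LY] by blast
  have "F \<in> null_sets lborel" using F(1) by (intro countable_imp_null_set_lborel countable_finite)
  then have "AE z in lborel. z \<notin> F" by (rule AE_not_in)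
  with r have ae: "AE z in lborel. z \<notin> F \<and> cmat_rank (rm_eval (para_conj L * L) z) = r"
    unfolding has_normal_rank_def by eventually_elim simp
  have "\<exists>z. z \<notin> F \<and> cmat_rank (rm_eval (para_conj L * L) z) = r"
  proof (rule ccontr)
    assume none: "\<not> ?thesis"
    have "AE z in (lborel :: complex measure). False"
      by (rule eventually_mono[OF ae]) (use none in blast)
    then have "emeasure lborel (UNIV :: complex set) = 0"
      by (simp add: AE_iff_null null_sets_def)
    then show False by (simp add: emeasure_lborel_UNIV)
  qed
  then show ?thesis using F(2) by blast
qed

text \<open>\<open>smap\<close> carries L to the disc, where \<open>inner_outer\<close> applies, and
  the resulting factor back. A para-unitary multiplier on the left leaves
  \<open>para_conj L * L\<close> unchanged.\<close>

lemma ex_outer_factor: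
  assumes "is_spectrum n \<Phi>" "has_normal_rank \<Phi> r"
  shows "\<exists>W. is_outer_factor r n \<Phi> W"
proof -
  have \<Phi>: "\<Phi> \<in> carrier_mat n n" "para_conj \<Phi> = \<Phi>" using assms(1) by (auto simp: is_spectrum_def)
  obtain s L Y where L: "L \<in> carrier_mat s n" and Y: "Y \<in> carrier_mat n s"
    and LL: "para_conj L * L = \<Phi>" and LY: "L * Y = 1\<^sub>m s"
    using hermitian_form_factorization[OF \<Phi> spectrum_form_square[OF assms(1)]] by blast
  have s: "s = r" using normal_rank_eq[OF L Y LY] assms(2) LL by simp
  have "smap L * smap Y = 1\<^sub>m r" using smap_mult[OF L Y] LY s by simp
  then obtain U C where U: "para_unitary r U" and C: "C \<in> carrier_mat n r" "(U * smap L) * C = 1\<^sub>m r"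
    "regular_mat disc (U * smap L)" "regular_mat disc C"
    using inner_outer[of "smap L" r n "smap Y"] L Y s by auto
  have Uc: "U \<in> carrier_mat r r" and UU: "para_conj U * U = 1\<^sub>m r" using U by (auto simp: para_unitary_def)
  have L: "L \<in> carrier_mat r n" using L s by simp
  define W where "W = smap U * L"
  have W: "W \<in> carrier_mat r n" using Uc L by (simp add: W_def)
  have sW: "smap W = U * smap L" unfolding W_def using Uc L by (subst smap_mult[of _ r r _ n]) auto
  have sU: "smap U \<in> carrier_mat r r" "para_conj (smap U) \<in> carrier_mat r r" using Uc by auto
  have pL: "para_conj L \<in> carrier_mat n r" using L by simp
  have uu: "para_conj (smap U) * smap U = 1\<^sub>m r"
    unfolding para_conj_smap using Uc UU by (subst smap_mult[of _ r r _ r, symmetric]) auto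
  have "para_conj W * W = para_conj L * (para_conj (smap U) * smap U) * L"
    unfolding W_def para_conj_mult[OF sU(1) L] by (rule mat_mult_regroup[OF pL sU(2,1) L])
  also have "\<dots> = \<Phi>" unfolding uu right_mult_one_mat[OF pL] by (rule LL)
  finally have "is_spectral_factor \<Phi> W" by (simp add: is_spectral_factor_def)
  moreover have "rm_analytic W outside_disc" unfolding rm_analytic_outside_disc sW by (rule C(3))
  moreover have "has_analytic_right_inverse r n W outside_disc"
    unfolding has_analytic_right_inverse_def
  proof (intro bexI conjI)
    show "smap C \<in> carrier_mat n r" using C by simp
    have "smap (smap W * C) = 1\<^sub>m r" using C sW by simp
    then show "W * smap C = 1\<^sub>m r" using W C by (subst (asm) smap_mult[of _ r n _ r]) auto
    show "rm_analytic (smap C) outside_disc" unfolding rm_analytic_outside_disc using C by simp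
  qed
  ultimately show ?thesis using W unfolding is_outer_factor_def by blast
qed

text \<open>For V = L * R the product \<open>para_conj V * L\<close> is
  \<open>para_conj R * \<Phi>\<close>, which is W since \<open>para_conj R\<close> is a left inverse
  of \<open>para_conj W\<close>. Multiplying by R shows that \<open>para_conj V\<close> is a left
  inverse of the square matrix V.\<close>

lemma spectral_factor_para_unitary:
  assumes W: "W \<in> carrier_mat r n" and \<Phi>W: "\<Phi> = para_conj W * W"
    and R: "R \<in> carrier_mat n r" "W * R = 1\<^sub>m r"
    and L: "L \<in> carrier_mat r n" and \<Phi>L: "\<Phi> = para_conj L * L"
  shows "para_unitary r (L * R)" "L = (L * R) * W" "para_conj (L * R) * L = W"
proof -
  let ?V = "L * R"
  have V: "?V \<in> carrier_mat r r" using L R by simp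
  have pR: "para_conj R \<in> carrier_mat r n" and pL: "para_conj L \<in> carrier_mat n r"
    and pW: "para_conj W \<in> carrier_mat n r" using L R W by auto
  have pV: "para_conj ?V = para_conj R * para_conj L" by (rule para_conj_mult[OF L R(1)])
  have RW: "para_conj R * para_conj W = 1\<^sub>m r"
    using para_conj_mult[OF W R(1)] R(2) by simp
  show VL: "para_conj ?V * L = W"
  proof -
    have "para_conj ?V * L = para_conj R * (para_conj L * L)"
      unfolding pV by (rule assoc_mult_mat[OF pR pL L])
    also have "\<dots> = para_conj R * para_conj W * W"
      unfolding \<Phi>L[symmetric] \<Phi>W by (rule assoc_mult_mat[OF pR pW W, symmetric])
    finally show ?thesis using RW W by simp
  qed
  have pVc: "para_conj ?V \<in> carrier_mat r r" using V by simp
  have 1: "para_conj ?V * ?V = 1\<^sub>m r"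
    using assoc_mult_mat[OF pVc L R(1)] VL R(2) by simp
  have 2: "?V * para_conj ?V = 1\<^sub>m r" by (rule right_inverse_square[OF pVc V 1])
  show "para_unitary r ?V" using 1 2 V by (simp add: para_unitary_def)
  have "?V * W = (?V * para_conj ?V) * L"
    unfolding VL[symmetric] by (rule assoc_mult_mat[OF V pVc L, symmetric])
  then show "L = ?V * W" using 2 L by simp
qed

text \<open>Liouville's theorem for rational functions: the denominator has no roots, and regularity
  at infinity bounds the degree of the numerator.\<close>

lemma no_poles_const:
  assumes "\<And>p. pole_mult f p = 0"
  shows "\<exists>c. f = rat_const c"
proof -
  have "degree (cpoly (denom f)) = 0"
  proof (rule ccontr)
    assume "degree (cpoly (denom f)) \<noteq> 0"
    then obtain z where "ceval (denom f) z = 0"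
      using fundamental_theorem_of_algebra constant_degree by metis
    then show False using assms[of "Fin z"] by (metis regular_def regular_iff_denom)
  qed
  then have d: "degree (denom f) = 0" by simp
  then obtain e where e: "denom f = [:e:]" by (rule degree_eq_zeroE)
  have "degree (numer f) = 0" using assms[of Infty] d by (simp add: pole_mult.simps)
  then obtain a where a: "numer f = [:a:]" by (rule degree_eq_zeroE)
  have "e \<noteq> 0" using denom_nonzero[of f] e by auto
  then have "rat_const e * rat_const (a / e) = rat_const a"
    by (simp flip: rat_const_hom(5))
  moreover have "f = rat_const a / rat_const e"
    using numer_denom[of f] unfolding a e rat_const_def .
  moreover have "rat_const e \<noteq> 0" using \<open>e \<noteq> 0\<close> by (simp add: rat_const_def)
  ultimately have "f = rat_const (a / e)" by (metis nonzero_mult_div_cancel_left)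
  then show ?thesis by blast
qed

interpretation rcm: inj_comm_ring_hom rat_const
  by unfold_locales (simp_all add: rat_const_def)

text \<open>The diagonal entry is the sum of \<open>star a * a\<close> over the entries a of column
  j, so circle poles cannot cancel.\<close>

lemma column_pole_mult_circle:
  assumes A: "A \<in> carrier_mat r n" and k: "k < r" "j < n" and p: "p \<in> unit_circle"
  shows "2 * pole_mult (A $$ (k, j)) p \<le> pole_mult ((para_conj A * A) $$ (j, j)) p"
proof -
  obtain z where z: "p = Fin z" "cmod z = 1" using p by (auto simp: unit_circle_eq)
  have pA: "para_conj A \<in> carrier_mat n r" using A by simp
  have "(para_conj A * A) $$ (j, j) = (\<Sum>i<r. star (A $$ (i, j)) * A $$ (i, j))"
    unfolding mat_mult_index[OF pA A k(2) k(2)] using A k by simp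
  then show ?thesis
    using pole_mult_sum_squares_circle[OF z(2), of "{..<r}" k "\<lambda>i. A $$ (i, j)"] k z
    by simp
qed

text \<open>Analyticity of \<open>para_conj V\<close> outside is analyticity of V inside. On the
  circle the diagonal entries of \<open>para_conj V * V\<close> equal 1, sums of squares without
  poles.\<close>

lemma analytic_para_unitary_constant:
  assumes V: "para_unitary r V" and out: "rm_analytic V outside_disc" "rm_analytic (para_conj V) outside_disc"
  shows "\<exists>T. real_orthogonal r T \<and> V = map_mat rat_const T"
proof -
  have Vc: "V \<in> carrier_mat r r" and VV: "para_conj V * V = 1\<^sub>m r" "V * para_conj V = 1\<^sub>m r"
    using V by (auto simp: para_unitary_def)
  have "rm_analytic V unit_circle"
    unfolding rm_analytic_alt
  proof (intro allI impI ballI)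
    fix i j p assume "i < dim_row V" "j < dim_col V" "p \<in> unit_circle"
    then show "pole_mult (V $$ (i, j)) p = 0"
      using column_pole_mult_circle[OF Vc, of i j p] Vc VV(1) by auto
  qed
  then have "rm_analytic V UNIV"
    unfolding UNIV_xcomplex rm_analytic_Un using out by (simp add: rm_analytic_para_conj)
  then have "\<exists>c. V $$ (i, j) = rat_const c" if "i < r" "j < r" for i j
    using that Vc rm_analyticD by (intro no_poles_const) blast
  then obtain t where t: "\<And>i j. i < r \<Longrightarrow> j < r \<Longrightarrow> V $$ (i, j) = rat_const (t i j)" by metis
  define T where "T = mat r r (\<lambda>(i, j). t i j)"
  have T: "T \<in> carrier_mat r r" by (simp add: T_def)
  have VT: "V = map_mat rat_const T" using Vc by (intro eq_matI) (auto simp: T_def t)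
  have pVT: "para_conj V = map_mat rat_const (transpose_mat T)"
    using Vc by (intro eq_matI) (auto simp: T_def t)
  have "map_mat rat_const (transpose_mat T * T) = map_mat rat_const (1\<^sub>m r)"
    using VV(1) T unfolding pVT unfolding VT by (simp add: rat_const.base.mat_hom_mult[of _ r r _ r] rat_const.base.mat_hom_one)
  then have 1: "transpose_mat T * T = 1\<^sub>m r" by (rule rcm.mat_hom_inj)
  have "map_mat rat_const (T * transpose_mat T) = map_mat rat_const (1\<^sub>m r)"
    using VV(2) T unfolding pVT unfolding VT by (simp add: rat_const.base.mat_hom_mult[of _ r r _ r] rat_const.base.mat_hom_one)
  then have "T * transpose_mat T = 1\<^sub>m r" by (rule rcm.mat_hom_inj)
  then show ?thesis using 1 T VT by (auto simp: real_orthogonal_def)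
qed

section \<open>Regularity on the unit circle\<close>

lemma rat_eval_prod:
  "(\<And>x. x \<in> A \<Longrightarrow> regular z (f x)) \<Longrightarrow> rat_eval (prod f A) z = (\<Prod>x\<in>A. rat_eval (f x) z)"
  by (induction A rule: infinite_finite_induct) (simp_all add: rat_eval_mult regular_prod)

lemma signof_cases: "(signof p :: 'a::comm_ring_1) = 1 \<or> (signof p :: 'a) = - 1"
  by (simp add: sign_def)

lemma signof_ratfun: "(signof p :: ratfun) = rat_const (signof p)"
  by (simp add: sign_def)

lemma regular_det:
  assumes "A \<in> carrier_mat n n" "regular_mat {z} A"
  shows "regular z (det A)"
  unfolding det_def'[OF assms(1)]
proof (intro regular_sum regular_mult regular_prod)
  fix p i assume "p \<in> {p. p permutes {0..<n}}" "i \<in> {0..<n}"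
  then have "i < n" "p i < n" using permutes_in_image[of p "{0..<n}" i] by auto
  then show "regular z (A $$ (i, p i))" using regular_matD[OF assms(2,1)] by simp
next
  show "regular z (signof p)" for p by (simp only: signof_ratfun regular_simps)
qed

lemma rat_eval_det:
  assumes A: "A \<in> carrier_mat n n" and r: "regular_mat {z} A"
  shows "rat_eval (det A) z = det (rm_eval A z)"
proof -
  have A': "rm_eval A z \<in> carrier_mat n n" using A by simp
  have reg: "regular z (A $$ (i, p i))" "rm_eval A z $$ (i, p i) = rat_eval (A $$ (i, p i)) z"
    if "p permutes {0..<n}" "i \<in> {0..<n}" for p i
  proof -
    have "i < n" "p i < n" using that permutes_in_image[of p "{0..<n}" i] by auto
    then show "regular z (A $$ (i, p i))" "rm_eval A z $$ (i, p i) = rat_eval (A $$ (i, p i)) z"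
      using regular_matD[OF r A] rm_eval_index[OF A] by auto
  qed
  have rs: "regular z (signof p)" "rat_eval (signof p) z = signof p" for p :: "nat \<Rightarrow> nat"
    unfolding signof_ratfun by (simp_all add: sign_def)
  have "rat_eval (det A) z = (\<Sum>p\<in>{p. p permutes {0..<n}}. rat_eval (signof p * (\<Prod>i = 0..<n. A $$ (i, p i))) z)"
    unfolding det_def'[OF A] using reg(1) rs(1)
    by (intro rat_eval_sum regular_mult regular_prod) auto
  also have "\<dots> = (\<Sum>p\<in>{p. p permutes {0..<n}}. signof p * (\<Prod>i = 0..<n. rm_eval A z $$ (i, p i)))"
  proof (rule sum.cong[OF refl])
    fix p assume "p \<in> {p. p permutes {0..<n}}"
    then have p: "p permutes {0..<n}" by simp
    have "rat_eval (signof p * (\<Prod>i = 0..<n. A $$ (i, p i))) z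
        = rat_eval (signof p) z * rat_eval (\<Prod>i = 0..<n. A $$ (i, p i)) z"
      by (rule rat_eval_mult[OF rs(1) regular_prod]) (rule reg(1)[OF p])
    also have "rat_eval (\<Prod>i = 0..<n. A $$ (i, p i)) z = (\<Prod>i = 0..<n. rat_eval (A $$ (i, p i)) z)"
      by (rule rat_eval_prod) (rule reg(1)[OF p])
    also have "\<dots> = (\<Prod>i = 0..<n. rm_eval A z $$ (i, p i))"
      by (rule prod.cong[OF refl]) (simp only: reg(2)[OF p])
    finally show "rat_eval (signof p * (\<Prod>i = 0..<n. A $$ (i, p i))) z
        = signof p * (\<Prod>i = 0..<n. rm_eval A z $$ (i, p i))" by (simp only: rs(2))
  qed
  also have "\<dots> = det (rm_eval A z)" unfolding det_def'[OF A'] ..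
  finally show ?thesis .
qed

lemma regular_inverse:
  assumes "regular z f" "rat_eval f z \<noteq> 0"
  shows "regular z (1 / f)"
proof -
  obtain a b where f: "f = to_fract a / to_fract b" "ceval b z \<noteq> 0" "b \<noteq> 0"
    using assms(1) by (rule regularE)
  then have "ceval a z \<noteq> 0" using assms(2) rat_eval_quot[OF f(1,2)] by simp
  moreover have "1 / f = to_fract b / to_fract a" using f by simp
  ultimately show ?thesis by (metis regularI)
qed

text \<open>A left kernel vector y of B yields a singular matrix E with E * B = B, namely the
  identity minus e_i0 y^T / y_i0. Inserting E between A and B lowers the inner dimension.\<close>

lemma rank_deficient_product:
  fixes A B :: "complex mat"
  assumes A: "A \<in> carrier_mat n r" and B: "B \<in> carrier_mat r m"
    and y: "i0 < r" "y i0 \<noteq> 0" "\<And>j. j < m \<Longrightarrow> (\<Sum>i<r. y i * B $$ (i, j)) = 0"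
  shows "vec_space.rank n (A * B) < r"
proof -
  define E where "E = mat r r (\<lambda>(i, j). (if i = j then 1 else 0) - (if i = i0 then y j / y i0 else 0))"
  have E: "E \<in> carrier_mat r r" by (simp add: E_def)
  have "E * B = B"
  proof (rule eq_matI)
    fix i j assume "i < dim_row B" "j < dim_col B"
    then have ij: "i < r" "j < m" using B by auto
    have "(E * B) $$ (i, j) = (\<Sum>l<r. (if i = l then B $$ (l, j) else 0) - (if i = i0 then 1 / y i0 else 0) * (y l * B $$ (l, j)))"
      unfolding mat_mult_index[OF E B ij] using ij by (intro sum.cong) (auto simp: E_def algebra_simps)
    also have "\<dots> = B $$ (i, j) - (if i = i0 then 1 / y i0 else 0) * (\<Sum>l<r. y l * B $$ (l, j))"
      using ij by (simp add: sum_subtractf sum_distrib_left)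
    finally show "(E * B) $$ (i, j) = B $$ (i, j)" using y(3)[OF ij(2)] by simp
  qed (use E B in auto)
  have "det E = 0"
  proof -
    have "E *\<^sub>v unit_vec r i0 = 0\<^sub>v r"
    proof (rule eq_vecI)
      fix i assume "i < dim_vec (0\<^sub>v r :: complex vec)"
      then have i: "i < r" by simp
      have "(E *\<^sub>v unit_vec r i0) $ i = E $$ (i, i0)"
        using E i y(1) by simp
      then show "(E *\<^sub>v unit_vec r i0) $ i = 0\<^sub>v r $ i" using i y by (simp add: E_def)
    qed (use E in auto)
    moreover have "unit_vec r i0 \<noteq> (0\<^sub>v r :: complex vec)" using y(1) by simp
    ultimately show ?thesis unfolding det_0_iff_vec_prod_zero_field[OF E] by (metis unit_vec_carrier)
  qed
  then have "vec_space.rank r E < r" by (rule vec_space.det_zero_low_rank[OF E])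
  moreover obtain P Q where PQ: "P \<in> carrier_mat r (vec_space.rank r E)" "Q \<in> carrier_mat (vec_space.rank r E) r" "E = P * Q"
    using rank_factorization[OF E] by blast
  moreover have "A * B = (A * P) * (Q * B)"
  proof -
    have "(A * P) * (Q * B) = A * (P * Q) * B" by (rule mat_mult_regroup[OF A PQ(1,2) B])
    also have "\<dots> = A * (E * B)" unfolding PQ(3)[symmetric] by (rule assoc_mult_mat[OF A E B])
    finally show ?thesis by (simp only: \<open>E * B = B\<close>)
  qed
  moreover have "vec_space.rank n ((A * P) * (Q * B)) \<le> vec_space.rank r E"
    using A B PQ(1,2) by (intro rank_le_inner_dim[of _ n _ _ m]) auto
  ultimately show ?thesis by simp
qed

text \<open>On the circle the value A of \<open>para_conj W\<close> is the conjugate transpose of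
  the value B of W. If B * A kills x, then A x has norm 0, so x is a relation between the rows of B,
  and the rank of A * B falls below r.\<close>

lemma gram_det_nonzero_circle:
  assumes W: "W \<in> carrier_mat r n" and z: "cmod z = 1" and reg: "regular_mat {z} W"
    and rk: "cmat_rank (rm_eval (para_conj W * W) z) = r"
  shows "rat_eval (det (W * para_conj W)) z \<noteq> 0"
proof
  have pW: "para_conj W \<in> carrier_mat n r" using W by simp
  have rij: "regular z (W $$ (i, j))" if "i < r" "j < n" for i j
    using regular_matD[OF reg W that] by simp
  have preg: "regular_mat {z} (para_conj W)"
    unfolding regular_mat_def using W z rij by (auto simp: regular_star_circle)
  have G: "W * para_conj W \<in> carrier_mat r r" using W by simp
  have Greg: "regular_mat {z} (W * para_conj W)" by (rule regular_mat_mult[OF reg preg W pW])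
  define B where "B = rm_eval W z"
  define A where "A = rm_eval (para_conj W) z"
  have B: "B \<in> carrier_mat r n" and A: "A \<in> carrier_mat n r" using W pW by (simp_all add: A_def B_def)
  have AB: "A $$ (j, i) = cnj (B $$ (i, j))" if "i < r" "j < n" for i j
  proof -
    have "A $$ (j, i) = rat_eval (star (W $$ (i, j))) z"
      unfolding A_def rm_eval_index[OF pW that(2,1)] using W that by simp
    also have "\<dots> = cnj (rat_eval (W $$ (i, j)) z)" by (rule rat_eval_star_circle[OF z rij[OF that]])
    finally show ?thesis unfolding B_def rm_eval_index[OF W that] .
  qed
  assume "rat_eval (det (W * para_conj W)) z = 0"
  then have "det (B * A) = 0"
    unfolding rat_eval_det[OF G Greg] unfolding B_def A_def rm_eval_mult[OF reg preg W pW] .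
  moreover have BA: "B * A \<in> carrier_mat r r" using A B by simp
  ultimately obtain x where x: "x \<in> carrier_vec r" "x \<noteq> 0\<^sub>v r" "(B * A) *\<^sub>v x = 0\<^sub>v r"
    using det_0_iff_vec_prod_zero_field[OF BA] by blast
  define w where "w = A *\<^sub>v x"
  have w: "w \<in> carrier_vec n" using A x by (simp add: w_def)
  have wj: "w $ j = (\<Sum>i<r. A $$ (j, i) * x $ i)" if "j < n" for j
    using that A x by (simp add: w_def scalar_prod_def atLeast0LessThan)
  have Bw: "(\<Sum>j<n. B $$ (i, j) * w $ j) = 0" if i: "i < r" for i
  proof -
    have "B *\<^sub>v w = 0\<^sub>v r" using x(3) assoc_mult_mat_vec[OF B A x(1)] by (simp add: w_def)
    then have "(B *\<^sub>v w) $ i = 0" using i by simp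
    then show ?thesis using i B w by (simp add: scalar_prod_def atLeast0LessThan)
  qed
  have "(\<Sum>j<n. of_real ((cmod (w $ j))\<^sup>2)) = (\<Sum>j<n. \<Sum>i<r. cnj (x $ i) * (B $$ (i, j) * w $ j))"
  proof (rule sum.cong[OF refl])
    fix j assume "j \<in> {..<n}"
    then have j: "j < n" by simp
    have "cnj (w $ j) = (\<Sum>i<r. cnj (x $ i) * B $$ (i, j))"
      unfolding wj[OF j] using j by (simp add: AB mult.commute)
    then show "of_real ((cmod (w $ j))\<^sup>2) = (\<Sum>i<r. cnj (x $ i) * (B $$ (i, j) * w $ j))"
      by (simp only: complex_norm_square mult.commute[of "w $ j"] sum_distrib_right mult.assoc)
  qed
  also have "\<dots> = (\<Sum>i<r. cnj (x $ i) * (\<Sum>j<n. B $$ (i, j) * w $ j))"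
    by (subst sum.swap) (simp add: sum_distrib_left)
  also have "\<dots> = 0" using Bw by simp
  finally have "complex_of_real (\<Sum>j<n. (cmod (w $ j))\<^sup>2) = 0" by simp
  then have "(\<Sum>j<n. (cmod (w $ j))\<^sup>2) = 0" by (metis of_real_eq_0_iff)
  then have w0: "w $ j = 0" if "j < n" for j
    using that by (simp add: sum_nonneg_eq_0_iff)
  obtain i0 where i0: "i0 < r" "x $ i0 \<noteq> 0"
    using x(1,2) by (metis carrier_vecD eq_vecI index_zero_vec(1,2))
  have "(\<Sum>i<r. cnj (x $ i) * B $$ (i, j)) = 0" if j: "j < n" for j
  proof -
    have "cnj (w $ j) = (\<Sum>i<r. cnj (x $ i) * B $$ (i, j))"
      unfolding wj[OF j] using j by (simp add: AB mult.commute)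
    then show ?thesis using w0[OF j] by simp
  qed
  then have "vec_space.rank n (A * B) < r"
    using rank_deficient_product[OF A B i0(1), of "\<lambda>i. cnj (x $ i)"] i0 by simp
  then show False
    using rk unfolding cmat_rank_def rm_eval_mult[OF preg reg pW W] using A by (simp add: A_def B_def)
qed

lemma regular_adj_mat:
  assumes A: "A \<in> carrier_mat n n" and r: "regular_mat {z} A"
  shows "regular_mat {z} (adj_mat A)"
  unfolding regular_mat_def
proof (intro allI impI ballI)
  fix i j w assume "i < dim_row (adj_mat A)" "j < dim_col (adj_mat A)" "w \<in> {z}"
  then have ij: "i < n" "j < n" and w: "w = z" using adj_mat(1)[OF A] by auto
  have md: "mat_delete A j i \<in> carrier_mat (n - 1) (n - 1)" by (rule mat_delete_carrier[OF A])
  have "regular_mat {z} (mat_delete A j i)"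
    unfolding regular_mat_def mat_delete_def using A r by (auto simp: regular_mat_def)
  then have "regular z (det (mat_delete A j i))" by (rule regular_det[OF md])
  moreover have "regular z ((- 1) ^ (j + i))" by (rule regular_power) simp
  ultimately show "regular w (adj_mat A $$ (i, j))"
    using A ij w by (simp add: adj_mat_def cofactor_def regular_mult)
qed

text \<open>The inverse is \<open>para_conj W * H\<close>, where H inverts the Gram matrix
  \<open>W * para_conj W\<close>. As adjugate over determinant, H is regular on the circle.\<close>

lemma right_inverse_regular_circle:
  assumes W: "W \<in> carrier_mat r n" and reg: "regular_mat (sphere 0 1) W"
    and rk: "\<And>z. cmod z = 1 \<Longrightarrow> cmat_rank (rm_eval (para_conj W * W) z) = r"
  shows "\<exists>R \<in> carrier_mat n r. W * R = 1\<^sub>m r \<and> regular_mat (sphere 0 1) R"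
proof -
  have pW: "para_conj W \<in> carrier_mat n r" using W by simp
  define G where "G = W * para_conj W"
  have G: "G \<in> carrier_mat r r" using W by (simp add: G_def)
  define g where "g = det G"
  have regz: "regular_mat {z} W" if "cmod z = 1" for z
    using reg that by (auto simp: regular_mat_def)
  have preg: "regular_mat {z} (para_conj W)" if z: "cmod z = 1" for z
    unfolding regular_mat_def using W z regular_matD[OF regz[OF z] W] by (auto simp: regular_star_circle)
  have Greg: "regular_mat {z} G" if "cmod z = 1" for z
    unfolding G_def by (rule regular_mat_mult[OF regz[OF that] preg[OF that] W pW])
  have gz: "rat_eval g z \<noteq> 0" if "cmod z = 1" for z
    unfolding g_def G_def by (rule gram_det_nonzero_circle[OF W that regz[OF that] rk[OF that]])
  have g0: "g \<noteq> 0" using gz[of 1] by auto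
  define H where "H = (1 / g) \<cdot>\<^sub>m adj_mat G"
  have H: "H \<in> carrier_mat r r" using adj_mat(1)[OF G] by (simp add: H_def)
  have "G * H = (1 / g) \<cdot>\<^sub>m (g \<cdot>\<^sub>m 1\<^sub>m r)"
    unfolding H_def using mult_smult_distrib[OF G adj_mat(1)[OF G]] adj_mat(2)[OF G] by (simp add: g_def)
  also have "\<dots> = 1\<^sub>m r" using g0 by (intro eq_matI) auto
  finally have GH: "G * H = 1\<^sub>m r" .
  show ?thesis
  proof (intro bexI conjI)
    show "W * (para_conj W * H) = 1\<^sub>m r"
      using assoc_mult_mat[OF W pW H] GH by (simp add: G_def)
    show "para_conj W * H \<in> carrier_mat n r" using pW H by simp
    have "regular_mat {z} (para_conj W * H)" if z: "cmod z = 1" for z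
    proof (rule regular_mat_mult[OF preg[OF z] _ pW H])
      have "regular z (1 / g)"
        using regular_det[OF G Greg[OF z]] gz[OF z] by (intro regular_inverse) (simp_all add: g_def)
      then show "regular_mat {z} H"
        using regular_adj_mat[OF G Greg[OF z]] unfolding H_def regular_mat_def
        by (auto simp: regular_mult simp del: times_divide_eq_left mult_1)
    qed
    then show "regular_mat (sphere 0 1) (para_conj W * H)"
      by (auto simp: regular_mat_def)
  qed
qed

text \<open>Right inverses without poles in the disc and on the circle are combined by Bezout's identity
  for the denominators of their remaining poles.\<close>

lemma right_inverse_regular_cball:
  assumes W: "W \<in> carrier_mat r n"
    and R: "R \<in> carrier_mat n r" "W * R = 1\<^sub>m r" "regular_mat disc R"
    and S: "S \<in> carrier_mat n r" "W * S = 1\<^sub>m r" "regular_mat (sphere 0 1) S"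
  shows "\<exists>Q \<in> carrier_mat n r. W * Q = 1\<^sub>m r \<and> regular_mat (cball 0 1) Q"
proof -
  define I where "I = {..<n} \<times> {..<r}"
  obtain q where q: "lead_coeff q = 1" "\<And>z. ceval q z = 0 \<Longrightarrow> z \<in> sphere 0 1"
    "\<And>i z. i \<in> I \<Longrightarrow> z \<in> sphere 0 1 \<Longrightarrow> regular z (to_fract q * R $$ i)"
    by (rule clear_poles[of I "sphere 0 1" "\<lambda>i. R $$ i"]) (auto simp: I_def)
  obtain p where p: "lead_coeff p = 1" "\<And>z. ceval p z = 0 \<Longrightarrow> z \<in> disc"
    "\<And>i z. i \<in> I \<Longrightarrow> z \<in> disc \<Longrightarrow> regular z (to_fract p * S $$ i)"
    by (rule clear_poles[of I disc "\<lambda>i. S $$ i"]) (auto simp: I_def)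
  have "coprime q p"
    by (rule coprime_if_no_common_root) (use p q in force)+
  then obtain a b where ab: "a * q + b * p = 1"
    using bezout_coefficients_fst_snd[of q p] by (metis coprime_iff_gcd_eq_1)
  \<comment> \<open>As x + y = 1, the combination of R and S is again a right inverse; the factor q
    in x removes the circle poles of R, the factor p in y the disc poles of S.\<close>
  define x where "x = to_fract (a * q)"
  define y where "y = to_fract (b * p)"
  have xy: "x + y = 1" using ab by (simp add: x_def y_def flip: to_fract_add to_fract_mult)
  define Q where "Q = x \<cdot>\<^sub>m R + y \<cdot>\<^sub>m S"
  have Q: "Q \<in> carrier_mat n r" using R S by (simp add: Q_def)
  have "W * Q = W * (x \<cdot>\<^sub>m R) + W * (y \<cdot>\<^sub>m S)"
    unfolding Q_def using W R(1) S(1) by (intro mult_add_distrib_mat[of _ r n _ r]) auto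
  also have "\<dots> = x \<cdot>\<^sub>m 1\<^sub>m r + y \<cdot>\<^sub>m 1\<^sub>m r"
    using mult_smult_distrib[OF W R(1)] mult_smult_distrib[OF W S(1)] R S by simp
  also have "\<dots> = 1\<^sub>m r" using xy by (intro eq_matI) auto
  finally have WQ: "W * Q = 1\<^sub>m r" .
  have "regular_mat (cball 0 1) Q"
    unfolding regular_mat_def
  proof (intro allI impI ballI)
    fix i j and z :: complex assume "i < dim_row Q" "j < dim_col Q" and z: "z \<in> cball 0 1"
    then have ij: "i < n" "j < r" using Q by auto
    then have I: "(i, j) \<in> I" by (simp add: I_def)
    have Qij: "Q $$ (i, j) = to_fract a * (to_fract q * R $$ (i, j)) + to_fract b * (to_fract p * S $$ (i, j))"
      using ij R(1) S(1) by (simp add: Q_def x_def y_def mult.assoc)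
    have rR: "regular z (to_fract q * R $$ (i, j))"
    proof (cases "z \<in> disc")
      case True
      then show ?thesis using regular_matD[OF R(3,1) ij True] by (intro regular_mult) auto
    next
      case False
      then have "z \<in> sphere 0 1" using z by simp
      then show ?thesis by (rule q(3)[OF I])
    qed
    have rS: "regular z (to_fract p * S $$ (i, j))"
    proof (cases "z \<in> disc")
      case True
      then show ?thesis by (rule p(3)[OF I])
    next
      case False
      then have "z \<in> sphere 0 1" using z by simp
      then show ?thesis using regular_matD[OF S(3,1) ij] by (intro regular_mult) auto
    qed
    show "regular z (Q $$ (i, j))"
      unfolding Qij by (intro regular_add regular_mult[OF _ rR] regular_mult[OF _ rS]) auto
  qed
  then show ?thesis using Q WQ by blast
qed

lemma outer_factor_analytic_circle:
  assumes "is_outer_factor r n \<Phi> W" "rm_analytic \<Phi> unit_circle"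
  shows "rm_analytic W unit_circle"
  unfolding rm_analytic_alt
proof (intro allI impI ballI)
  have W: "W \<in> carrier_mat r n" and \<Phi>: "\<Phi> = para_conj W * W"
    using assms(1) by (auto simp: is_outer_factor_def is_spectral_factor_def)
  have \<Phi>c: "\<Phi> \<in> carrier_mat n n"
    unfolding \<Phi> by (rule mult_carrier_mat[OF para_conj_carrier[OF W] W])
  fix i j p assume "i < dim_row W" "j < dim_col W" and p: "p \<in> unit_circle"
  then have ij: "i < r" "j < n" using W by auto
  show "pole_mult (W $$ (i, j)) p = 0"
    using column_pole_mult_circle[OF W ij p] rm_analyticD[OF assms(2) \<Phi>c ij(2,2) p]
    by (simp flip: \<Phi>)
qed

lemma outer_factor_right_inverse_closed:
  assumes outer: "is_outer_factor r n \<Phi> W" and an: "rm_analytic \<Phi> unit_circle"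
    and rk: "\<And>z. cmod z = 1 \<Longrightarrow> cmat_rank (rm_eval \<Phi> z) = k"
  shows "has_analytic_right_inverse r n W closed_outside_disc"
proof -
  have W: "W \<in> carrier_mat r n" and \<Phi>: "\<Phi> = para_conj W * W"
    using outer by (auto simp: is_outer_factor_def is_spectral_factor_def)
  obtain R where R: "R \<in> carrier_mat n r" "W * R = 1\<^sub>m r" "rm_analytic R outside_disc"
    using outer by (auto simp: is_outer_factor_def has_analytic_right_inverse_def)
  \<comment> \<open>The generic rank r is attained at some circle point, so it is the constant rank
    k.\<close>
  obtain F where F: "finite F" "\<And>z. z \<notin> F \<Longrightarrow> cmat_rank (rm_eval (para_conj W * W) z) = r"
    using generic_rank[OF W R(1,2)] by blast
  obtain t where "cis t \<notin> F"
    using eventually_happens'[OF _ cis_eventually_avoids[OF F(1)]] by (metis at_neq_bot)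
  then have k: "k = r" using F(2)[of "cis t"] rk[of "cis t"] by (simp add: \<Phi>)
  have "regular_mat (sphere 0 1) W"
    using outer_factor_analytic_circle[OF outer an] by (simp add: unit_circle_eq rm_analytic_Fin)
  then obtain S where S: "S \<in> carrier_mat n r" "W * S = 1\<^sub>m r" "regular_mat (sphere 0 1) S"
    using right_inverse_regular_circle[OF W] rk k \<Phi> by blast
  have "smap W * smap R = 1\<^sub>m r"
    using smap_mult[OF W R(1)] unfolding R(2) smap_one by (rule sym)
  moreover have "smap W * smap S = 1\<^sub>m r"
    using smap_mult[OF W S(1)] unfolding S(2) smap_one by (rule sym)
  moreover have "regular_mat (sphere 0 1) (smap S)"
    using S(3) by (auto simp: regular_mat_def regular_star_circle)
  ultimately obtain Q where Q: "Q \<in> carrier_mat n r" "smap W * Q = 1\<^sub>m r" "regular_mat (cball 0 1) Q"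
    using right_inverse_regular_cball[of "smap W" r n "smap R" "smap S"] W R S
    by (auto simp: rm_analytic_outside_disc)
  have "smap (smap W * Q) = 1\<^sub>m r" using Q by simp
  then have "W * smap Q = 1\<^sub>m r" using W Q by (subst (asm) smap_mult[of _ r n _ r]) auto
  then show ?thesis
    unfolding has_analytic_right_inverse_def using Q
    by (intro bexI[of _ "smap Q"]) (auto simp: rm_analytic_closed_outside_disc)
qed

section \<open>Minors and the McMillan degree\<close>

text \<open>Index functions replace index sets: unsorted and repeated indices are allowed, so the
  Cauchy-Binet sum can range over all functions.\<close>

definition minor :: "'a::comm_ring_1 mat \<Rightarrow> nat \<Rightarrow> (nat \<Rightarrow> nat) \<Rightarrow> (nat \<Rightarrow> nat) \<Rightarrow> 'a" where
  "minor A m f g = det (mat m m (\<lambda>(i, j). A $$ (f i, g j)))"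

lemma minor_leibniz:
  "minor A m f g = (\<Sum>p | p permutes {0..<m}. signof p * (\<Prod>i = 0..<m. A $$ (f i, g (p i))))"
proof -
  have "p i < m" if "p permutes {0..<m}" "i < m" for p i
    using permutes_in_image[OF that(1), of i] that(2) by auto
  then show ?thesis
    unfolding minor_def by (subst det_def'[of _ m]) (auto intro!: sum.cong prod.cong)
qed

lemma minor_cong:
  "(\<And>i. i < m \<Longrightarrow> f i = f' i) \<Longrightarrow> (\<And>i. i < m \<Longrightarrow> g i = g' i) \<Longrightarrow> minor A m f g = minor A m f' g'"
  unfolding minor_def by (intro arg_cong[of _ _ det] eq_matI) auto

lemma minor_transpose:
  assumes "\<And>i. i < m \<Longrightarrow> f i < dim_row A" "\<And>i. i < m \<Longrightarrow> g i < dim_col A"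
  shows "minor (transpose_mat A) m g f = minor A m f g"
proof -
  have "mat m m (\<lambda>(i, j). transpose_mat A $$ (g i, f j)) = transpose_mat (mat m m (\<lambda>(i, j). A $$ (f i, g j)))"
    using assms by (intro eq_matI) auto
  then show ?thesis unfolding minor_def by (simp add: det_transpose[of _ m])
qed

lemma minor_permute_rows:
  assumes "p permutes {0..<m}"
  shows "minor A m (f \<circ> p) g = signof p * minor A m f g"
proof -
  have "p i < m" if "i < m" for i using permutes_in_image[OF assms, of i] that by auto
  then have "mat m m (\<lambda>(i, j). A $$ ((f \<circ> p) i, g j))
      = mat m m (\<lambda>(i, j). mat m m (\<lambda>(i, j). A $$ (f i, g j)) $$ (p i, j))"
    by (intro eq_matI) auto
  then show ?thesis unfolding minor_def using det_permute_rows[OF _ assms, of "mat m m (\<lambda>(i, j). A $$ (f i, g j))"]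
    by simp
qed

lemma minor_not_inj:
  assumes "\<not> inj_on f {0..<m}"
  shows "minor A m f g = 0"
proof -
  obtain i j where "i < m" "j < m" "i \<noteq> j" "f i = f j" using assms by (auto simp: inj_on_def)
  then show ?thesis unfolding minor_def
    by (intro det_identical_rows[of _ m i j]) auto
qed

lemma minor_sorted_rows:
  assumes "inj_on f {0..<m}"
  shows "\<exists>c\<in>{1, - 1}. minor A m f g = c * minor A m (pick (f ` {0..<m})) g"
proof -
  define I where "I = f ` {0..<m}"
  have cI: "card I = m" and fI: "finite I" using card_image[OF assms] by (simp_all add: I_def)
  \<comment> \<open>p i is the position of f i in the sorted image of f; the identity beyond m makes
    p a permutation in the sense of \<open>permutes\<close>.\<close>
  define p where "p i = (if i < m then card {a \<in> I. a < f i} else i)" for i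
  have pick: "pick I (p i) = f i" if "i < m" for i
    using that pick_card_in_set[of "f i" I] by (simp add: p_def I_def)
  have pm: "p i < m" if i: "i < m" for i
  proof -
    have "{a \<in> I. a < f i} \<subset> I" using i by (auto simp: I_def)
    then have "card {a \<in> I. a < f i} < card I" using fI by (intro psubset_card_mono)
    then show ?thesis using i cI by (simp add: p_def)
  qed
  have "inj_on p {0..<m}"
  proof (rule inj_onI)
    fix i j assume ij: "i \<in> {0..<m}" "j \<in> {0..<m}" "p i = p j"
    then have "f i = f j" using pick[of i] pick[of j] by simp
    then show "i = j" using assms ij by (auto simp: inj_on_def)
  qed
  moreover have "p ` {0..<m} \<subseteq> {0..<m}" using pm by auto
  ultimately have "bij_betw p {0..<m} {0..<m}"
    by (simp add: bij_betw_def endo_inj_surj)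
  then have p: "p permutes {0..<m}" by (rule bij_imp_permutes) (simp add: p_def)
  have "minor A m f g = minor A m (pick I \<circ> p) g" by (rule minor_cong) (simp_all add: pick)
  also have "\<dots> = signof p * minor A m (pick I) g" by (rule minor_permute_rows[OF p])
  finally show ?thesis using signof_cases[of p] unfolding I_def by (metis insertCI)
qed

text \<open>Summing over all index functions instead of increasing ones overcounts by \<open>fact m\<close>.\<close>

lemma cauchy_binet_fact:
  fixes A B :: "'a::comm_ring_1 mat"
  assumes A: "A \<in> carrier_mat n k" and B: "B \<in> carrier_mat k l"
    and f: "\<And>i. i < m \<Longrightarrow> f i < n" and g: "\<And>i. i < m \<Longrightarrow> g i < l"
  shows "of_nat (fact m) * minor (A * B) m f g
    = (\<Sum>h\<in>{0..<m} \<rightarrow>\<^sub>E {..<k}. minor A m f h * minor B m h g)"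
proof -
  let ?S = "{0..<m} \<rightarrow>\<^sub>E {..<k}" and ?P = "{p. p permutes {0..<m}}"
  have fP: "finite ?P" by (rule finite_permutations) simp
  have fS: "finite ?S" by (intro finite_PiE) auto
  \<comment> \<open>The product over rows of sums becomes a sum over index functions h; for fixed h
    the sum over permutations is a minor of B.\<close>
  have AB: "minor (A * B) m f g = (\<Sum>h\<in>?S. (\<Prod>i = 0..<m. A $$ (f i, h i)) * minor B m h g)"
  proof -
    have "(\<Prod>i = 0..<m. (A * B) $$ (f i, g (p i)))
        = (\<Sum>h\<in>?S. \<Prod>i = 0..<m. A $$ (f i, h i) * B $$ (h i, g (p i)))" if p: "p permutes {0..<m}" for p
    proof -
      have "(\<Prod>i = 0..<m. (A * B) $$ (f i, g (p i)))
          = (\<Prod>i = 0..<m. \<Sum>y<k. A $$ (f i, y) * B $$ (y, g (p i)))"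
      proof (rule prod.cong[OF refl])
        fix i assume "i \<in> {0..<m}"
        then have "f i < n" "g (p i) < l" using f g permutes_in_image[OF p, of i] by auto
        then show "(A * B) $$ (f i, g (p i)) = (\<Sum>y<k. A $$ (f i, y) * B $$ (y, g (p i)))"
          by (rule mat_mult_index[OF A B])
      qed
      also have "\<dots> = (\<Sum>h\<in>?S. \<Prod>i = 0..<m. A $$ (f i, h i) * B $$ (h i, g (p i)))"
        by (rule prod_sum_PiE) auto
      finally show ?thesis .
    qed
    then have "minor (A * B) m f g
        = (\<Sum>p\<in>?P. \<Sum>h\<in>?S. signof p * (\<Prod>i = 0..<m. A $$ (f i, h i) * B $$ (h i, g (p i))))"
      unfolding minor_leibniz by (intro sum.cong refl) (simp add: sum_distrib_left)
    also have "\<dots> = (\<Sum>h\<in>?S. \<Sum>p\<in>?P. signof p * (\<Prod>i = 0..<m. A $$ (f i, h i) * B $$ (h i, g (p i))))"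
      by (rule sum.swap)
    also have "\<dots> = (\<Sum>h\<in>?S. (\<Prod>i = 0..<m. A $$ (f i, h i)) * minor B m h g)"
      unfolding minor_leibniz
      by (intro sum.cong refl) (simp add: prod.distrib sum_distrib_left mult.left_commute)
    finally show ?thesis .
  qed
  have shift: "(\<Sum>h\<in>?S. F h) = (\<Sum>h\<in>?S. F (restrict (h \<circ> q) {0..<m}))" if q: "q permutes {0..<m}"
    for F :: "(nat \<Rightarrow> nat) \<Rightarrow> 'a" and q
  proof -
    have qi: "Hilbert_Choice.inv q permutes {0..<m}" by (rule permutes_inv[OF q])
    have im: "q i < m" "Hilbert_Choice.inv q i < m" if "i < m" for i
      using that permutes_in_image[OF q, of i] permutes_in_image[OF qi, of i] by auto
    have iq: "Hilbert_Choice.inv q (q i) = i" "q (Hilbert_Choice.inv q i) = i" for i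
      using permutes_inverses[OF q] by auto
    have cancel: "restrict (restrict (h \<circ> s) {0..<m} \<circ> t) {0..<m} = h"
      if "h \<in> ?S" "\<And>i. i < m \<Longrightarrow> t i < m" "\<And>i. s (t i) = i" for h :: "nat \<Rightarrow> nat" and s t
      using that by (auto simp: PiE_def extensional_def fun_eq_iff restrict_def)
    have mem: "restrict (h \<circ> s) {0..<m} \<in> ?S"
      if "h \<in> ?S" "\<And>i. i < m \<Longrightarrow> s i < m" for h :: "nat \<Rightarrow> nat" and s
      using that by (auto simp: PiE_def Pi_def)
    show ?thesis
      by (rule sum.reindex_bij_witness[of _ "\<lambda>h. restrict (h \<circ> q) {0..<m}"
            "\<lambda>h. restrict (h \<circ> Hilbert_Choice.inv q) {0..<m}"])
        (simp_all add: cancel mem im iq, auto simp: PiE_iff im)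
  qed
  \<comment> \<open>One copy of the minor for each permutation q, with h replaced by
    \<open>h \<circ> q\<close>: the sign of q appears, and the sum over q completes the minor of
    A.\<close>
  have "of_nat (fact m) * minor (A * B) m f g = (\<Sum>q\<in>?P. minor (A * B) m f g)"
    using card_permutations[of "{0..<m}" m] by simp
  also have "\<dots> = (\<Sum>q\<in>?P. \<Sum>h\<in>?S. signof q * (\<Prod>i = 0..<m. A $$ (f i, h (q i))) * minor B m h g)"
  proof (rule sum.cong[OF refl])
    fix q assume "q \<in> ?P"
    then have q: "q permutes {0..<m}" by simp
    have qm: "q i < m" if "i < m" for i using that permutes_in_image[OF q, of i] by auto
    have "minor B m (restrict (h \<circ> q) {0..<m}) g = signof q * minor B m h g" for h
    proof -
      have "minor B m (restrict (h \<circ> q) {0..<m}) g = minor B m (h \<circ> q) g" by (rule minor_cong) auto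
      then show ?thesis by (simp add: minor_permute_rows[OF q])
    qed
    then show "minor (A * B) m f g = (\<Sum>h\<in>?S. signof q * (\<Prod>i = 0..<m. A $$ (f i, h (q i))) * minor B m h g)"
      unfolding AB by (subst shift[OF q]) (simp add: mult.assoc mult.left_commute)
  qed
  also have "\<dots> = (\<Sum>h\<in>?S. \<Sum>q\<in>?P. signof q * (\<Prod>i = 0..<m. A $$ (f i, h (q i))) * minor B m h g)"
    by (rule sum.swap)
  also have "\<dots> = (\<Sum>h\<in>?S. minor A m f h * minor B m h g)"
    unfolding minor_leibniz[of A] by (simp add: sum_distrib_right)
  finally show ?thesis .
qed

section \<open>Pole degrees through minors\<close>

lemma finite_minor_set:
  "finite {pole_mult (det (submatrix G I J)) p | I J. I \<subseteq> {..<dim_row G} \<and> J \<subseteq> {..<dim_col G} \<and> card I = card J}"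
proof -
  have "{pole_mult (det (submatrix G I J)) p | I J. I \<subseteq> {..<dim_row G} \<and> J \<subseteq> {..<dim_col G} \<and> card I = card J}
    \<subseteq> (\<lambda>(I, J). pole_mult (det (submatrix G I J)) p) ` (Pow {..<dim_row G} \<times> Pow {..<dim_col G})"
    by auto
  then show ?thesis by (rule finite_subset) auto
qed

lemma det_submatrix_eq_minor:
  assumes "I \<subseteq> {..<dim_row G}" "J \<subseteq> {..<dim_col G}" "card I = m" "card J = m"
  shows "det (submatrix G I J) = minor G m (pick I) (pick J)"
proof -
  have "{i. i < dim_row G \<and> i \<in> I} = I" "{j. j < dim_col G \<and> j \<in> J} = J" using assms(1,2) by auto
  then show ?thesis using assms(3,4) by (simp add: submatrix_def minor_def)
qed

text \<open>A repeated index makes the minor 0, and sorting the indices changes only its sign; this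
  leads back to the sets in \<open>pole_degree\<close>.\<close>

lemma pole_mult_minor_le:
  assumes f: "\<And>i. i < m \<Longrightarrow> f i < dim_row G" and g: "\<And>i. i < m \<Longrightarrow> g i < dim_col G"
  shows "pole_mult (minor G m f g) p \<le> pole_degree G p"
proof (cases "inj_on f {0..<m} \<and> inj_on g {0..<m}")
  case False
  have "minor G m f g = 0"
  proof (cases "inj_on f {0..<m}")
    case True
    then have "minor (transpose_mat G) m g f = 0" using False by (intro minor_not_inj) auto
    then show ?thesis using minor_transpose[of m f G g] f g by simp
  qed (rule minor_not_inj)
  then show ?thesis by simp
next
  case True
  define I where "I = f ` {0..<m}"
  define J where "J = g ` {0..<m}"
  have I: "I \<subseteq> {..<dim_row G}" "card I = m" and J: "J \<subseteq> {..<dim_col G}" "card J = m"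
    using f g True by (auto simp: I_def J_def card_image)
  have pI: "pick I i < dim_row G" if "i < m" for i using pick_in_set[of i I] I that by auto
  obtain c where c: "c \<in> {1, - 1}" "minor G m f g = c * minor G m (pick I) g"
    using minor_sorted_rows[of f m G g] True unfolding I_def by blast
  obtain c' where c': "c' \<in> {1, - 1}"
    "minor (transpose_mat G) m g (pick I) = c' * minor (transpose_mat G) m (pick J) (pick I)"
    using minor_sorted_rows[of g m "transpose_mat G" "pick I"] True unfolding J_def by blast
  have pJ: "pick J i < dim_col G" if "i < m" for i using pick_in_set[of i J] J that by auto
  have "minor G m (pick I) g = c' * minor G m (pick I) (pick J)"
    using c'(2) minor_transpose[of m "pick I" G g] minor_transpose[of m "pick I" G "pick J"] pI pJ g by simp
  then have "pole_mult (minor G m f g) p = pole_mult (minor G m (pick I) (pick J)) p"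
    using c c'(1) by auto
  also have "\<dots> = pole_mult (det (submatrix G I J)) p"
    using det_submatrix_eq_minor[OF I(1) J(1) I(2) J(2)] by simp
  also have "\<dots> \<le> pole_degree G p"
  proof -
    have "card I = card J" using I J by simp
    then show ?thesis
      unfolding pole_degree_def using I(1) J(1) by (intro Max_ge[OF finite_minor_set]) blast
  qed
  finally show ?thesis .
qed

lemma pole_degree_attained:
  obtains m f g where "\<And>i. i < m \<Longrightarrow> f i < dim_row G" "\<And>i. i < m \<Longrightarrow> g i < dim_col G"
    "pole_degree G p = pole_mult (minor G m f g) p"
proof -
  let ?S = "{pole_mult (det (submatrix G I J)) p | I J. I \<subseteq> {..<dim_row G} \<and> J \<subseteq> {..<dim_col G} \<and> card I = card J}"
  have "?S \<noteq> {}" by blast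
  then have "pole_degree G p \<in> ?S" unfolding pole_degree_def by (intro Max_in finite_minor_set)
  then obtain I J where IJ: "I \<subseteq> {..<dim_row G}" "J \<subseteq> {..<dim_col G}" "card I = card J"
    "pole_degree G p = pole_mult (det (submatrix G I J)) p" by blast
  have "pick I i < dim_row G" "pick J i < dim_col G" if "i < card J" for i
    using pick_in_set[of i I] pick_in_set[of i J] IJ that by auto
  then show ?thesis
    using that[of "card J" "pick I" "pick J"] IJ det_submatrix_eq_minor[OF IJ(1,2,3) refl] by simp
qed

lemma pole_mult_prod_zero:
  "(\<And>x. x \<in> A \<Longrightarrow> pole_mult (f x) p = 0) \<Longrightarrow> pole_mult (prod f A) p = 0"
proof (induction A rule: infinite_finite_induct)
  case (insert x A)
  then show ?case using pole_mult_mult[of "f x" "prod f A" p] by simp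
qed simp_all

lemma pole_degree_eq_0:
  assumes "\<not> is_pole_of G p"
  shows "pole_degree G p = 0"
proof -
  obtain m f g where fg: "\<And>i. i < m \<Longrightarrow> f i < dim_row G" "\<And>i. i < m \<Longrightarrow> g i < dim_col G"
    "pole_degree G p = pole_mult (minor G m f g) p" by (rule pole_degree_attained) blast
  have "pole_mult (signof q * (\<Prod>i = 0..<m. G $$ (f i, g (q i)))) p \<le> 0" if q: "q permutes {0..<m}" for q
  proof -
    have "pole_mult (\<Prod>i = 0..<m. G $$ (f i, g (q i))) p = 0"
    proof (rule pole_mult_prod_zero)
      fix i assume "i \<in> {0..<m}"
      then have "f i < dim_row G" "g (q i) < dim_col G" using fg permutes_in_image[OF q, of i] by auto
      then show "pole_mult (G $$ (f i, g (q i))) p = 0" using assms by (auto simp: is_pole_of_def)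
    qed
    then show ?thesis
      unfolding signof_ratfun using pole_mult_const_mult[of "signof q"] by (metis)
  qed
  then have "pole_mult (minor G m f g) p \<le> 0"
    unfolding minor_leibniz by (intro pole_mult_sum) auto
  then show ?thesis using fg(3) by simp
qed

lemma of_nat_ratfun: "(of_nat n :: ratfun) = rat_const (of_nat n)"
  by (induction n) simp_all

text \<open>By Cauchy-Binet a minor of A * B is, up to the nonzero constant \<open>fact m\<close>, a
  sum of products of minors of A and B.\<close>

lemma pole_degree_mult:
  assumes A: "A \<in> carrier_mat n k" and B: "B \<in> carrier_mat k l"
  shows "pole_degree (A * B) p \<le> pole_degree A p + pole_degree B p"
proof -
  obtain m f g where fg: "\<And>i. i < m \<Longrightarrow> f i < dim_row (A * B)" "\<And>i. i < m \<Longrightarrow> g i < dim_col (A * B)"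
    "pole_degree (A * B) p = pole_mult (minor (A * B) m f g) p" by (rule pole_degree_attained) blast
  have f: "f i < n" and g: "g i < l" if "i < m" for i using fg(1,2)[OF that] A B by auto
  have "pole_mult (minor (A * B) m f g) p = pole_mult (of_nat (fact m) * minor (A * B) m f g) p"
    unfolding of_nat_ratfun by (rule pole_mult_const_mult_eq[symmetric]) simp
  also have "of_nat (fact m) * minor (A * B) m f g
      = (\<Sum>h\<in>{0..<m} \<rightarrow>\<^sub>E {..<k}. minor A m f h * minor B m h g)"
    by (rule cauchy_binet_fact[OF A B f g])
  also have "pole_mult \<dots> p \<le> pole_degree A p + pole_degree B p"
  proof (rule pole_mult_sum)
    fix h assume "h \<in> {0..<m} \<rightarrow>\<^sub>E {..<k}"
    then have h: "h i < k" if "i < m" for i using that by auto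
    have "pole_mult (minor A m f h * minor B m h g) p \<le> pole_mult (minor A m f h) p + pole_mult (minor B m h g) p"
      by (rule pole_mult_mult)
    also have "\<dots> \<le> pole_degree A p + pole_degree B p"
      using f g h A B by (intro add_mono pole_mult_minor_le) auto
    finally show "pole_mult (minor A m f h * minor B m h g) p \<le> pole_degree A p + pole_degree B p" .
  qed
  finally show ?thesis by (simp only: fg(3))
qed

lemma minor_para_conj:
  assumes A: "A \<in> carrier_mat n k" and f: "\<And>i. i < m \<Longrightarrow> f i < n" and g: "\<And>i. i < m \<Longrightarrow> g i < k"
  shows "minor (para_conj A) m g f = star (minor A m f g)"
proof -
  have "mat m m (\<lambda>(i, j). para_conj A $$ (g i, f j)) = transpose_mat (map_mat star (mat m m (\<lambda>(i, j). A $$ (f i, g j))))"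
    using f g A by (intro eq_matI) auto
  then show ?thesis unfolding minor_def by (simp add: det_transpose[of _ m])
qed

lemma pole_degree_para_conj_le: "pole_degree (para_conj A) p \<le> pole_degree A (xinv p)"
proof -
  obtain m f g where fg: "\<And>i. i < m \<Longrightarrow> f i < dim_row (para_conj A)" "\<And>i. i < m \<Longrightarrow> g i < dim_col (para_conj A)"
    "pole_degree (para_conj A) p = pole_mult (minor (para_conj A) m f g) p" by (rule pole_degree_attained) blast
  then have "pole_degree (para_conj A) p = pole_mult (minor A m g f) (xinv p)"
    using minor_para_conj[of A "dim_row A" "dim_col A" m g f] by (simp add: pole_mult_star)
  also have "\<dots> \<le> pole_degree A (xinv p)" using fg by (intro pole_mult_minor_le) auto
  finally show ?thesis .
qed

lemma pole_degree_para_conj: "pole_degree (para_conj A) p = pole_degree A (xinv p)"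
  using pole_degree_para_conj_le[of A p] pole_degree_para_conj_le[of "para_conj A" "xinv p"] by simp

text \<open>Up to \<open>fact m\<close>, the principal minor of \<open>para_conj W * W\<close> at
  columns g is a sum of \<open>star a * a\<close> over minors a of W in these columns, and on the
  circle nothing cancels.\<close>

lemma pole_degree_gram_circle:
  assumes W: "W \<in> carrier_mat r n" and z: "cmod z = 1"
  shows "2 * pole_degree W (Fin z) \<le> pole_degree (para_conj W * W) (Fin z)"
proof -
  have pW: "para_conj W \<in> carrier_mat n r" using W by simp
  obtain m f g where fg: "\<And>i. i < m \<Longrightarrow> f i < dim_row W" "\<And>i. i < m \<Longrightarrow> g i < dim_col W"
    "pole_degree W (Fin z) = pole_mult (minor W m f g) (Fin z)" by (rule pole_degree_attained) blast
  have g: "g i < n" if "i < m" for i using fg(2)[OF that] W by simp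
  define f' where "f' = restrict f {0..<m}"
  have f': "f' \<in> {0..<m} \<rightarrow>\<^sub>E {..<r}" using fg(1) W by (auto simp: f'_def)
  have "minor W m f g = minor W m f' g" by (rule minor_cong) (auto simp: f'_def)
  then have "2 * pole_degree W (Fin z) = 2 * pole_mult (minor W m f' g) (Fin z)" by (simp only: fg(3))
  also have "\<dots> \<le> pole_mult (\<Sum>h\<in>{0..<m} \<rightarrow>\<^sub>E {..<r}. star (minor W m h g) * minor W m h g) (Fin z)"
    by (rule pole_mult_sum_squares_circle[OF z _ f']) (intro finite_PiE, auto)
  also have "(\<Sum>h\<in>{0..<m} \<rightarrow>\<^sub>E {..<r}. star (minor W m h g) * minor W m h g)
      = (\<Sum>h\<in>{0..<m} \<rightarrow>\<^sub>E {..<r}. minor (para_conj W) m g h * minor W m h g)"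
    using g by (intro sum.cong refl) (subst minor_para_conj[OF W], auto)
  also have "\<dots> = of_nat (fact m) * minor (para_conj W * W) m g g"
    by (rule cauchy_binet_fact[OF pW W g g, symmetric])
  also have "pole_mult (of_nat (fact m) * minor (para_conj W * W) m g g) (Fin z)
      = pole_mult (minor (para_conj W * W) m g g) (Fin z)"
    unfolding of_nat_ratfun by (rule pole_mult_const_mult_eq) simp
  also have "\<dots> \<le> pole_degree (para_conj W * W) (Fin z)"
    using g W by (intro pole_mult_minor_le) auto
  finally show ?thesis .
qed

lemma pole_degree_cnj: "pole_degree A (Fin (cnj z)) = pole_degree A (Fin z)"
  unfolding pole_degree_def pole_mult_cnj ..

text \<open>The upper bound is \<open>pole_degree_mult\<close>. The lower bound uses W =
  \<open>para_conj R * \<Phi>\<close> off the circle, where \<open>para_conj R\<close> is analytic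
  in the disc, and sums of squares of minors on the circle.\<close>

lemma pole_degree_outer_factor:
  assumes "is_outer_factor r n \<Phi> W"
  shows "pole_degree \<Phi> p = pole_degree W p + pole_degree W (xinv p)"
proof -
  have W: "W \<in> carrier_mat r n" and \<Phi>: "\<Phi> = para_conj W * W" and out: "rm_analytic W outside_disc"
    using assms by (auto simp: is_outer_factor_def is_spectral_factor_def)
  obtain R where R: "R \<in> carrier_mat n r" "W * R = 1\<^sub>m r" "rm_analytic R outside_disc"
    using assms by (auto simp: is_outer_factor_def has_analytic_right_inverse_def)
  have pW: "para_conj W \<in> carrier_mat n r" and pR: "para_conj R \<in> carrier_mat r n" using W R by auto
  have \<Phi>c: "\<Phi> \<in> carrier_mat n n" unfolding \<Phi> by (rule mult_carrier_mat[OF pW W])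
  have sym: "para_conj \<Phi> = \<Phi>" unfolding \<Phi> by (simp add: para_conj_mult[OF pW W])
  have le: "pole_degree \<Phi> p \<le> pole_degree W p + pole_degree W (xinv p)" for p
    using pole_degree_mult[OF pW W, of p] by (simp add: \<Phi> pole_degree_para_conj)
  have zero: "pole_degree A p = 0" if "rm_analytic A outside_disc" "p \<in> outside_disc" for A p
    using that by (intro pole_degree_eq_0) (auto simp: rm_analytic_def)
  have RW: "para_conj R * \<Phi> = W"
  proof -
    have "para_conj R * \<Phi> = (para_conj R * para_conj W) * W"
      unfolding \<Phi> by (rule assoc_mult_mat[OF pR pW W, symmetric])
    also have "para_conj R * para_conj W = 1\<^sub>m r"
      using para_conj_mult[OF W R(1)] R(2) by simp
    finally show ?thesis using W by simp
  qed
  have outside: "pole_degree W (xinv p) \<le> pole_degree \<Phi> p" if p: "p \<in> outside_disc" for p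
  proof -
    have "pole_degree W (xinv p) \<le> pole_degree (para_conj R) (xinv p) + pole_degree \<Phi> (xinv p)"
      using pole_degree_mult[OF pR \<Phi>c, of "xinv p"] by (simp add: RW)
    also have "pole_degree (para_conj R) (xinv p) = 0"
      using zero[OF R(3) p] by (simp add: pole_degree_para_conj)
    also have "pole_degree \<Phi> (xinv p) = pole_degree \<Phi> p"
      using pole_degree_para_conj[of \<Phi> p] by (simp add: sym)
    finally show ?thesis by simp
  qed
  have ge: "pole_degree W p + pole_degree W (xinv p) \<le> pole_degree \<Phi> p"
  proof -
    consider "p \<in> outside_disc" | "xinv p \<in> outside_disc" | "p \<in> unit_circle"
      using UNIV_xcomplex by (metis (no_types, lifting) UNIV_I UnE image_iff xinv_xinv)
    then show ?thesis
    proof cases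
      case 1
      then show ?thesis using outside[OF 1] zero[OF out 1] by simp
    next
      case 2
      have "pole_degree \<Phi> (xinv p) = pole_degree \<Phi> p"
        using pole_degree_para_conj[of \<Phi> p] by (simp add: sym)
      then show ?thesis using outside[OF 2] zero[OF out 2] by simp
    next
      case 3
      then obtain z where z: "p = Fin z" "cmod z = 1" by (auto simp: unit_circle_eq)
      then have "z \<noteq> 0" by auto
      \<comment> \<open>On the circle \<open>xinv\<close> is conjugation, which preserves pole
        degrees, so the right side is twice the pole degree of W.\<close>
      then have "xinv p = Fin (cnj z)" using z by (simp add: inverse_unit_complex)
      then have "pole_degree W (xinv p) = pole_degree W p" using z by (simp add: pole_degree_cnj)
      then show ?thesis using pole_degree_gram_circle[OF W z(2)] z by (simp add: \<Phi>)
    qed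
  qed
  show ?thesis using le[of p] ge by simp
qed

section \<open>The McMillan degree as a sum over a reflection-invariant set\<close>

lemma finite_poles: "finite {p. is_pole_of G p}"
proof -
  have "{p. is_pole_of G p} \<subseteq> insert Infty (Fin ` {z. \<not> regular_mat {z} G})"
  proof
    fix p assume "p \<in> {p. is_pole_of G p}"
    then show "p \<in> insert Infty (Fin ` {z. \<not> regular_mat {z} G})"
      by (cases p) (auto simp: is_pole_of_def regular_mat_def regular_def)
  qed
  then show ?thesis by (rule finite_subset) (simp add: finite_not_regular_mat)
qed

lemma mcmillan_degree_superset:
  assumes "finite S" "{p. is_pole_of G p} \<subseteq> S"
  shows "mcmillan_degree G = (\<Sum>p\<in>S. pole_degree G p)"
  unfolding mcmillan_degree_def
proof (rule sum.mono_neutral_left[OF assms], rule ballI)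
  fix p assume "p \<in> S - {p. is_pole_of G p}"
  then show "pole_degree G p = 0" by (intro pole_degree_eq_0) simp
qed

lemma is_pole_of_pole_degree:
  assumes "is_pole_of G p"
  shows "pole_degree G p > 0"
proof -
  obtain i j where ij: "i < dim_row G" "j < dim_col G" "pole_mult (G $$ (i, j)) p > 0"
    using assms unfolding is_pole_of_def by blast
  have "minor G 1 (\<lambda>_. i) (\<lambda>_. j) = G $$ (i, j)"
    unfolding minor_def by (subst det_single) auto
  then show ?thesis
    using pole_mult_minor_le[of 1 "\<lambda>_. i" G "\<lambda>_. j" p] ij by simp
qed

text \<open>Summed over a finite set invariant under \<open>xinv\<close>, the two terms of the local
  identity contribute equally.\<close>

lemma mcmillan_degree_outer_factor:
  assumes "is_outer_factor r n \<Phi> W"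
  shows "mcmillan_degree \<Phi> = 2 * mcmillan_degree W"
proof -
  define P where "P = {p. is_pole_of W p}"
  define S where "S = P \<union> xinv ` P"
  have fS: "finite S" unfolding S_def P_def by (simp add: finite_poles)
  have "{p. is_pole_of \<Phi> p} \<subseteq> S"
  proof
    fix p assume "p \<in> {p. is_pole_of \<Phi> p}"
    then have "pole_degree \<Phi> p > 0" by (simp add: is_pole_of_pole_degree)
    then have "pole_degree W p > 0 \<or> pole_degree W (xinv p) > 0"
      using pole_degree_outer_factor[OF assms, of p] by auto
    then have "p \<in> P \<or> xinv p \<in> P" unfolding P_def using pole_degree_eq_0 by (metis less_irrefl mem_Collect_eq)
    then show "p \<in> S" unfolding S_def by (metis UnI1 UnI2 image_eqI xinv_xinv)
  qed
  then have "mcmillan_degree \<Phi> = (\<Sum>p\<in>S. pole_degree W p + pole_degree W (xinv p))"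
    using mcmillan_degree_superset[OF fS] by (simp add: pole_degree_outer_factor[OF assms])
  also have "\<dots> = (\<Sum>p\<in>S. pole_degree W p) + (\<Sum>p\<in>S. pole_degree W (xinv p))"
    by (rule sum.distrib)
  also have "(\<Sum>p\<in>S. pole_degree W (xinv p)) = (\<Sum>p\<in>S. pole_degree W p)"
    by (rule sum.reindex_bij_witness[of _ xinv xinv]) (auto simp: S_def)
  also have "(\<Sum>p\<in>S. pole_degree W p) = mcmillan_degree W"
    by (rule mcmillan_degree_superset[OF fS, symmetric]) (auto simp: S_def P_def)
  finally show ?thesis by simp
qed

theorem theorem2:
  fixes \<Phi> :: "ratfun mat" and n r :: nat
  assumes "is_spectrum n \<Phi>"
    and "has_normal_rank \<Phi> r"
    and "r \<noteq> 0"
  shows "\<exists>W \<in> carrier_mat r n.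
    is_spectral_factor \<Phi> W \<and>
    (rm_analytic W outside_disc \<and> has_analytic_right_inverse r n W outside_disc) \<and>
    (\<forall>W1. is_outer_factor r n \<Phi> W1 \<longrightarrow>
       (\<exists>T. real_orthogonal r T \<and> W1 = map_mat rat_const T * W)) \<and>
    (\<forall>L \<in> carrier_mat r n. is_spectral_factor \<Phi> L \<and> rm_analytic L outside_disc \<longrightarrow>
       (\<exists>V. para_unitary r V \<and> rm_analytic V outside_disc \<and> L = V * W)) \<and>
    (\<forall>V. para_unitary r V \<and> rm_analytic V outside_disc \<longrightarrow>
       is_spectral_factor \<Phi> (V * W) \<and> rm_analytic (V * W) outside_disc) \<and>
    (rm_analytic \<Phi> unit_circle \<longrightarrow> rm_analytic W closed_outside_disc) \<and>
    (rm_analytic \<Phi> unit_circle \<and>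
       (\<exists>k. \<forall>z. cmod z = 1 \<longrightarrow> cmat_rank (rm_eval \<Phi> z) = k) \<longrightarrow>
       rm_analytic W closed_outside_disc \<and>
       has_analytic_right_inverse r n W closed_outside_disc) \<and>
    (\<forall>W1. is_outer_factor r n \<Phi> W1 \<longrightarrow>
       real (mcmillan_degree W1) = real (mcmillan_degree \<Phi>) / 2)"
proof -
  obtain W where outer: "is_outer_factor r n \<Phi> W" using ex_outer_factor[OF assms(1,2)] by blast
  then have W: "W \<in> carrier_mat r n" and sf: "is_spectral_factor \<Phi> W"
    and an: "rm_analytic W outside_disc" and inv: "has_analytic_right_inverse r n W outside_disc"
    by (auto simp: is_outer_factor_def)
  have \<Phi>: "\<Phi> = para_conj W * W" using sf by (simp add: is_spectral_factor_def)
  obtain R where R: "R \<in> carrier_mat n r" "W * R = 1\<^sub>m r" "rm_analytic R outside_disc"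
    using inv by (auto simp: has_analytic_right_inverse_def)
  have 3: "\<exists>T. real_orthogonal r T \<and> W1 = map_mat rat_const T * W" if W1: "is_outer_factor r n \<Phi> W1" for W1
  proof -
    have c1: "W1 \<in> carrier_mat r n" and \<Phi>1: "\<Phi> = para_conj W1 * W1" and an1: "rm_analytic W1 outside_disc"
      using W1 by (auto simp: is_outer_factor_def is_spectral_factor_def)
    obtain R1 where R1: "R1 \<in> carrier_mat n r" "W1 * R1 = 1\<^sub>m r" "rm_analytic R1 outside_disc"
      using W1 by (auto simp: is_outer_factor_def has_analytic_right_inverse_def)
    note V = spectral_factor_para_unitary[OF W \<Phi> R(1,2) c1 \<Phi>1]
    have Vc: "W1 * R \<in> carrier_mat r r" using c1 R by simp
    \<comment> \<open>The para-conjugate of the multiplier W1 * R equals W * R1 and is therefore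
      analytic outside as well.\<close>
    have "para_conj (W1 * R) = (para_conj (W1 * R) * W1) * R1"
      using assoc_mult_mat[OF para_conj_carrier[OF Vc] c1 R1(1)] R1(2)
        right_mult_one_mat[OF para_conj_carrier[OF Vc]] by simp
    then have "rm_analytic (para_conj (W1 * R)) outside_disc"
      unfolding V(3) using rm_analytic_mult[OF an R1(3) W R1(1)] by simp
    then obtain T where "real_orthogonal r T" "W1 * R = map_mat rat_const T"
      using analytic_para_unitary_constant[OF V(1) rm_analytic_mult[OF an1 R(3) c1 R(1)]] by blast
    then show ?thesis using V(2) by auto
  qed
  have 4: "\<exists>V. para_unitary r V \<and> rm_analytic V outside_disc \<and> L = V * W"
    if L: "L \<in> carrier_mat r n" "is_spectral_factor \<Phi> L" "rm_analytic L outside_disc" for L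
    using spectral_factor_para_unitary[OF W \<Phi> R(1,2) L(1)] L(2) rm_analytic_mult[OF L(3) R(3) L(1) R(1)]
    unfolding is_spectral_factor_def by blast
  have conv: "is_spectral_factor \<Phi> (V * W)" "rm_analytic (V * W) outside_disc"
    if V: "para_unitary r V" "rm_analytic V outside_disc" for V
  proof -
    have Vc: "V \<in> carrier_mat r r" and VV: "para_conj V * V = 1\<^sub>m r" using V(1) by (auto simp: para_unitary_def)
    have pW: "para_conj W \<in> carrier_mat n r" and pV: "para_conj V \<in> carrier_mat r r" using W Vc by auto
    have "para_conj (V * W) * (V * W) = para_conj W * (para_conj V * V) * W"
      unfolding para_conj_mult[OF Vc W] by (rule mat_mult_regroup[OF pW pV Vc W])
    also have "\<dots> = \<Phi>" unfolding VV right_mult_one_mat[OF pW] by (rule \<Phi>[symmetric])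
    finally show "is_spectral_factor \<Phi> (V * W)" by (simp add: is_spectral_factor_def)
    show "rm_analytic (V * W) outside_disc" by (rule rm_analytic_mult[OF V(2) an Vc W])
  qed
  have 5: "rm_analytic W closed_outside_disc" if "rm_analytic \<Phi> unit_circle"
    using outer_factor_analytic_circle[OF outer that] an
    by (simp add: closed_outside_disc_eq rm_analytic_Un)
  have 6: "has_analytic_right_inverse r n W closed_outside_disc"
    if "rm_analytic \<Phi> unit_circle" "\<exists>k. \<forall>z. cmod z = 1 \<longrightarrow> cmat_rank (rm_eval \<Phi> z) = k"
    using outer_factor_right_inverse_closed[OF outer that(1)] that(2) by blast
  have 7: "real (mcmillan_degree W1) = real (mcmillan_degree \<Phi>) / 2" if "is_outer_factor r n \<Phi> W1" for W1
    using mcmillan_degree_outer_factor[OF that] by simp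
  show ?thesis
    using W sf an inv 3 4 conv 5 6 7 by (intro bexI[of _ W]) blast+
qed

end
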